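(* Let $\mathbf p$ be a domino type partition of $2n$. Then the H-algorithm of metaplectic type applied to $\mathbf p$ produces the metaplectic special partition $\mathbf p_{\frac12}=((\mathbf b^* )_D)^*$ of type $C_n$, where $\mathbf b$ is the special partition of type $D_n$ attached to $\mathbf p$.
   Context: A domino type partition of $2n$ is a partition equal to the shape of the Robinson–Schensted (row insertion) tableau of ${}^-w=(-w(n),\dots,-w(1),w(1),\dots,w(n))$ for some signed permutation $w$ of $\{\pm1,\dots,\pm n\}$. $\mathbf d^*$ denotes the transpose partition. A partition of $2n$ is of type $D$ (resp. $C$) if its even (resp. odd) parts occur with even multiplicity; the $D$-collapse $\mathbf d_D$ is the largest (dominance order) type $D$ partition of $2n$ dominated by $\mathbf d$. The special partition $\mathbf b$ of type $D$ attached to $\mathbf p$. A $D$-symbol is a class of arrays $\binom{\lambda_1<\dots<\lambda_m}{\mu_1<\dots<\mu_m}$ of nonnegative integers modulo the shift to $\binom{0,\lambda_1+1,\dots,\lambda_m+1}{0,\mu_1+1,\dots,\mu_m+1}$ and the exchange of rows; it is special if $\lambda_1\le\mu_1\le\lambda_2\le\dots\le\lambda_m\le\mu_m$ up to exchange of rows. For $\mathbf p=[p_1,p_2,\dots]$ (extended by zeros, $p_{2m+2}=0$) there is an array $\binom{\lambda_1<\dots<\lambda_{m+1}}{\mu_1<\dots<\mu_m}$ with $\{2\lambda_i,2\mu_j+1\}=\{p_k+2m+1-k\mid1\le k\le2m+1\}$ as multisets; the $D$-symbol of $\mathbf p$ is $\binom{\lambda_1,\ \lambda_2,\ \dots,\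 \lambda_{m+1}}{0,\mu_1+1,\dots,\mu_m+1}$. A type $D$ partition $[d_1,\dots,d_k]$ ($k$ even) has the $D$-symbol with $\{2\lambda_i+1,2\mu_j\}=\{d_l+k-l\mid1\le l\le k\}$. $\mathbf b$ is the type $D$ partition whose $D$-symbol is the unique special $D$-symbol with the same multiset of entries as the $D$-symbol of $\mathbf p$. H-algorithm of metaplectic type. Let $P$ be the Young diagram of $\mathbf p$. The box $(k,l)$ is even (E) if $k+l$ is even, odd (O) otherwise. (1) Form $P^{\mathrm{ev}}$, the set of even boxes of $P$, with the rows of $P$ remembered. (2) Label the rows from the top by $1,2,3,\dots$, but skip every pair of consecutive rows $i,i+1$ of equal length in $P$ such that the last box of row $i$ is O and the last box of row $i+1$ is E. (3) Keep even labeled rows unchanged and put an O on the end of each odd labeled row (immediately to the right of its last remaining box). (4) Fill the holes, i.e. take the smallest Young diagram containing all boxes; if it has only $2n-1$ boxes, add one box below the last row in the first column. *)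

theory Defs
  imports Main "HOL-Library.Multiset"
begin

section \<open>Partitions and Young diagrams\<close>

text \<open>A partition is the weakly decreasing list of its positive parts.\<close>

definition is_partition :: "nat \<Rightarrow> nat list \<Rightarrow> bool" where
  "is_partition N p \<longleftrightarrow> sorted_wrt (\<ge>) p \<and> 0 \<notin> set p \<and> sum_list p = N"

text \<open>Parts are numbered from 1, and a partition is extended by zeros.\<close>

definition part :: "nat list \<Rightarrow> nat \<Rightarrow> nat" where
  "part p k = (if 1 \<le> k \<and> k \<le> length p then p ! (k - 1) else 0)"

text \<open>A box is a pair (row, column), both counted from 1, rows from top to bottom.\<close>

definition diagram :: "nat list \<Rightarrow> (nat \<times> nat) set" where
  "diagram p = {(k, l). 1 \<le> k \<and> 1 \<le> l \<and> l \<le> part p k}"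

definition is_young_diagram :: "(nat \<times> nat) set \<Rightarrow> bool" where
  "is_young_diagram Y \<longleftrightarrow> finite Y \<and> (\<forall>(k, l) \<in> Y. 1 \<le> k \<and> 1 \<le> l) \<and>
     (\<forall>(k, l) \<in> Y. \<forall>k' l'. 1 \<le> k' \<and> k' \<le> k \<and> 1 \<le> l' \<and> l' \<le> l \<longrightarrow> (k', l') \<in> Y)"

definition num_rows :: "(nat \<times> nat) set \<Rightarrow> nat" where
  "num_rows Y = card {k. (k, 1) \<in> Y}"

definition row_lengths :: "(nat \<times> nat) set \<Rightarrow> nat list" where
  "row_lengths Y = map (\<lambda>k. card {l. (k, l) \<in> Y}) [1..<Suc (num_rows Y)]"

definition conjugate :: "nat list \<Rightarrow> nat list" where
  "conjugate p = row_lengths {(l, k). (k, l) \<in> diagram p}"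

definition dominated_by :: "nat list \<Rightarrow> nat list \<Rightarrow> bool" where
  "dominated_by d e \<longleftrightarrow> (\<forall>k. sum_list (take k d) \<le> sum_list (take k e))"

definition is_type_D :: "nat \<Rightarrow> nat list \<Rightarrow> bool" where
  "is_type_D n d \<longleftrightarrow> is_partition (2 * n) d \<and> (\<forall>x \<in> set d. even x \<longrightarrow> even (count_list d x))"

definition is_type_C :: "nat \<Rightarrow> nat list \<Rightarrow> bool" where
  "is_type_C n d \<longleftrightarrow> is_partition (2 * n) d \<and> (\<forall>x \<in> set d. odd x \<longrightarrow> even (count_list d x))"

definition D_collapse :: "nat \<Rightarrow> nat list \<Rightarrow> nat list" where
  "D_collapse n d = (THE e. is_type_D n e \<and> dominated_by e d \<and>
     (\<forall>f. is_type_D n f \<and> dominated_by f d \<longrightarrow> dominated_by f e))"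


section \<open>Robinson--Schensted row insertion and domino type partitions\<close>

fun row_insert :: "int \<Rightarrow> int list list \<Rightarrow> int list list" where
  "row_insert x [] = [[x]]"
| "row_insert x (r # rs) =
     (case dropWhile (\<lambda>y. y \<le> x) r of
        [] \<Rightarrow> (r @ [x]) # rs
      | y # ys \<Rightarrow> (takeWhile (\<lambda>y. y \<le> x) r @ x # ys) # row_insert y rs)"

definition rs_tableau :: "int list \<Rightarrow> int list list" where
  "rs_tableau xs = fold row_insert xs []"

definition signed_perm :: "nat \<Rightarrow> (int \<Rightarrow> int) \<Rightarrow> bool" where
  "signed_perm n w \<longleftrightarrow> bij_betw w ({- int n..int n} - {0}) ({- int n..int n} - {0}) \<and>
     (\<forall>i \<in> {- int n..int n} - {0}. w (- i) = - w i)"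

definition neg_word :: "nat \<Rightarrow> (int \<Rightarrow> int) \<Rightarrow> int list" where
  "neg_word n w = map (\<lambda>i. - w i) (rev [1..int n]) @ map w [1..int n]"

definition domino_type :: "nat \<Rightarrow> nat list \<Rightarrow> bool" where
  "domino_type n p \<longleftrightarrow> is_partition (2 * n) p \<and>
     (\<exists>w. signed_perm n w \<and> p = map length (rs_tableau (neg_word n w)))"


section \<open>D-symbols\<close>

text \<open>An array is the pair of its upper and lower row.\<close>

type_synonym array = "nat list \<times> nat list"

definition is_D_array :: "array \<Rightarrow> bool" where
  "is_D_array A \<longleftrightarrow> length (fst A) = length (snd A) \<and>
     sorted_wrt (<) (fst A) \<and> sorted_wrt (<) (snd A)"

inductive D_move :: "array \<Rightarrow> array \<Rightarrow> bool" where
  shift: "D_move (ls, us) (0 # map Suc ls, 0 # map Suc us)"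
| exchange: "D_move (ls, us) (us, ls)"

definition D_symbol :: "array \<Rightarrow> array set" where
  "D_symbol A = {B. is_D_array B \<and> equivclp D_move A B}"

definition is_D_symbol :: "array set \<Rightarrow> bool" where
  "is_D_symbol S \<longleftrightarrow> (\<exists>A. is_D_array A \<and> S = D_symbol A)"

definition interlaced :: "array \<Rightarrow> bool" where
  "interlaced A \<longleftrightarrow> (\<forall>i < length (fst A). fst A ! i \<le> snd A ! i \<and>
     (Suc i < length (fst A) \<longrightarrow> snd A ! i \<le> fst A ! Suc i))"

text \<open>A D-symbol contains, with each array, the one with its rows exchanged, and the
  shift preserves interlacing in both directions.\<close>

definition special_D_symbol :: "array set \<Rightarrow> bool" where
  "special_D_symbol S \<longleftrightarrow> is_D_symbol S \<and> (\<exists>A \<in> S. interlaced A)"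

definition entries :: "array \<Rightarrow> nat multiset" where
  "entries A = mset (fst A) + mset (snd A)"

text \<open>The shift changes the multiset of entries; two D-symbols have the same entries if
  they have them in representatives of the same size.\<close>

definition same_entries :: "array set \<Rightarrow> array set \<Rightarrow> bool" where
  "same_entries S T \<longleftrightarrow> (\<exists>A \<in> S. \<exists>B \<in> T. entries A = entries B)"

text \<open>The D-symbol of a domino type partition; it does not depend on \<open>m\<close>.\<close>

definition D_symbol_of_domino :: "nat list \<Rightarrow> array set \<Rightarrow> bool" where
  "D_symbol_of_domino p S \<longleftrightarrow> (\<exists>m ls us. length p \<le> 2 * m + 1 \<and>
     length ls = m + 1 \<and> length us = m \<and> sorted_wrt (<) ls \<and> sorted_wrt (<) us \<and>
     image_mset (\<lambda>x. 2 * x) (mset ls) + image_mset (\<lambda>x. 2 * x + 1) (mset us)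
       = mset (map (\<lambda>k. part p k + 2 * m + 1 - k) [1..<2 * m + 2]) \<and>
     S = D_symbol (ls, 0 # map Suc us))"

definition D_symbol_of_type_D :: "nat list \<Rightarrow> array set \<Rightarrow> bool" where
  "D_symbol_of_type_D d S \<longleftrightarrow> even (length d) \<and> (\<exists>ls us. is_D_array (ls, us) \<and>
     image_mset (\<lambda>x. 2 * x + 1) (mset ls) + image_mset (\<lambda>x. 2 * x) (mset us)
       = mset (map (\<lambda>l. part d l + length d - l) [1..<Suc (length d)]) \<and>
     S = D_symbol (ls, us))"

definition attached_special_D :: "nat \<Rightarrow> nat list \<Rightarrow> nat list" where
  "attached_special_D n p = (THE b. is_type_D n b \<and>
     (\<exists>S T. D_symbol_of_domino p S \<and> D_symbol_of_type_D b T \<and>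
        special_D_symbol T \<and> same_entries S T))"

definition metaplectic_special :: "nat \<Rightarrow> nat list \<Rightarrow> nat list" where
  "metaplectic_special n p = conjugate (D_collapse n (conjugate (attached_special_D n p)))"


section \<open>The H-algorithm of metaplectic type\<close>

definition even_boxes :: "nat list \<Rightarrow> (nat \<times> nat) set" where
  "even_boxes p = {(k, l) \<in> diagram p. even (k + l)}"

definition skip_pair :: "nat list \<Rightarrow> nat \<Rightarrow> bool" where
  "skip_pair p i \<longleftrightarrow> 1 \<le> i \<and> i + 1 \<le> length p \<and> part p i = part p (i + 1) \<and>
     odd (i + part p i) \<and> even ((i + 1) + part p (i + 1))"

definition labeled_rows :: "nat list \<Rightarrow> nat set" where
  "labeled_rows p = {i \<in> {1..length p}. \<not> (\<exists>j. skip_pair p j \<and> (i = j \<or> i = j + 1))}"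

definition row_label :: "nat list \<Rightarrow> nat \<Rightarrow> nat" where
  "row_label p i = card {j \<in> labeled_rows p. j \<le> i}"

text \<open>Only a row of length 1 with even row number has no even box;
  an O put on its end goes to its first column.\<close>

definition last_even_col :: "nat list \<Rightarrow> nat \<Rightarrow> nat" where
  "last_even_col p i = Max (insert 0 {l. (i, l) \<in> even_boxes p})"

definition H_boxes :: "nat list \<Rightarrow> (nat \<times> nat) set" where
  "H_boxes p = even_boxes p \<union>
     {(i, last_even_col p i + 1) | i. i \<in> labeled_rows p \<and> odd (row_label p i)}"

definition fill_holes :: "(nat \<times> nat) set \<Rightarrow> (nat \<times> nat) set" where
  "fill_holes B = \<Inter> {Y. is_young_diagram Y \<and> B \<subseteq> Y}"

definition H_diagram :: "nat \<Rightarrow> nat list \<Rightarrow> (nat \<times> nat) set" where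
  "H_diagram n p = (let Y = fill_holes (H_boxes p) in
     if card Y + 1 = 2 * n then insert (num_rows Y + 1, 1) Y else Y)"

definition H_metaplectic :: "nat \<Rightarrow> nat list \<Rightarrow> nat list" where
  "H_metaplectic n p = row_lengths (H_diagram n p)"

end

theory Submission
  imports Defs "HOL-Library.Product_Lexorder" "HOL-Library.Product_Plus"
begin

text \<open>
  A domino type partition has as many rows of odd length with odd as with even row number.
  Indeed the permutation \<open>w\<close> is a point set symmetric under rotation by 180 degrees, and the
  Robinson--Schensted shape grows by Fomin's local rules when extremal points are added. A cube
  argument turns the rule for a rightmost and a topmost point into rules for the other pairs of
  directions. Consequently shapes are invariant under rotation, so removing the leftmost and the
  rightmost point of a symmetric set separately removes the same box, and removing both removes
  a domino.

  The rest is explicit. Write \<open>p k\<close> for the parts of \<open>\<^bold>p\<close>. Reading off the interlaced symbol shows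
  that the parts of \<open>\<^bold>b\<close> are \<open>p k\<close>, except that for even \<open>p k\<close> one subtracts 1 if \<open>k\<close> is odd and
  \<open>p (k + 1) \<noteq> p k\<close>, and adds 1 if \<open>k\<close> is even and \<open>p (k - 1) \<noteq> p k\<close>. The conjugate of a type
  \<open>D\<close> partition has even partial sums at odd indices, so transposing the collapse amounts to
  finding the smallest partition above \<open>\<^bold>b\<close> with that property. Its parts are obtained from
  \<open>\<^bold>p\<close> in the same way with the parities of both parts and row numbers reversed. In the
  H-algorithm skipping pairs of rows preserves the parity of the labels, and the algorithm yields
  the same partition; in particular it already has \<open>2n\<close> boxes after filling the holes.
\<close>

section \<open>Two boxes added by a pair of extremal points\<close>

text \<open>Row insertion is governed by a rule for a rightmost and a topmost point, but a symmetric
  set has to be dismantled by pairs \<open>p\<close>, \<open>- p\<close> that are extremal on the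
  right and on the left. For such a pair the smaller shapes do not determine the larger one: when
  both points add the same box, the second box may stand beside it or below it, as two points in
  increasing or decreasing position already show. Only the relation \<open>domino_rule\<close>
  remains; it is enough because either domino has signed box count zero. The left/top rule, in
  contrast, is deterministic, which makes a uniqueness argument for the rotation possible. The two
  new rules are proved together, because a cube for either of them has faces of the other kind. In
  the second half, balance of the odd rows enters twice: it makes the corrected parts in
  \<open>special_partition p\<close> add up to \<open>2 * n\<close>, and it gives the two rows of
  the symbol of \<open>p\<close> the lengths \<open>m + 1\<close> and \<open>m\<close>. Shapes of
  point sets are functions with rows counted from 0, whereas \<open>part\<close> counts from
  1.\<close>

definition inc :: "(nat \<Rightarrow> nat) \<Rightarrow> nat \<Rightarrow> nat \<Rightarrow> nat" where
  "inc f a = f(a := Suc (f a))"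

lemma inc_apply: "inc f a i = (if i = a then Suc (f i) else f i)"
  by (simp add: inc_def)

lemma inc_commute: "inc (inc f a) b = inc (inc f b) a"
  by (auto simp: inc_def)

lemma inc_inject [simp]: "inc f a = inc f b \<longleftrightarrow> a = b"
  by (metis inc_apply n_not_Suc_n)

lemma antimono_inc_iff:
  assumes "antimono f"
  shows "antimono (inc f a) \<longleftrightarrow> (\<forall>i. a = Suc i \<longrightarrow> f a < f i)"
proof -
  have "f (Suc i) \<le> f i" for i
    using assms by (simp add: antimono_iff_le_Suc)
  then show ?thesis
    by (auto simp: antimono_iff_le_Suc inc_apply Suc_le_eq le_Suc_eq)
qed

text \<open>The row of the box that ends the column to the right of the box added to row \<open>b\<close>.\<close>

definition next_col_row :: "(nat \<Rightarrow> nat) \<Rightarrow> nat \<Rightarrow> nat" where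
  "next_col_row f b = (LEAST i. f i \<le> Suc (f b))"

lemma next_col_row_eqI:
  assumes "f r \<le> Suc (f b)" and "\<And>i. i < r \<Longrightarrow> Suc (f b) < f i"
  shows "next_col_row f b = r"
  unfolding next_col_row_def
  by (rule Least_equality) (use assms in \<open>auto simp: not_less[symmetric]\<close>)

lemma next_col_row_props:
  shows "f (next_col_row f b) \<le> Suc (f b)"
    and "i < next_col_row f b \<Longrightarrow> Suc (f b) < f i"
    and "next_col_row f b \<le> b"
proof -
  show "f (next_col_row f b) \<le> Suc (f b)"
    unfolding next_col_row_def by (rule LeastI[of _ b]) simp
  show "i < next_col_row f b \<Longrightarrow> Suc (f b) < f i"
    unfolding next_col_row_def by (metis not_less_Least not_le)
  show "next_col_row f b \<le> b"
    unfolding next_col_row_def by (rule Least_le) simp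
qed

text \<open>How the row \<open>b'\<close> of the last of two boxes depends on the rows \<open>a\<close>, \<open>b\<close> of the boxes
  that the two points add separately, for two points extremal in opposite directions:
  if \<open>a = b\<close>, the two boxes form a domino.\<close>

definition domino_rule :: "(nat \<Rightarrow> nat) \<Rightarrow> nat \<Rightarrow> nat \<Rightarrow> nat \<Rightarrow> bool" where
  "domino_rule f a b b' \<longleftrightarrow>
     (if a = b then b' = a \<or> (b' = Suc a \<and> f (Suc a) = f a) else b' = b)"

text \<open>Read \<open>f\<close> as the shape of a set to which a rightmost point \<open>p\<close>,
  a leftmost \<open>q\<close> and a topmost \<open>t\<close> can be added, alone in rows
  \<open>a\<close>, \<open>b\<close>, \<open>c\<close>. Then \<open>a'\<close> and \<open>c'\<close>
  are the rows of \<open>p\<close> and \<open>t\<close> after \<open>q\<close>, \<open>c''\<close>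
  is the row of \<open>t\<close> after \<open>p\<close>, and \<open>\<mu>\<close> is the shape with
  all three points. Four faces of the cube obey known rules; the conclusions are the rules on the
  other two, for \<open>q\<close>, \<open>t\<close> after \<open>p\<close> and for \<open>p\<close>,
  \<open>q\<close> after \<open>t\<close>. Boxes interact only where rows coincide, hence the case
  distinction.\<close>

lemma cube_rule:
  fixes f :: "nat \<Rightarrow> nat"
  assumes f: "antimono f" and fa: "antimono (inc f a)" and fb: "antimono (inc f b)"
    and fc: "antimono (inc f c)"
    and dr: "domino_rule f b a a'" and fab: "antimono (inc (inc f b) a')"
    and c'_def: "c' = (if b = c then next_col_row f b else c)"
    and \<mu>: "\<mu> = inc (inc (inc f b) a') (if a' = c' then Suc a' else c')"
    and c''_def: "c'' = (if a = c then Suc a else c)"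
  shows "\<exists>b'. inc (inc f b) a' = inc (inc f a) b' \<and>
           \<mu> = inc (inc (inc f a) b') (if b' = c'' then next_col_row (inc f a) b' else c'')"
    and "\<exists>a3 b3 x. inc (inc f a) c'' = inc (inc f c) a3 \<and> inc (inc f b) c' = inc (inc f c) b3 \<and>
           \<mu> = inc (inc (inc f c) a3) x \<and> domino_rule (inc f c) a3 b3 x"
proof -
  let ?g1 = "\<exists>b'. inc (inc f b) a' = inc (inc f a) b' \<and>
           \<mu> = inc (inc (inc f a) b') (if b' = c'' then next_col_row (inc f a) b' else c'')"
  let ?g2 = "\<exists>a3 b3 x. inc (inc f a) c'' = inc (inc f c) a3 \<and> inc (inc f b) c' = inc (inc f c) b3 \<and>
           \<mu> = inc (inc (inc f c) a3) x \<and> domino_rule (inc f c) a3 b3 x"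
  have add: "f r < f i" if "antimono (inc f r)" "r = Suc i" for r i
    using that f by (simp add: antimono_inc_iff)
  have addb: "f b < f i" if ib: "i < b" for i
  proof -
    obtain j where j: "b = Suc j" using ib by (cases b) auto
    with ib have "i \<le> j" by simp
    then have "f j \<le> f i" using f by (simp add: antimono_def)
    with add[OF fb j] show ?thesis by simp
  qed
  define r where "r = next_col_row f b"
  have r: "f r \<le> Suc (f b)" "\<And>i. i < r \<Longrightarrow> Suc (f b) < f i" "r \<le> b"
    using next_col_row_props unfolding r_def by blast+
  have g1I: "?g1" if "inc (inc f b) a' = inc (inc f a) b'"
    "\<mu> = inc (inc (inc f a) b') (if b' = c'' then next_col_row (inc f a) b' else c'')" for b'
    using that by blast
  have g2I: "?g2" if "inc (inc f a) c'' = inc (inc f c) a3" "inc (inc f b) c' = inc (inc f c) b3"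
    "\<mu> = inc (inc (inc f c) a3) x" "domino_rule (inc f c) a3 b3 x" for a3 b3 x
    using that by blast
  consider "a \<noteq> b" "b \<noteq> c" "a \<noteq> c" | "a = b" "b \<noteq> c" | "a = c" "b \<noteq> c"
    | "b = c" "a \<noteq> b" | "a = b" "b = c" by blast
  then have "?g1 \<and> ?g2"
  proof cases
    case 1
    then have "a' = a" "c' = c" "c'' = c"
      using dr c'_def c''_def by (auto simp: domino_rule_def)
    with 1 \<mu> show ?thesis
      by (intro conjI g1I[of b] g2I[of a b b]) (simp_all add: domino_rule_def inc_commute)
  next
    case 2
    then have c: "c' = c" "c'' = c" "a' = a \<or> (a' = Suc a \<and> f (Suc a) = f a)"
      using dr c'_def c''_def by (auto simp: domino_rule_def)
    \<comment> \<open>In the vertical case rows \<open>a\<close> and \<open>Suc a\<close> have equal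
      length, so row \<open>Suc a\<close> cannot receive the box of \<open>t\<close>.\<close>
    have ne: "c \<noteq> a'"
      using add[OF fc, of a] c 2 by auto
    have d: "domino_rule (inc f c) a a a'"
      using 2 c(3) ne by (auto simp: domino_rule_def inc_apply)
    show ?thesis
      using 2 c(1,2) \<mu> ne d
      by (intro conjI g1I[of a'] g2I[of a a a']) (simp_all add: inc_commute)
  next
    case 3
    then have c: "a' = a" "c' = a" "c'' = Suc a" "c = a"
      using dr c'_def c''_def by (auto simp: domino_rule_def)
    have \<mu>': "\<mu> = inc (inc (inc f a) b) (Suc a)"
      using \<mu> c by (simp add: inc_commute)
    show ?thesis
    \<comment> \<open>The collision of \<open>p\<close> and \<open>t\<close> sends the second box to
      row \<open>Suc a\<close>. If this is the row of \<open>q\<close>, then after \<open>t\<close>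
      the points \<open>p\<close> and \<open>q\<close> add the same box and form a horizontal
      domino.\<close>
    proof (cases "b = Suc a")
      case True
      have lt: "f (Suc a) < f a" using add[OF fb True] True by simp
      have "next_col_row (inc f a) b = Suc a"
      proof (rule next_col_row_eqI)
        fix i assume "i < Suc a"
        then have "inc f a a \<le> inc f a i"
          using fa by (auto simp: antimono_def)
        then show "Suc (inc f a b) < inc f a i"
          using lt True by (auto simp: inc_apply)
      qed (auto simp: True inc_apply)
      then show ?thesis
        using True c \<mu>' 
        by (intro conjI g1I[of b] g2I[of b b b]) (simp_all add: domino_rule_def inc_commute)
    next
      case False
      then show ?thesis
        using c \<mu>' 3(2) False
        by (intro conjI g1I[of b] g2I[of "Suc a" b b]) (simp_all add: domino_rule_def inc_commute)
    qed
  next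
    case 4
    then have c: "a' = a" "c' = r" "c'' = b" "c = b"
      using dr c'_def c''_def by (auto simp: domino_rule_def r_def)
    show ?thesis
    \<comment> \<open>The collision of \<open>q\<close> and \<open>t\<close> sends a box to the end
      of the next column, in row \<open>r\<close>. If this is the row of \<open>p\<close>, then row
      \<open>a\<close> is exactly one longer than row \<open>b\<close>, and after \<open>t\<close>
      the boxes of \<open>p\<close> and \<open>q\<close> form a vertical domino.\<close>
    proof (cases "a = r")
      case True
      with r 4 have "a < b" by simp
      then have fa1: "f a = Suc (f b)"
        using r(1) addb[of a] True by simp
      have "f (Suc a) \<le> f a" using f by (simp add: antimono_def)
      have n: "next_col_row (inc f a) b = Suc a"
      proof (rule next_col_row_eqI)
        show "inc f a (Suc a) \<le> Suc (inc f a b)"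
          using \<open>f (Suc a) \<le> f a\<close> fa1 4 by (auto simp: inc_apply)
      next
        fix i assume i: "i < Suc a"
        show "Suc (inc f a b) < inc f a i"
          using r(2)[of i] i True 4 fa1 by (cases "i = a") (auto simp: inc_apply)
      qed
      have "inc f b (Suc a) = inc f b a"
        using addb[of "Suc a"] \<open>a < b\<close> fa1 \<open>f (Suc a) \<le> f a\<close>
        by (cases "Suc a = b") (auto simp: inc_apply)
      then have d: "domino_rule (inc f b) a a (Suc a)"
        by (simp add: domino_rule_def)
      have m: "\<mu> = inc (inc (inc f b) a) (Suc a)"
        using \<mu> c True by simp
      have ?g1
        using c m n by (intro g1I[of b]) (simp_all add: inc_commute)
      moreover have ?g2
        using c m d True 
        by (intro g2I[of a a "Suc a"]) (simp_all add: inc_commute)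
      ultimately show ?thesis by blast
    next
      case False
      have n: "next_col_row (inc f a) b = r"
      proof (rule next_col_row_eqI)
        fix i assume "i < r"
        then show "Suc (inc f a b) < inc f a i"
          using r(2)[of i] 4 by (auto simp: inc_apply)
      qed (use r 4 False in \<open>auto simp: inc_apply\<close>)
      then have ?g1
        using c \<mu> False by (intro g1I[of b]) (simp_all add: inc_commute)
      moreover have ?g2
        using c \<mu> False
        by (intro g2I[of a r r]) (simp_all add: inc_commute domino_rule_def)
      ultimately show ?thesis by blast
    qed
  next
    case 5
    then have c: "c' = r" "c'' = Suc a" "a' = a \<or> (a' = Suc a \<and> f (Suc a) = f a)"
      using dr c'_def c''_def by (auto simp: domino_rule_def r_def)
    have e: "a = b" "c = b" using 5 by auto
    \<comment> \<open>All three points add the same box. After \<open>t\<close>, the box of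
      \<open>p\<close> moves to the next row and that of \<open>q\<close> to the next column, so
      these two no longer meet, whichever domino they formed before.\<close>
    from c(3) show ?thesis
    proof
      assume a': "a' = a"
      have "r = b"
        unfolding r_def
      proof (rule next_col_row_eqI)
        fix i assume "i < b"
        then obtain j where j: "b = Suc j" "i \<le> j" by (cases b) auto
        then have "inc f b b < inc f b j"
          using fab fb a' e by (subst (asm) antimono_inc_iff) auto
        moreover have "f j \<le> f i" using j f by (simp add: antimono_def)
        ultimately show "Suc (f b) < f i" using j by (auto simp: inc_apply)
      qed simp
      have ?g1
        using c a' e \<mu> \<open>r = b\<close>
        by (intro g1I[of b]) (simp_all add: inc_commute)
      moreover have ?g2
        using c a' e \<mu> \<open>r = b\<close>
        by (intro g2I[of "Suc b" b b]) (simp_all add: inc_commute domino_rule_def)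
      ultimately show ?thesis by blast
    next
      assume a': "a' = Suc a \<and> f (Suc a) = f a"
      have n: "next_col_row (inc f a) (Suc a) = r"
      proof (rule next_col_row_eqI)
        show "inc f a r \<le> Suc (inc f a (Suc a))"
          using r(1) a' e by (auto simp: inc_apply)
        fix i assume "i < r"
        then show "Suc (inc f a (Suc a)) < inc f a i"
          using r(2)[of i] a' e by (auto simp: inc_apply)
      qed
      have ne: "Suc b \<noteq> r" using r(3) by simp
      have m: "\<mu> = inc (inc (inc f b) (Suc b)) r"
        using \<mu> a' c e ne by simp
      have ?g1
        using m n a' c e ne
        by (intro g1I[of "Suc b"]) simp_all
      moreover have ?g2
        using m n a' c e ne
        by (intro g2I[of "Suc b" r r]) (simp_all add: inc_commute domino_rule_def)
      ultimately show ?thesis by blast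
    qed
  qed
  then show ?g1 ?g2 by blast+
qed

section \<open>Growth rules for point sets\<close>

type_synonym point = "int \<times> int"

definition generic :: "point set \<Rightarrow> bool" where
  "generic A \<longleftrightarrow> finite A \<and> inj_on fst A \<and> inj_on snd A"

lemma generic_subset: "generic A \<Longrightarrow> B \<subseteq> A \<Longrightarrow> generic B"
  unfolding generic_def by (meson finite_subset inj_on_subset)

definition highest :: "(point \<Rightarrow> int) \<Rightarrow> point \<Rightarrow> point set \<Rightarrow> bool" where
  "highest h p A \<longleftrightarrow> (\<forall>z\<in>A. h z < h p)"

lemma highest_insert [simp]: "highest h p (insert q A) \<longleftrightarrow> h q < h p \<and> highest h p A"
  by (auto simp: highest_def)

lemma highest_notin: "highest h p A \<Longrightarrow> p \<notin> A"
  by (auto simp: highest_def)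

text \<open>A coordinate is injective only on generic sets, hence the relativization.\<close>

definition separating :: "(point \<Rightarrow> int) \<Rightarrow> bool" where
  "separating h \<longleftrightarrow> (\<forall>A. generic A \<longrightarrow> inj_on h A)"

lemma separating_coords:
  "separating fst" "separating snd" "separating (\<lambda>z. - fst z)" "separating (\<lambda>z. - snd z)"
  by (auto simp: separating_def generic_def inj_on_def)

lemma obtain_highest:
  assumes "generic A" and "A \<noteq> {}" and "separating h"
  obtains p A0 where "A = insert p A0" and "highest h p A0" and "p \<notin> A0"
proof -
  have "finite (h ` A)" "h ` A \<noteq> {}" using assms by (auto simp: generic_def)
  then obtain p where p: "p \<in> A" "h p = Max (h ` A)"
    using Max_in by (metis imageE)
  have "highest h p (A - {p})"
    unfolding highest_def
  proof
    fix z assume z: "z \<in> A - {p}"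
    have "h z \<le> h p" using p z \<open>finite (h ` A)\<close> by simp
    moreover have "h z \<noteq> h p"
      using z p(1) assms(1,3) by (auto simp: separating_def inj_on_def)
    ultimately show "h z < h p" by simp
  qed
  with p that[of p "A - {p}"] show thesis by (simp add: insert_absorb)
qed

text \<open>Fomin's local rules: \<open>K\<close> gives the row of the box added by a point that is highest in
  both coordinates, and \<open>N\<close> the row of the second box when the highest points in the two
  coordinates separately add the same box.\<close>

definition growth :: "((nat \<Rightarrow> nat) \<Rightarrow> nat) \<Rightarrow> ((nat \<Rightarrow> nat) \<Rightarrow> nat \<Rightarrow> nat) \<Rightarrow>
    (point \<Rightarrow> int) \<Rightarrow> (point \<Rightarrow> int) \<Rightarrow> (point set \<Rightarrow> nat \<Rightarrow> nat) \<Rightarrow> bool" where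
  "growth K N hx hy S \<longleftrightarrow> S {} = (\<lambda>_. 0) \<and>
     (\<forall>A p. generic (insert p A) \<and> highest hx p A \<and> highest hy p A \<longrightarrow>
        S (insert p A) = inc (S A) (K (S A))) \<and>
     (\<forall>A p t a c. generic (insert p (insert t A)) \<and>
        highest hx p (insert t A) \<and> highest hy t (insert p A) \<and>
        S (insert p A) = inc (S A) a \<and> S (insert t A) = inc (S A) c \<longrightarrow>
        S (insert p (insert t A)) = inc (inc (S A) a) (if a = c then N (S A) a else c))"

lemma growth_empty: "growth K N hx hy S \<Longrightarrow> S {} = (\<lambda>_. 0)"
  by (simp add: growth_def)

lemma growth_corner:
  "growth K N hx hy S \<Longrightarrow> generic (insert p A) \<Longrightarrow> highest hx p A \<Longrightarrow> highest hy p A \<Longrightarrow>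
     S (insert p A) = inc (S A) (K (S A))"
  unfolding growth_def by blast

lemma growth_step:
  "growth K N hx hy S \<Longrightarrow> generic (insert p (insert t A)) \<Longrightarrow> highest hx p (insert t A) \<Longrightarrow>
     highest hy t (insert p A) \<Longrightarrow> S (insert p A) = inc (S A) a \<Longrightarrow> S (insert t A) = inc (S A) c \<Longrightarrow>
     S (insert p (insert t A)) = inc (inc (S A) a) (if a = c then N (S A) a else c)"
  unfolding growth_def by blast

text \<open>The rule is symmetric in the two points, because \<open>inc\<close> commutes and
  \<open>N\<close> is consulted only when \<open>a = c\<close>.\<close>

lemma growth_swap:
  assumes "growth K N hx hy S"
  shows "growth K N hy hx S"
  unfolding growth_def
proof (intro conjI allI impI)
  show "S {} = (\<lambda>_. 0)" using growth_empty[OF assms] .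
next
  fix A p assume "generic (insert p A) \<and> highest hy p A \<and> highest hx p A"
  then show "S (insert p A) = inc (S A) (K (S A))" using growth_corner[OF assms] by blast
next
  fix A p t a c
  assume *: "generic (insert p (insert t A)) \<and> highest hy p (insert t A) \<and>
    highest hx t (insert p A) \<and> S (insert p A) = inc (S A) a \<and> S (insert t A) = inc (S A) c"
  then have "S (insert t (insert p A)) = inc (inc (S A) c) (if c = a then N (S A) c else a)"
    by (intro growth_step[OF assms]) (auto simp: insert_commute)
  then show "S (insert p (insert t A)) = inc (inc (S A) a) (if a = c then N (S A) a else c)"
    by (auto simp: insert_commute inc_commute)
qed

lemma growth_cong:
  assumes "growth K N hx hy S" and "\<And>A. generic A \<Longrightarrow> S' A = S A"
  shows "growth K N hx hy S'"
proof -
  have e: "S' {} = S {}" using assms(2) by (simp add: generic_def)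
  have g: "generic (insert p (insert t A)) \<Longrightarrow> generic (insert p A) \<and> generic (insert t A) \<and> generic A"
    "generic (insert p A) \<Longrightarrow> generic A" for p t A
    by (auto elim!: generic_subset)
  show ?thesis
    unfolding growth_def
  proof (intro conjI allI impI)
    show "S' {} = (\<lambda>_. 0)" using e growth_empty[OF assms(1)] by simp
  next
    fix A p assume "generic (insert p A) \<and> highest hx p A \<and> highest hy p A"
    with g(2) show "S' (insert p A) = inc (S' A) (K (S' A))"
      using growth_corner[OF assms(1)] assms(2) by metis
  next
    fix A p t a c
    assume *: "generic (insert p (insert t A)) \<and> highest hx p (insert t A) \<and>
      highest hy t (insert p A) \<and> S' (insert p A) = inc (S' A) a \<and> S' (insert t A) = inc (S' A) c"
    then have "S' A = S A" "S' (insert p A) = S (insert p A)" "S' (insert t A) = S (insert t A)"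
      "S' (insert p (insert t A)) = S (insert p (insert t A))"
      using g assms(2) by blast+
    with * show "S' (insert p (insert t A)) = inc (inc (S' A) a) (if a = c then N (S' A) a else c)"
      using growth_step[OF assms(1)] by metis
  qed
qed

lemma growth_image:
  assumes "growth K N hx hy S" and "\<And>A. generic A \<Longrightarrow> generic (\<phi> ` A)"
  shows "growth K N (hx \<circ> \<phi>) (hy \<circ> \<phi>) (\<lambda>A. S (\<phi> ` A))"
proof -
  have h: "highest (h \<circ> \<phi>) p A \<longleftrightarrow> highest h (\<phi> p) (\<phi> ` A)" for h p A
    by (auto simp: highest_def)
  show ?thesis
    unfolding growth_def h image_insert image_empty
  proof (intro conjI allI impI)
    show "S {} = (\<lambda>_. 0)" using growth_empty[OF assms(1)] .
  next
    fix A p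
    assume "generic (insert p A) \<and> highest hx (\<phi> p) (\<phi> ` A) \<and> highest hy (\<phi> p) (\<phi> ` A)"
    then show "S (insert (\<phi> p) (\<phi> ` A)) = inc (S (\<phi> ` A)) (K (S (\<phi> ` A)))"
      using assms(2)[of "insert p A"] by (intro growth_corner[OF assms(1)]) simp_all
  next
    fix A p t a c
    assume "generic (insert p (insert t A)) \<and>
      highest hx (\<phi> p) (insert (\<phi> t) (\<phi> ` A)) \<and> highest hy (\<phi> t) (insert (\<phi> p) (\<phi> ` A)) \<and>
      S (insert (\<phi> p) (\<phi> ` A)) = inc (S (\<phi> ` A)) a \<and> S (insert (\<phi> t) (\<phi> ` A)) = inc (S (\<phi> ` A)) c"
    then show "S (insert (\<phi> p) (insert (\<phi> t) (\<phi> ` A))) =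
        inc (inc (S (\<phi> ` A)) a) (if a = c then N (S (\<phi> ` A)) a else c)"
      using assms(2)[of "insert p (insert t A)"] by (intro growth_step[OF assms(1)]) simp_all
  qed
qed

text \<open>Unless \<open>p\<close> is highest in both directions, remove the highest point
  \<open>t\<close> in the other direction. The rule for \<open>p\<close> and \<open>t\<close> over
  the remaining set then exhibits the large shape as that of \<open>A\<close> with one more
  box.\<close>

lemma growth_row:
  assumes g: "growth K N hx hy S" and x: "separating hx" and y: "separating hy"
    and "generic (insert p A)" and "highest hx p A \<or> highest hy p A"
  shows "\<exists>a. S (insert p A) = inc (S A) a"
  using assms(4,5)
proof (induction "card A" arbitrary: A p)
  case 0
  then have "A = {}" using generic_subset[of "insert p A" A] by (auto simp: generic_def)
  then show ?case
    using growth_corner[OF g, of p A] 0 by (auto simp: highest_def)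
next
  case (Suc n)
  have *: "\<exists>a. S (insert p A) = inc (S A) a"
    if g: "growth K N hx hy S" and y: "separating hy"
      and ge: "generic (insert p A)" and hp: "highest hx p A" and n: "Suc n = card A"
      and IH: "\<And>A p. n = card A \<Longrightarrow> generic (insert p A) \<Longrightarrow> highest hx p A \<or> highest hy p A \<Longrightarrow>
        \<exists>a. S (insert p A) = inc (S A) a"
    for hx hy
  proof (cases "highest hy p A")
    case True
    then show ?thesis using growth_corner[OF g ge hp] by blast
  next
    case False
    have "generic A" "A \<noteq> {}" using ge n by (auto elim: generic_subset)
    then obtain t A0 where t: "A = insert t A0" "highest hy t A0" "t \<notin> A0"
      using obtain_highest y by metis
    have "inj_on hy (insert p A)" using y ge by (auto simp: separating_def)
    moreover have "p \<notin> A" using hp highest_notin by blast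
    ultimately have "hy p \<noteq> hy t" using t by (auto simp: inj_on_def)
    moreover have "\<not> hy t < hy p"
      using False t by (force simp: highest_def)
    ultimately have ht: "highest hy t (insert p A0)" using t by simp
    have n0: "n = card A0" using n t \<open>generic A\<close> by (simp add: generic_def)
    have "generic (insert p A0)" "generic (insert t A0)" 
      using t ge by (auto elim: generic_subset)
    then obtain a c where "S (insert p A0) = inc (S A0) a" "S (insert t A0) = inc (S A0) c"
      using IH[OF n0] hp t by (metis highest_insert)
    then have "S (insert p A) = inc (S A) (if a = c then N (S A0) a else a)"
      using growth_step[OF g, of p t A0 a c] ge hp ht t(1) by (auto simp: inc_commute)
    then show ?thesis by blast
  qed
  from Suc.prems(2) show ?case
  proof
    assume "highest hx p A"
    then show ?thesis
      by (rule *[OF g y Suc.prems(1) _ Suc.hyps(2)]) (use Suc.hyps(1) in blast)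
  next
    assume "highest hy p A"
    then show ?thesis
      by (rule *[OF growth_swap[OF g] x Suc.prems(1) _ Suc.hyps(2)]) (use Suc.hyps(1) in blast)
  qed
qed

text \<open>Removing the highest points of the two directions separately and together leaves three
  smaller sets whose shapes determine the given one.\<close>

lemma growth_unique:
  assumes g: "growth K N hx hy S" and g': "growth K N hx hy S'"
    and x: "separating hx" and y: "separating hy" and "generic A"
  shows "S A = S' A"
  using assms(5)
proof (induction "card A" arbitrary: A rule: less_induct)
  case less
  show ?case
  proof (cases "A = {}")
    case True
    then show ?thesis using growth_empty g g' by metis
  next
    case False
    then obtain p B where p: "A = insert p B" "highest hx p B" "p \<notin> B"
      using obtain_highest x less.prems by metis
    have fin: "finite A" "finite B" using less.prems p(1) by (auto simp: generic_def)
    have eqB: "S B = S' B"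
      using less p fin by (metis card_insert_disjoint generic_subset lessI subset_insertI)
    show ?thesis
    proof (cases "highest hy p B")
      case True
      then show ?thesis
        using growth_corner[OF g, of p B] growth_corner[OF g', of p B] p less.prems eqB by simp
    next
      case False
      then have "B \<noteq> {}" by (auto simp: highest_def)
      moreover have "generic B" using less.prems p(1) by (auto elim: generic_subset)
      ultimately obtain t C where t: "B = insert t C" "highest hy t C" "t \<notin> C"
        using obtain_highest y by metis
      have "inj_on hy A" using y less.prems by (auto simp: separating_def)
      then have "hy p \<noteq> hy t" using t p by (auto simp: inj_on_def)
      moreover have "\<not> hy t < hy p" using False t by (force simp: highest_def)
      ultimately have ht: "highest hy t (insert p C)" using t by simp
      have gen: "generic (insert p C)" "generic (insert t C)" "generic C"
        using t p less.prems by (auto elim: generic_subset)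
      have "finite C" using gen(3) by (simp add: generic_def)
      then have c: "card (insert p C) < card A" "card (insert t C) < card A" "card C < card A"
        using p t by auto
      have hpC: "highest hx p C" using p t by simp
      obtain a c where "S (insert p C) = inc (S C) a" "S (insert t C) = inc (S C) c"
        using growth_row[OF g x y] gen hpC t(2) by metis
      moreover have "S (insert p C) = S' (insert p C)" "S (insert t C) = S' (insert t C)" "S C = S' C"
        using less.hyps c gen by blast+
      ultimately show ?thesis
        using growth_step[OF g, of p t C a c] growth_step[OF g', of p t C a c] less.prems p t ht
        by simp
    qed
  qed
qed

lemma growth_support:
  assumes g: "growth K N hx hy S" and x: "separating hx" and y: "separating hy" and "generic A"
  shows "\<exists>M. \<forall>i\<ge>M. S A i = 0"
  using assms(4)
proof (induction "card A" arbitrary: A)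
  case 0
  then have "A = {}" by (auto simp: generic_def)
  then show ?case using growth_empty[OF g] by simp
next
  case (Suc n)
  then obtain p B where p: "A = insert p B" "highest hx p B" "p \<notin> B"
    using obtain_highest x by (metis card.empty nat.distinct(1))
  have B: "generic B" using Suc.prems p(1) by (auto elim: generic_subset)
  then have "n = card B" using Suc.hyps(2) p by (simp add: generic_def)
  with Suc.hyps(1) B obtain M where "\<forall>i\<ge>M. S B i = 0" by blast
  moreover obtain a where "S A = inc (S B) a"
    using growth_row[OF g x y] Suc.prems p by metis
  ultimately show ?case
    by (intro exI[of _ "max M (Suc a)"]) (auto simp: inc_apply)
qed

text \<open>Here \<open>fst\<close> is the position in a word and \<open>snd\<close> the letter. A
  last and largest letter extends the top row; if the last letter needs the box of the largest
  letter, the latter is bumped to the next row.\<close>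

abbreviation row_growth :: "(point set \<Rightarrow> nat \<Rightarrow> nat) \<Rightarrow> bool" where
  "row_growth \<equiv> growth (\<lambda>_. 0) (\<lambda>_. Suc) fst snd"

lemma row_growth_antimono:
  assumes g: "row_growth S" and "generic A"
  shows "antimono (S A)"
  using assms(2)
proof (induction "card A" arbitrary: A rule: less_induct)
  case less
  show ?case
  proof (cases "A = {}")
    case True
    then show ?thesis using growth_empty[OF g] by (simp add: antimono_def)
  next
    case False
    then obtain p B where p: "A = insert p B" "highest fst p B" "p \<notin> B"
      using obtain_highest separating_coords less.prems by metis
    have fin: "finite A" "finite B" using less.prems p(1) by (auto simp: generic_def)
    have gB: "generic B" using less.prems p(1) by (auto elim: generic_subset)
    have B: "antimono (S B)" using less.hyps gB p fin by simp
    show ?thesis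
    proof (cases "highest snd p B")
      case True
      then show ?thesis
        using growth_corner[OF g, of p B] p less.prems B by (simp add: antimono_inc_iff)
    next
      case False
      then have "B \<noteq> {}" by (auto simp: highest_def)
      then obtain t C where t: "B = insert t C" "highest snd t C" "t \<notin> C"
        using obtain_highest gB separating_coords by metis
      have "inj_on snd A" using less.prems by (auto simp: generic_def)
      then have "snd p \<noteq> snd t" using t p by (auto simp: inj_on_def)
      moreover have "\<not> snd t < snd p" using False t by (force simp: highest_def)
      ultimately have ht: "highest snd t (insert p C)" using t by simp
      have gen: "generic (insert p C)" "generic (insert t C)" "generic C"
        using t p less.prems by (auto elim: generic_subset)
      have "finite C" using gen(3) by (simp add: generic_def)
      then have c: "card (insert p C) < card A" "card (insert t C) < card A" "card C < card A"
        using p t by auto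
      have hpC: "highest fst p C" using p t by simp
      obtain a c' where ac: "S (insert p C) = inc (S C) a" "S (insert t C) = inc (S C) c'"
        using growth_row[OF g separating_coords(1,2)] gen hpC t(2) by metis
      have am: "antimono (S C)" "antimono (inc (S C) a)" "antimono (inc (S C) c')"
        using less.hyps c gen ac by metis+
      have "S A = inc (inc (S C) a) (if a = c' then Suc a else c')"
        using growth_step[OF g, of p t C a c'] less.prems p t ht ac by simp
      moreover have "antimono (inc (inc (S C) a) (if a = c' then Suc a else c'))"
      proof -
        have "\<And>i. a = Suc i \<Longrightarrow> S C a < S C i" "\<And>i. c' = Suc i \<Longrightarrow> S C c' < S C i"
          using am by (simp_all add: antimono_inc_iff)
        moreover have "S C (Suc a) \<le> S C a"
          using am(1) by (simp add: antimono_def)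
        ultimately show ?thesis
          using am(2) by (subst antimono_inc_iff) (auto simp: inc_apply less_Suc_eq_le less_SucI)
      qed
      ultimately show ?thesis by simp
    qed
  qed
qed

lemma domino_rule_commute:
  assumes "domino_rule f a b x"
  obtains y where "inc (inc f a) x = inc (inc f b) y" and "domino_rule f b a y"
proof (cases "a = b")
  case True
  then show ?thesis using assms that[of x] by simp
next
  case False
  then show ?thesis using assms that[of a] by (simp add: domino_rule_def inc_commute)
qed

text \<open>A largest letter at the start of the word stays at the foot of the first column. A
  rightmost point never adds a box below the first empty row, and if it claims exactly that row, the
  large letter moves down by one.\<close>

lemma row_growth_corner_left:
  assumes g: "row_growth S" and "generic (insert q A)"
    and "highest (\<lambda>z. - fst z) q A" and "highest snd q A"
  shows "S (insert q A) = inc (S A) (LEAST i. S A i = 0)"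
  using assms(2-)
proof (induction "card A" arbitrary: A)
  case 0
  then have "A = {}" using generic_subset[of "insert q A" A] by (auto simp: generic_def)
  then show ?case
    using growth_corner[OF g, of q A] growth_empty[OF g] 0
    by (simp add: highest_def Least_equality)
next
  case (Suc n)
  have gA: "generic A" "A \<noteq> {}" using Suc by (auto elim: generic_subset)
  then obtain p B where p: "A = insert p B" "highest fst p B" "p \<notin> B"
    using obtain_highest separating_coords by metis
  have gB: "generic B" "generic (insert q B)" "generic (insert p B)"
    using Suc.prems p by (auto elim: generic_subset)
  have nB: "n = card B" using Suc.hyps(2) p gB(1) by (simp add: generic_def)
  define c where "c = (LEAST i. S B i = 0)"
  have qB: "S (insert q B) = inc (S B) c"
    using Suc.hyps(1)[OF nB] gB Suc.prems p unfolding c_def by simp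
  have "\<exists>i. S B i = 0"
    using growth_support[OF g separating_coords(1,2) gB(1)] by blast
  then have c: "S B c = 0" "\<And>i. i < c \<Longrightarrow> S B i \<noteq> 0"
    unfolding c_def by (auto intro: LeastI_ex dest: not_less_Least)
  obtain a where a: "S A = inc (S B) a"
    using growth_row[OF g] separating_coords gB p by metis
  have s: "S (insert q A) = inc (inc (S B) a) (if a = c then Suc a else c)"
    using growth_step[OF g, of p q B a c] Suc.prems p qB a by (simp add: insert_commute)
  have am: "antimono (S B)" "antimono (inc (S B) a)"
    using row_growth_antimono[OF g] gB a p by metis+
  have "a \<le> c"
  proof (rule ccontr)
    assume "\<not> a \<le> c"
    then obtain j where "a = Suc j" "c \<le> j" by (cases a) auto
    moreover from this have "S B a < S B j"
      using am by (simp add: antimono_inc_iff)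
    ultimately have "S B a < S B j" "S B j \<le> S B c"
      using am(1) by (auto simp: antimono_def)
    with c show False by simp
  qed
  have "(LEAST i. S A i = 0) = (if a = c then Suc a else c)"
  proof (rule Least_equality)
    have "S B (Suc c) \<le> S B c" using am(1) by (simp add: antimono_def)
    then show "S A (if a = c then Suc a else c) = 0"
      using c(1) a by (auto simp: inc_apply)
  next
    fix y assume "S A y = 0"
    then have "y \<noteq> a" "S B y = 0" using a by (auto simp: inc_apply split: if_splits)
    moreover from this have "c \<le> y" using c(2) not_less by blast
    ultimately show "(if a = c then Suc a else c) \<le> y" by auto
  qed
  with s a show ?case by simp
qed

text \<open>Prepares the choice of a third direction for the cube: its extremal point is either one
  of the two given points, a degenerate case, or a new point \<open>t\<close>.\<close>

lemma highest_cases: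
  assumes "generic (insert p (insert q A))" and "separating h"
    and "p \<notin> insert q A" and "q \<notin> insert p A"
  obtains "highest h p (insert q A)" | "highest h q (insert p A)"
  | t B where "A = insert t B" and "t \<notin> B" and "highest h t (insert p (insert q B))"
proof -
  obtain t B where t: "insert p (insert q A) = insert t B" "highest h t B" "t \<notin> B"
    using obtain_highest[OF assms(1) _ assms(2)] by blast
  consider "t = p" | "t = q" | "t \<in> A" "t \<noteq> p" "t \<noteq> q" using t(1) by blast
  then show thesis
  proof cases
    case 1
    then have "B = insert q A" using t(1,3) assms(3) by (metis insert_ident)
    with t(2) 1 show ?thesis using that(1) by simp
  next
    case 2
    then have "insert q (insert p A) = insert q B" using t(1) by (simp add: insert_commute)
    then have "B = insert p A" using 2 t(3) assms(4) by (metis insert_ident)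
    with t(2) 2 show ?thesis using that(2) by simp
  next
    case 3
    have "highest h t (insert p (insert q (A - {t})))"
      unfolding highest_def
    proof
      fix z assume "z \<in> insert p (insert q (A - {t}))"
      then have "z \<in> insert t B" "z \<noteq> t" using t(1) 3 by auto
      then show "h z < h t" using t(2) by (simp add: highest_def)
    qed
    then show ?thesis using that(3)[of t "A - {t}"] 3 by (simp add: insert_absorb)
  qed
qed

text \<open>For \<open>?J\<close> the topmost point is removed and for \<open>?L\<close> the
  rightmost one; the removed point spans the cube together with the two given points. Both steps use
  all three statements for the smaller set, so they are proved by one induction.\<close>

lemma row_growth_opposite:
  assumes g: "row_growth S"
  shows "(\<forall>q. generic (insert q A) \<and> highest (\<lambda>z. - fst z) q A \<longrightarrow>
           (\<exists>b. S (insert q A) = inc (S A) b)) \<and>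
         (\<forall>p q a b. generic (insert p (insert q A)) \<and> highest fst p (insert q A) \<and>
           highest (\<lambda>z. - fst z) q (insert p A) \<and>
           S (insert p A) = inc (S A) a \<and> S (insert q A) = inc (S A) b \<longrightarrow>
           (\<exists>x. S (insert p (insert q A)) = inc (inc (S A) a) x \<and> domino_rule (S A) a b x)) \<and>
         (\<forall>q t b c. generic (insert q (insert t A)) \<and> highest (\<lambda>z. - fst z) q (insert t A) \<and>
           highest snd t (insert q A) \<and>
           S (insert q A) = inc (S A) b \<and> S (insert t A) = inc (S A) c \<longrightarrow>
           S (insert q (insert t A)) =
             inc (inc (S A) b) (if b = c then next_col_row (S A) b else c))"
      (is "?E A \<and> ?J A \<and> ?L A")
proof (induction "card A" arbitrary: A rule: less_induct)
  case less
  note row = growth_row[OF g separating_coords(1,2)]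
  note sub = generic_subset
  have IH: "?E B" "?J B" "?L B" if "A = insert t B" "t \<notin> B" "generic A" for t B
    using less[of B] that by (auto simp: generic_def)
  have E: "?E A"
  proof (intro allI impI)
    fix q assume q: "generic (insert q A) \<and> highest (\<lambda>z. - fst z) q A"
    show "\<exists>b. S (insert q A) = inc (S A) b"
    proof (cases "highest snd q A")
      case True
      then show ?thesis using row_growth_corner_left[OF g] q by blast
    next
      case False
      have "generic A" using q by (auto elim: sub)
      moreover have "A \<noteq> {}" using False by (auto simp: highest_def)
      ultimately obtain t B where t: "A = insert t B" "highest snd t B" "t \<notin> B"
        using obtain_highest separating_coords by metis
      have "inj_on snd (insert q A)" using q by (auto simp: generic_def)
      moreover have "q \<notin> A" using q highest_notin by blast
      ultimately have "snd q \<noteq> snd t" using t by (auto simp: inj_on_def)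
      moreover have "\<not> snd t < snd q" using False t by (force simp: highest_def)
      ultimately have ht: "highest snd t (insert q B)" using t by simp
      have gen: "generic (insert q B)" "generic (insert t B)"
        using t q by (auto elim: sub)
      obtain b where b: "S (insert q B) = inc (S B) b"
        using IH(1)[OF t(1,3) \<open>generic A\<close>, rule_format, of q] gen q t by auto
      obtain c where c: "S (insert t B) = inc (S B) c"
        using row gen(2) t(2) by blast
      have "S (insert q (insert t B)) = inc (inc (S B) b) (if b = c then next_col_row (S B) b else c)"
        using IH(3)[OF t(1,3) \<open>generic A\<close>, rule_format, of q t b c] q t ht b c by auto
      then have "S (insert q A) = inc (S A) (if b = c then next_col_row (S B) b else b)"
        using c t(1) by (auto simp: inc_commute)
      then show ?thesis by blast
    qed
  qed
  have J: "?J A"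
  proof (intro allI impI)
    fix p q a b
    assume *: "generic (insert p (insert q A)) \<and> highest fst p (insert q A) \<and>
      highest (\<lambda>z. - fst z) q (insert p A) \<and> S (insert p A) = inc (S A) a \<and>
      S (insert q A) = inc (S A) b"
    then have gen: "generic (insert p A)" "generic (insert q A)" "generic A"
      by (auto elim: sub)
    consider (1) "highest snd p (insert q A)" | (2) "highest snd q (insert p A)"
      | (3) t B where "A = insert t B" "t \<notin> B" "highest snd t (insert p (insert q B))"
      using highest_cases[of p q A snd] * separating_coords(2) highest_notin by metis
    then show "\<exists>x. S (insert p (insert q A)) = inc (inc (S A) a) x \<and> domino_rule (S A) a b x"
    proof cases
      case 1
      \<comment> \<open>Now \<open>p\<close> is extremal at the top right, so its box lies in row 0
        both with and without \<open>q\<close>.\<close>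
      have "S (insert p (insert q A)) = inc (inc (S A) b) 0"
        using growth_corner[OF g, of p "insert q A"] * 1 by auto
      moreover have "S (insert p A) = inc (S A) 0"
        using growth_corner[OF g gen(1)] * 1 by auto
      ultimately show ?thesis using *
        by (intro exI[of _ b]) (auto simp: inc_commute domino_rule_def)
    next
      case 2
      have s: "S (insert p (insert q A)) = inc (inc (S A) a) (if a = b then Suc a else b)"
        using growth_step[OF g, of p q A a b] * 2 by auto
      \<comment> \<open>Now \<open>q\<close> is extremal at the top left, so row \<open>b\<close> is
        empty, and so is the row below. The row \<open>Suc a\<close> prescribed for equal rows is
        therefore a vertical domino.\<close>
      have "b = (LEAST i. S A i = 0)"
        using row_growth_corner_left[OF g gen(2)] * 2 by auto
      moreover have "\<exists>i. S A i = 0"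
        using growth_support[OF g separating_coords(1,2) gen(3)] by blast
      ultimately have "S A b = 0" using LeastI_ex[of "\<lambda>i. S A i = 0"] by simp
      moreover have "S A (Suc b) \<le> S A b"
        using row_growth_antimono[OF g gen(3)] by (simp add: antimono_def)
      ultimately show ?thesis
        using s by (intro exI[of _ "if a = b then Suc a else b"]) (auto simp: domino_rule_def)
    next
      case 3
      note t = 3
      have gen': "generic (insert p B)" "generic (insert q B)" "generic (insert t B)" "generic B"
        "generic (insert p (insert q B))" "generic (insert q (insert t B))"
        "generic (insert p (insert t B))" "generic (insert p (insert t (insert q B)))"
        using * t by (auto elim!: sub simp: insert_commute)
      obtain b0 where b0: "S (insert q B) = inc (S B) b0"
        using IH(1)[OF t(1,2) gen(3), rule_format, of q] gen' * t by auto
      obtain a0 where a0: "S (insert p B) = inc (S B) a0"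
        using row gen'(1) * t(1) by (metis highest_insert)
      obtain c0 where c0: "S (insert t B) = inc (S B) c0"
        using row gen'(3) t by (metis highest_insert)
      obtain x where x: "S (insert p (insert q B)) = inc (inc (S B) a0) x" "domino_rule (S B) a0 b0 x"
        using IH(2)[OF t(1,2) gen(3), rule_format, of p q a0 b0] gen' * t a0 b0 by auto
      then obtain a' where a': "S (insert p (insert q B)) = inc (inc (S B) b0) a'"
        "domino_rule (S B) b0 a0 a'"
        using domino_rule_commute by metis
      have qt: "S (insert q (insert t B)) =
          inc (inc (S B) b0) (if b0 = c0 then next_col_row (S B) b0 else c0)"
        using IH(3)[OF t(1,2) gen(3), rule_format, of q t b0 c0] gen' * t b0 c0 by auto
      have pt: "S (insert p (insert t B)) = inc (inc (S B) a0) (if a0 = c0 then Suc a0 else c0)"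
        using growth_step[OF g gen'(7) _ _ a0 c0] * t by auto
      have all: "S (insert p (insert t (insert q B))) = inc (inc (inc (S B) b0) a')
          (if a' = (if b0 = c0 then next_col_row (S B) b0 else c0) then Suc a'
           else (if b0 = c0 then next_col_row (S B) b0 else c0))"
        using growth_step[OF g gen'(8), of a' "if b0 = c0 then next_col_row (S B) b0 else c0"]
          * t a' b0 qt by (simp add: insert_commute)
      have am: "antimono (S B)" "antimono (inc (S B) a0)" "antimono (inc (S B) b0)"
        "antimono (inc (S B) c0)" "antimono (inc (inc (S B) b0) a')"
        using row_growth_antimono[OF g] gen' a0 b0 c0 a' by metis+
      obtain a3 b3 x where r: "S (insert p (insert t B)) = inc (inc (S B) c0) a3"
        "S (insert q (insert t B)) = inc (inc (S B) c0) b3"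
        "S (insert p (insert t (insert q B))) = inc (inc (inc (S B) c0) a3) x"
        "domino_rule (inc (S B) c0) a3 b3 x"
        using cube_rule(2)[OF am(1-4) a'(2) am(5) refl all refl] pt qt by auto
      have SA: "S A = inc (S B) c0" using c0 t by simp
      have "a3 = a" "b3 = b" using r(1,2) * t(1) SA by auto
      then show ?thesis using r SA t(1) by (auto simp: insert_commute)
    qed
  qed
  have L: "?L A"
  proof (intro allI impI)
    fix q t b c
    assume *: "generic (insert q (insert t A)) \<and> highest (\<lambda>z. - fst z) q (insert t A) \<and>
      highest snd t (insert q A) \<and> S (insert q A) = inc (S A) b \<and> S (insert t A) = inc (S A) c"
    then have gen: "generic (insert q A)" "generic (insert t A)" "generic A"
      by (auto elim: sub)
    consider (1) "highest fst q (insert t A)" | (2) "highest fst t (insert q A)"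
      | (3) p B where "A = insert p B" "p \<notin> B" "highest fst p (insert q (insert t B))"
      using highest_cases[of q t A fst] * separating_coords(1) highest_notin by metis
    then show "S (insert q (insert t A)) =
        inc (inc (S A) b) (if b = c then next_col_row (S A) b else c)"
    proof cases
      case 1
      \<comment> \<open>This case is contradictory: \<open>q\<close> cannot lie both to the left and
        to the right of \<open>t\<close>.\<close>
      then show ?thesis using * by auto
    next
      case 2
      have "S (insert t (insert q A)) = inc (inc (S A) b) 0"
        using growth_corner[OF g, of t "insert q A"] * 2 by (auto simp: insert_commute)
      moreover have "S (insert t A) = inc (S A) 0"
        using growth_corner[OF g gen(2)] * 2 by auto
      moreover have "next_col_row (S A) 0 = 0"
        using next_col_row_props(3)[of "S A" 0] by simp
      ultimately show ?thesis using * by (auto simp: insert_commute)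
    next
      case 3
      note p = 3
      have gen': "generic (insert p B)" "generic (insert q B)" "generic (insert t B)" "generic B"
        "generic (insert p (insert q B))" "generic (insert q (insert t B))"
        "generic (insert p (insert t B))" "generic (insert p (insert t (insert q B)))"
        using * p by (auto elim!: sub simp: insert_commute)
      obtain b0 where b0: "S (insert q B) = inc (S B) b0"
        using IH(1)[OF p(1,2) gen(3), rule_format, of q] gen' * p by auto
      obtain a0 where a0: "S (insert p B) = inc (S B) a0"
        using row gen'(1) p by (metis highest_insert)
      obtain c0 where c0: "S (insert t B) = inc (S B) c0"
        using row gen'(3) * p by (metis highest_insert)
      obtain x where x: "S (insert p (insert q B)) = inc (inc (S B) a0) x" "domino_rule (S B) a0 b0 x"
        using IH(2)[OF p(1,2) gen(3), rule_format, of p q a0 b0] gen' * p a0 b0 by auto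
      then obtain a' where a': "S (insert p (insert q B)) = inc (inc (S B) b0) a'"
        "domino_rule (S B) b0 a0 a'"
        using domino_rule_commute by metis
      have qt: "S (insert q (insert t B)) =
          inc (inc (S B) b0) (if b0 = c0 then next_col_row (S B) b0 else c0)"
        using IH(3)[OF p(1,2) gen(3), rule_format, of q t b0 c0] gen' * p b0 c0 by auto
      have pt: "S (insert p (insert t B)) = inc (inc (S B) a0) (if a0 = c0 then Suc a0 else c0)"
        using growth_step[OF g gen'(7) _ _ a0 c0] * p by auto
      have all: "S (insert p (insert t (insert q B))) = inc (inc (inc (S B) b0) a')
          (if a' = (if b0 = c0 then next_col_row (S B) b0 else c0) then Suc a'
           else (if b0 = c0 then next_col_row (S B) b0 else c0))"
        using growth_step[OF g gen'(8), of a' "if b0 = c0 then next_col_row (S B) b0 else c0"]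
          * p a' b0 qt by (simp add: insert_commute)
      have am: "antimono (S B)" "antimono (inc (S B) a0)" "antimono (inc (S B) b0)"
        "antimono (inc (S B) c0)" "antimono (inc (inc (S B) b0) a')"
        using row_growth_antimono[OF g] gen' a0 b0 c0 a' by metis+
      obtain b' where r: "inc (inc (S B) b0) a' = inc (inc (S B) a0) b'"
        "S (insert p (insert t (insert q B))) = inc (inc (inc (S B) a0) b')
          (if b' = (if a0 = c0 then Suc a0 else c0) then next_col_row (inc (S B) a0) b'
           else (if a0 = c0 then Suc a0 else c0))"
        using cube_rule(1)[OF am(1-4) a'(2) am(5) refl all refl] by auto
      have SA: "S A = inc (S B) a0" using a0 p by simp
      have "b' = b" using a'(1) r(1) * p(1) SA by (auto simp: insert_commute)
      moreover have "(if a0 = c0 then Suc a0 else c0) = c"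
        using pt * p(1) SA by (auto simp: insert_commute)
      ultimately show ?thesis using r SA p(1) by (auto simp: insert_commute)
    qed
  qed
  from E J L show ?case by blast
qed

section \<open>Symmetric point sets and balanced shapes\<close>

text \<open>Exchanging the coordinates amounts to inverting the permutation, and the growth rule is
  symmetric in the coordinates.\<close>

lemma row_growth_swap:
  assumes g: "row_growth S" and "generic A"
  shows "S (prod.swap ` A) = S A"
proof -
  have "generic (prod.swap ` B)" if "generic B" for B
    using that by (auto simp: generic_def inj_on_def)
  then have "growth (\<lambda>_. 0) (\<lambda>_. Suc) (fst \<circ> prod.swap) (snd \<circ> prod.swap) (\<lambda>A. S (prod.swap ` A))"
    by (rule growth_image[OF g])
  then have "growth (\<lambda>_. 0) (\<lambda>_. Suc) snd fst (\<lambda>A. S (prod.swap ` A))"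
    by (simp add: comp_def)
  from growth_unique[OF growth_swap[OF this] g] show ?thesis
    using separating_coords assms(2) by blast
qed

lemma row_growth_left_top:
  assumes g: "row_growth S"
  shows "growth (\<lambda>f. LEAST i. f i = 0) next_col_row (\<lambda>z. - fst z) snd S"
  unfolding growth_def
  using growth_empty[OF g] row_growth_corner_left[OF g] row_growth_opposite[OF g]
  by blast

text \<open>The right/bottom rule arises from the left/top rule in two ways: by rotation it holds
  for the shapes of rotated sets, and by transposition, which preserves shapes, it holds for
  \<open>S\<close> itself. Uniqueness identifies the two.\<close>

lemma row_growth_rotate:
  assumes g: "row_growth S" and "generic A"
  shows "S (uminus ` A) = S A"
proof -
  let ?K = "\<lambda>f::nat \<Rightarrow> nat. LEAST i. f i = 0"
  have sw: "generic (prod.swap ` B)" and mi: "generic (uminus ` B)" if "generic B" for B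
    using that by (auto simp: generic_def inj_on_def)
  have c: "growth ?K next_col_row (\<lambda>z. - fst z) snd S"
    by (rule row_growth_left_top[OF g])
  have "growth ?K next_col_row ((\<lambda>z. - fst z) \<circ> prod.swap) (snd \<circ> prod.swap) (\<lambda>A. S (prod.swap ` A))"
    by (rule growth_image[OF c sw])
  then have "growth ?K next_col_row (\<lambda>z. - snd z) fst (\<lambda>A. S (prod.swap ` A))"
    by (simp add: comp_def)
  then have "growth ?K next_col_row (\<lambda>z. - snd z) fst S"
    by (rule growth_cong) (simp add: row_growth_swap[OF g])
  then have 1: "growth ?K next_col_row fst (\<lambda>z. - snd z) S"
    by (rule growth_swap)
  have "growth ?K next_col_row ((\<lambda>z. - fst z) \<circ> uminus) (snd \<circ> uminus) (\<lambda>A. S (uminus ` A))"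
    by (rule growth_image[OF c mi])
  then have "growth ?K next_col_row fst (\<lambda>z. - snd z) (\<lambda>A. S (uminus ` A))"
    by (simp add: comp_def)
  from growth_unique[OF this 1] show ?thesis
    using separating_coords assms(2) by blast
qed

text \<open>The signed number of boxes, where box \<open>(i, j)\<close>, counted from 0, has sign
  \<open>(- 1) ^ (i + j)\<close>: a row of even length cancels and a row of odd length leaves the
  sign of its first box.\<close>

definition imbalance :: "(nat \<Rightarrow> nat) \<Rightarrow> int" where
  "imbalance f = (\<Sum>i | odd (f i). (- 1) ^ i)"

lemma imbalance_inc:
  assumes "finite {i. odd (f i)}"
  shows "imbalance (inc f a) = imbalance f + (- 1) ^ (a + f a)"
proof (cases "odd (f a)")
  case True
  then have "{i. odd (inc f a i)} = {i. odd (f i)} - {a}" by (auto simp: inc_apply)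
  then show ?thesis
    using True assms by (simp add: imbalance_def sum_diff1 power_add)
next
  case False
  then have "{i. odd (inc f a i)} = insert a {i. odd (f i)}" by (auto simp: inc_apply)
  then show ?thesis
    using False assms by (simp add: imbalance_def power_add)
qed

lemma imbalance_symmetric:
  assumes g: "row_growth S" and "generic A" and "uminus ` A = A" and "(0, 0) \<notin> A"
  shows "imbalance (S A) = 0"
  using assms(2-)
proof (induction "card A" arbitrary: A rule: less_induct)
  case less
  show ?case
  proof (cases "A = {}")
    case True
    then show ?thesis using growth_empty[OF g] by (simp add: imbalance_def)
  next
    case False
    then obtain p B where p: "A = insert p B" "highest fst p B" "p \<notin> B"
      using obtain_highest less.prems(1) separating_coords by metis
    have neg: "- z \<in> A" if "z \<in> A" for z using less.prems(2) that by blast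
    have "p \<noteq> - p"
    proof
      assume "p = - p"
      then have "p = 0" by (metis prod.collapse fst_uminus snd_uminus equal_neg_zero zero_prod_def)
      then show False using less.prems(3) p(1) by (simp add: zero_prod_def)
    qed
    then have mp: "- p \<in> B" using neg[of p] p(1) by auto
    define C where "C = B - {- p}"
    have B: "B = insert (- p) C" "- p \<notin> C" "p \<notin> C" using mp p(3) by (auto simp: C_def)
    have gen: "generic C" "generic (insert p C)" "generic (insert (- p) C)"
      using less.prems(1) p B by (auto elim!: generic_subset)
    have symC: "- z \<in> C" if "z \<in> C" for z
    proof -
      have "- z \<in> A" using that neg p(1) B by auto
      moreover have "- z \<noteq> p" using that B(2) by (metis minus_minus)
      moreover have "- z \<noteq> - p" using that B(3) by (metis minus_minus)
      ultimately show ?thesis using p(1) B by blast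
    qed
    have "uminus ` C = C"
    proof
      show "C \<subseteq> uminus ` C" using symC by (metis image_eqI minus_minus subsetI)
    qed (use symC in auto)
    moreover have "card C < card A"
      using gen(1) p B by (simp add: generic_def)
    ultimately have 0: "imbalance (S C) = 0"
      using less.hyps gen(1) less.prems(3) p B by auto
    have hp: "highest fst p (insert (- p) C)" using p B by simp
    have hq: "highest (\<lambda>z. - fst z) (- p) (insert p C)"
      unfolding highest_def
    proof
      fix z assume "z \<in> insert p C"
      then have "- z \<in> insert (- p) C" using symC by blast
      with hp have "fst (- z) < fst p" unfolding highest_def by blast
      then show "- fst z < - fst (- p)" by simp
    qed
    obtain a where a: "S (insert p C) = inc (S C) a"
      using growth_row[OF g separating_coords(1,2) gen(2)] hp by auto
    have "uminus ` (insert p C) = insert (- p) C"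
      using \<open>uminus ` C = C\<close> by simp
    then have b: "S (insert (- p) C) = inc (S C) a"
      using row_growth_rotate[OF g gen(2)] a by simp
    obtain x where x: "S (insert p (insert (- p) C)) = inc (inc (S C) a) x"
      "domino_rule (S C) a a x"
      using row_growth_opposite[OF g, of C, THEN conjunct2, THEN conjunct1, rule_format, of p "- p" a a]
        less.prems(1) hp hq a b p(1) B(1) by auto
    obtain M where M: "\<forall>i\<ge>M. S C i = 0"
      using growth_support[OF g separating_coords(1,2) gen(1)] by blast
    have "i < M" if "odd (S C i)" for i
      using M that by (metis even_zero not_less)
    then have "{i. odd (S C i)} \<subseteq> {..<M}" by blast
    then have "finite {i. odd (S C i)}" by (rule finite_subset) simp
    moreover have "{i. odd (inc (S C) a i)} \<subseteq> insert a {i. odd (S C i)}"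
      by (auto simp: inc_apply)
    ultimately have "finite {i. odd (S C i)}" "finite {i. odd (inc (S C) a i)}"
      by (auto intro: finite_subset)
    then have "imbalance (S A) =
        (- 1) ^ (a + S C a) + (- 1) ^ (x + inc (S C) a x)"
      using x(1) p(1) B(1) 0 by (simp add: imbalance_inc)
    also have "\<dots> = 0"
      using x(2) by (auto simp: domino_rule_def inc_apply power_add)
    finally show ?thesis .
  qed
qed

subsection \<open>Shapes of Robinson--Schensted tableaux\<close>

definition tab_shape :: "int list list \<Rightarrow> nat \<Rightarrow> nat" where
  "tab_shape T i = (if i < length T then length (T ! i) else 0)"

lemma tab_shape_Nil: "tab_shape [] = (\<lambda>_. 0)"
  by (simp add: tab_shape_def fun_eq_iff)

lemma tab_shape_Cons: "tab_shape (r # T) = (\<lambda>i. case i of 0 \<Rightarrow> length r | Suc j \<Rightarrow> tab_shape T j)"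
  by (auto simp: tab_shape_def fun_eq_iff split: nat.split)

text \<open>Appends \<open>m\<close> to row \<open>i\<close>, starting a new row for
  \<open>i = length T\<close>; uses keep to \<open>i \<le> length T\<close>.\<close>

fun append_at :: "int \<Rightarrow> nat \<Rightarrow> int list list \<Rightarrow> int list list" where
  "append_at m i [] = [[m]]"
| "append_at m 0 (r # T) = (r @ [m]) # T"
| "append_at m (Suc i) (r # T) = r # append_at m i T"

lemma tab_shape_append_at: "i \<le> length T \<Longrightarrow> tab_shape (append_at m i T) = inc (tab_shape T) i"
proof (induction m i T rule: append_at.induct)
  case (1 m i)
  then show ?case by (auto simp: tab_shape_def inc_apply fun_eq_iff)
qed (auto simp: tab_shape_Cons inc_apply fun_eq_iff split: nat.split)

lemma row_insert_at_end:
  assumes "dropWhile (\<lambda>y. y \<le> x) r = []"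
  shows "row_insert x (r # T) = (r @ [x]) # T"
  by (simp only: row_insert.simps assms list.case)

lemma row_insert_bump:
  assumes "dropWhile (\<lambda>y. y \<le> x) r = y # ys"
  shows "row_insert x (r # T) = (takeWhile (\<lambda>y. y \<le> x) r @ x # ys) # row_insert y T"
  by (simp only: row_insert.simps assms list.case)

lemma row_insert_max:
  assumes "\<forall>r\<in>set T. \<forall>y\<in>set r. y \<le> m"
  shows "row_insert m T = append_at m 0 T"
proof (cases T)
  case (Cons r T')
  then have "dropWhile (\<lambda>y. y \<le> m) r = []" using assms by simp
  then show ?thesis using Cons by (simp only: row_insert_at_end append_at.simps)
qed simp

lemma set_row_insert: "\<Union> (set ` set (row_insert x T)) \<subseteq> insert x (\<Union> (set ` set T))"
proof (induction x T rule: row_insert.induct)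
  case (2 x r T)
  show ?case
  proof (cases "dropWhile (\<lambda>y. y \<le> x) r")
    case Nil
    then show ?thesis unfolding row_insert_at_end[OF Nil] by auto
  next
    case (Cons y ys)
    then have "y # ys = dropWhile (\<lambda>y. y \<le> x) r" by simp
    then have "set (y # ys) \<subseteq> set r" using set_dropWhileD by (metis subsetI)
    moreover have "set (takeWhile (\<lambda>y. y \<le> x) r) \<subseteq> set r" using set_takeWhileD by fast
    ultimately show ?thesis using 2[OF Cons] unfolding row_insert_bump[OF Cons] by fastforce
  qed
qed simp

text \<open>The letter \<open>m\<close> is larger than all others, so it occupies a corner; inserting \<open>x\<close> either
  leaves it there or, if the new box is this corner, bumps it to the end of the next row.\<close>

lemma row_insert_append_at:
  assumes "\<forall>r\<in>set T. \<forall>y\<in>set r. y < m" and "x < m" and "i \<le> length T"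
  shows "\<exists>a. tab_shape (row_insert x T) = inc (tab_shape T) a \<and>
     (if a = i then Suc i else i) \<le> length (row_insert x T) \<and>
     row_insert x (append_at m i T) = append_at m (if a = i then Suc i else i) (row_insert x T)"
  using assms
proof (induction x T arbitrary: i rule: row_insert.induct)
  case (1 x)
  then show ?case
    by (intro exI[of _ 0]) (auto simp: tab_shape_def inc_apply fun_eq_iff)
next
  case (2 x r T)
  show ?case
  proof (cases "dropWhile (\<lambda>y. y \<le> x) r")
    case Nil
    then have le: "\<forall>y\<in>set r. y \<le> x" by (simp add: dropWhile_eq_Nil_conv)
    have sh: "tab_shape (row_insert x (r # T)) = inc (tab_shape (r # T)) 0"
      unfolding row_insert_at_end[OF Nil]
      by (auto simp: tab_shape_Cons inc_apply fun_eq_iff split: nat.split)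
    show ?thesis
    proof (cases i)
      case 0
      have "row_insert m T = append_at m 0 T"
        by (rule row_insert_max) (use 2(2) in force)
      have "dropWhile (\<lambda>y. y \<le> x) (r @ [m]) = [m]" "takeWhile (\<lambda>y. y \<le> x) (r @ [m]) = r"
        using le 2(3) by (auto simp: dropWhile_append takeWhile_append)
      then have "row_insert x (append_at m i (r # T)) = (r @ [x]) # append_at m 0 T"
        using 0 row_insert_bump[of x "r @ [m]" m "[]" T] \<open>row_insert m T = append_at m 0 T\<close> by simp
      then show ?thesis
        using 0 sh row_insert_at_end[OF Nil] by (intro exI[of _ 0]) simp
    next
      case (Suc j)
      have "row_insert x (append_at m i (r # T)) = (r @ [x]) # append_at m j T"
        using Suc row_insert_at_end[OF Nil] by simp
      then show ?thesis
        using Suc sh 2(4) row_insert_at_end[OF Nil] by (intro exI[of _ 0]) simp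
    qed
  next
    case (Cons y ys)
    have sub: "set (dropWhile (\<lambda>y. y \<le> x) r) \<subseteq> set r" using set_dropWhileD by (metis subsetI)
    then have "y < m" using Cons 2(2) by simp
    have len: "length (takeWhile (\<lambda>y. y \<le> x) r @ x # ys) = length r"
      using Cons by (metis length_append length_Cons takeWhile_dropWhile_id)
    have sh: "tab_shape (row_insert x (r # T)) = inc (tab_shape (r # T)) (Suc a)"
      if "tab_shape (row_insert y T) = inc (tab_shape T) a" for a
      unfolding row_insert_bump[OF Cons] using that len
      by (auto simp: tab_shape_Cons inc_apply fun_eq_iff split: nat.split)
    have T: "\<forall>r\<in>set T. \<forall>y\<in>set r. y < m" using 2(2) by simp
    show ?thesis
    proof (cases i)
      case 0
      obtain a where a: "tab_shape (row_insert y T) = inc (tab_shape T) a"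
        using 2(1)[OF Cons T \<open>y < m\<close>, of 0] by auto
      have "\<exists>z\<in>set r. \<not> z \<le> x"
        using Cons by (metis dropWhile_eq_Nil_conv list.distinct(1))
      then have "dropWhile (\<lambda>y. y \<le> x) (r @ [m]) = y # ys @ [m]"
        "takeWhile (\<lambda>y. y \<le> x) (r @ [m]) = takeWhile (\<lambda>y. y \<le> x) r"
        using Cons by (auto simp: dropWhile_append takeWhile_append1 )
      then have "row_insert x (append_at m i (r # T)) = append_at m 0 (row_insert x (r # T))"
        using 0 row_insert_bump[of x "r @ [m]" y "ys @ [m]" T] row_insert_bump[OF Cons] by simp
      then show ?thesis
        using 0 sh[OF a] by (intro exI[of _ "Suc a"]) simp
    next
      case (Suc j)
      then obtain a where a: "tab_shape (row_insert y T) = inc (tab_shape T) a"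
         "(if a = j then Suc j else j) \<le> length (row_insert y T)"
         "row_insert y (append_at m j T) = append_at m (if a = j then Suc j else j) (row_insert y T)"
        using 2(1)[OF Cons T \<open>y < m\<close>, of j] 2(4) by auto
      have "row_insert x (append_at m i (r # T)) =
          (takeWhile (\<lambda>y. y \<le> x) r @ x # ys) # row_insert y (append_at m j T)"
        using Suc row_insert_bump[OF Cons] by simp
      then show ?thesis
        using Suc row_insert_bump[OF Cons] sh[OF a(1)] a(2,3) by (intro exI[of _ "Suc a"]) (auto split: if_splits)
    qed
  qed
qed

lemma rs_tableau_snoc: "rs_tableau (u @ [x]) = row_insert x (rs_tableau u)"
  by (simp add: rs_tableau_def)

lemma set_rs_tableau: "\<Union> (set ` set (rs_tableau u)) \<subseteq> set u"
proof (induction u rule: rev_induct)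
  case (snoc x u)
  show ?case
    unfolding rs_tableau_snoc by (rule order_trans[OF set_row_insert]) (use snoc in auto)
qed (simp add: rs_tableau_def)

text \<open>When \<open>m\<close> arrives it is appended to the top row. Each later letter moves it
  down by at most one row, so it stays a corner, and deleting it leaves the tableau of the word
  without \<open>m\<close>.\<close>

lemma rs_tableau_insert_max:
  assumes "\<forall>y\<in>set (u @ v). y < m"
  shows "\<exists>i\<le>length (rs_tableau (u @ v)).
    rs_tableau (u @ m # v) = append_at m i (rs_tableau (u @ v))"
  using assms
proof (induction v rule: rev_induct)
  case Nil
  have "\<forall>r\<in>set (rs_tableau u). \<forall>y\<in>set r. y \<le> m"
    using set_rs_tableau[of u] Nil by fastforce
  then show ?case
    using row_insert_max rs_tableau_snoc[of u m] by auto
next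
  case (snoc x v)
  then obtain i where i: "i \<le> length (rs_tableau (u @ v))"
    "rs_tableau (u @ m # v) = append_at m i (rs_tableau (u @ v))" by auto
  have "\<forall>r\<in>set (rs_tableau (u @ v)). \<forall>y\<in>set r. y < m"
    using set_rs_tableau[of "u @ v"] snoc.prems by fastforce
  with i snoc.prems show ?case
    using row_insert_append_at[of "rs_tableau (u @ v)" m x i]
      rs_tableau_snoc[of "u @ v" x] rs_tableau_snoc[of "u @ m # v" x] by auto
qed

definition word :: "point set \<Rightarrow> int list" where
  "word A = map snd (sorted_list_of_set A)"

definition rs_shape :: "point set \<Rightarrow> nat \<Rightarrow> nat" where
  "rs_shape A = tab_shape (rs_tableau (word A))"

lemma sorted_list_of_set_insert_right:
  assumes "finite A" and "highest fst p A"
  shows "sorted_list_of_set (insert p A) = sorted_list_of_set A @ [p]"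
proof -
  have "p \<notin> A" using highest_notin assms(2) .
  moreover have "\<forall>z\<in>A. z \<le> p" using assms(2) by (auto simp: highest_def less_eq_prod_def)
  ultimately have "sorted (sorted_list_of_set A @ [p])" "distinct (sorted_list_of_set A @ [p])"
    "set (sorted_list_of_set A @ [p]) = insert p A"
    using assms(1) by (auto simp: sorted_append)
  then show ?thesis
    using sorted_distinct_set_unique assms(1)
    by (metis finite_insert set_sorted_list_of_set sorted_sorted_list_of_set distinct_sorted_list_of_set)
qed

lemma rs_shape_insert_top:
  assumes "generic (insert t A)" and "highest snd t A"
  shows "\<exists>u v i. word A = u @ v \<and> word (insert t A) = u @ snd t # v \<and> (\<forall>y\<in>set (u @ v). y < snd t)"
proof -
  have "finite A" "t \<notin> A" using assms highest_notin by (auto simp: generic_def)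
  obtain u v where uv: "sorted_list_of_set (insert t A) = u @ t # v"
    using \<open>finite A\<close> by (metis finite_insert insertI1 set_sorted_list_of_set split_list)
  have d: "distinct (u @ t # v)" "sorted (u @ t # v)" "set (u @ t # v) = insert t A"
    using uv \<open>finite A\<close> by (metis distinct_sorted_list_of_set,
      metis sorted_sorted_list_of_set, metis finite_insert set_sorted_list_of_set)
  then have "sorted (u @ v)" "distinct (u @ v)" "set (u @ v) = A"
    using \<open>t \<notin> A\<close> by (auto simp: sorted_append)
  then have "sorted_list_of_set A = u @ v"
    using sorted_distinct_set_unique \<open>finite A\<close>
    by (metis set_sorted_list_of_set sorted_sorted_list_of_set distinct_sorted_list_of_set)
  moreover have "\<forall>z\<in>set (u @ v). snd z < snd t"
    using \<open>set (u @ v) = A\<close> assms(2) by (simp add: highest_def)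
  ultimately show ?thesis
    using uv by (intro exI[of _ "map snd u"] exI[of _ "map snd v"]) (auto simp: word_def)
qed

text \<open>The rightmost point \<open>p\<close> is the last letter inserted and the topmost point
  \<open>t\<close> the largest one, so the collision rule is exactly
  \<open>row_insert_append_at\<close>.\<close>

lemma row_growth_rs_shape: "row_growth rs_shape"
  unfolding growth_def
proof (intro conjI allI impI)
  show "rs_shape {} = (\<lambda>_. 0)"
    by (simp add: rs_shape_def word_def rs_tableau_def tab_shape_Nil)
next
  fix A p
  assume *: "generic (insert p A) \<and> highest fst p A \<and> highest snd p A"
  then have fin: "finite A" by (simp add: generic_def)
  have w: "word (insert p A) = word A @ [snd p]"
    using sorted_list_of_set_insert_right[OF fin] * by (simp add: word_def)
  have "set (word A) = snd ` A" using fin by (simp add: word_def)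
  then have "\<forall>r\<in>set (rs_tableau (word A)). \<forall>y\<in>set r. y \<le> snd p"
    using set_rs_tableau[of "word A"] * by (fastforce simp: highest_def)
  then show "rs_shape (insert p A) = inc (rs_shape A) 0"
    unfolding rs_shape_def w rs_tableau_snoc
    by (simp add: row_insert_max tab_shape_append_at)
next
  fix A p t a c
  assume *: "generic (insert p (insert t A)) \<and> highest fst p (insert t A) \<and>
      highest snd t (insert p A) \<and> rs_shape (insert p A) = inc (rs_shape A) a \<and>
      rs_shape (insert t A) = inc (rs_shape A) c"
  then have fin: "finite A" by (simp add: generic_def)
  have gt: "generic (insert t A)" using * by (auto elim: generic_subset)
  obtain u v where uv: "word A = u @ v" "word (insert t A) = u @ snd t # v"
    "\<forall>y\<in>set (u @ v). y < snd t"
    using rs_shape_insert_top[OF gt] * by auto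
  have wp: "word (insert p A) = word A @ [snd p]"
      "word (insert p (insert t A)) = word (insert t A) @ [snd p]"
    using sorted_list_of_set_insert_right[of A p] sorted_list_of_set_insert_right[of "insert t A" p] fin *
    by (simp_all add: word_def)
  define T where "T = rs_tableau (word A)"
  obtain i where i: "i \<le> length T" "rs_tableau (word (insert t A)) = append_at (snd t) i T"
    using rs_tableau_insert_max[OF uv(3)] uv unfolding T_def by auto
  have "\<forall>r\<in>set T. \<forall>y\<in>set r. y < snd t"
    using set_rs_tableau[of "word A"] uv unfolding T_def by fastforce
  moreover have "snd p < snd t" using * by simp
  ultimately obtain a' where a': "tab_shape (row_insert (snd p) T) = inc (tab_shape T) a'"
    "(if a' = i then Suc i else i) \<le> length (row_insert (snd p) T)"
    "row_insert (snd p) (append_at (snd t) i T) =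
       append_at (snd t) (if a' = i then Suc i else i) (row_insert (snd p) T)"
    using row_insert_append_at[of T "snd t" "snd p" i] i(1) by auto
  have "a' = a"
    using * a'(1) unfolding rs_shape_def wp rs_tableau_snoc T_def[symmetric] by simp
  moreover have "i = c"
    using * i unfolding rs_shape_def T_def[symmetric] by (simp add: tab_shape_append_at)
  ultimately show "rs_shape (insert p (insert t A)) =
      inc (inc (rs_shape A) a) (if a = c then Suc a else c)"
    using a' i unfolding rs_shape_def wp rs_tableau_snoc T_def[symmetric]
    by (simp add: tab_shape_append_at split: if_splits)
qed

lemma domino_type_imbalance:
  assumes "domino_type n p"
  shows "imbalance (\<lambda>i. part p (Suc i)) = 0"
proof -
  obtain w where w: "signed_perm n w" "p = map length (rs_tableau (neg_word n w))"
    using assms by (auto simp: domino_type_def)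
  let ?I = "{- int n..int n} - {0}"
  define A where "A = (\<lambda>i. (i, w i)) ` ?I"
  have odd_w: "w (- i) = - w i" if "i \<in> ?I" for i
    using w(1) that unfolding signed_perm_def by blast
  have "inj_on w ?I" using w(1) by (auto simp: signed_perm_def bij_betw_def)
  then have gen: "generic A"
    by (auto simp: generic_def A_def inj_on_def)
  \<comment> \<open>The nonzero indices in increasing order, split as in \<open>neg_word\<close>;
    oddness of \<open>w\<close> identifies the two words.\<close>
  define js where "js = map uminus (rev [1..int n]) @ [1..int n]"
  have "sorted_wrt (<) (map uminus (rev [1..int n]))"
    by (simp add: sorted_wrt_map sorted_wrt_rev)
  then have "sorted_wrt (<) js"
    by (auto simp: js_def sorted_wrt_append)
  then have "sorted_wrt (<) (map (\<lambda>i. (i, w i)) js)"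
    unfolding sorted_wrt_map by (rule sorted_wrt_mono_rel[rotated]) (simp add: less_prod_def)
  then have s: "sorted (map (\<lambda>i. (i, w i)) js)" "distinct (map (\<lambda>i. (i, w i)) js)"
    using strict_sorted_iff by blast+
  have "set js = ?I"
  proof -
    have "uminus ` {1..int n} = {- int n..-1}" by (simp add: image_uminus_atLeastAtMost)
    then show ?thesis by (auto simp: js_def)
  qed
  then have "set (map (\<lambda>i. (i, w i)) js) = A" by (simp add: A_def)
  with s have "sorted_list_of_set A = map (\<lambda>i. (i, w i)) js"
    using sorted_list_of_set.idem_if_sorted_distinct by metis
  then have "word A = map w js" by (simp add: word_def comp_def)
  also have "\<dots> = neg_word n w"
    using odd_w by (auto simp: js_def neg_word_def)
  finally have "word A = neg_word n w" .
  then have "rs_shape A = (\<lambda>i. part p (Suc i))"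
    using w(2) by (auto simp: rs_shape_def tab_shape_def part_def fun_eq_iff)
  moreover have "uminus ` A = A"
  proof -
    have "- z \<in> A" if "z \<in> A" for z
      using that odd_w unfolding A_def by (auto intro!: image_eqI[of _ _ "- fst z"])
    then show ?thesis by (force intro: image_eqI[of _ uminus])
  qed
  moreover have "(0, 0) \<notin> A" by (auto simp: A_def)
  ultimately show ?thesis
    using imbalance_symmetric[OF row_growth_rs_shape gen] by simp
qed

section \<open>Partitions, conjugation and dominance\<close>

lemma part_antimono:
  assumes "is_partition N p" and "1 \<le> i" and "i \<le> j"
  shows "part p j \<le> part p i"
proof (cases "i = j \<or> length p < j")
  case True
  then show ?thesis by (auto simp: part_def)
next
  case False
  then have "i - 1 < j - 1" "j - 1 < length p" using assms by auto
  then have "p ! (i - 1) \<ge> p ! (j - 1)"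
    using assms(1) sorted_wrt_nth_less unfolding is_partition_def by blast
  then show ?thesis using assms False by (simp add: part_def)
qed

lemma part_pos_iff:
  assumes "is_partition N p"
  shows "0 < part p k \<longleftrightarrow> 1 \<le> k \<and> k \<le> length p"
proof -
  have "p ! (k - 1) \<in> set p" if "1 \<le> k" "k \<le> length p"
    using that by (intro nth_mem) auto
  then have "p ! (k - 1) \<noteq> 0" if "1 \<le> k" "k \<le> length p"
    using that assms unfolding is_partition_def by metis
  then show ?thesis by (auto simp: part_def)
qed

lemma part_eq_0: "length p < k \<Longrightarrow> part p k = 0"
  by (simp add: part_def)

definition psum :: "nat list \<Rightarrow> nat \<Rightarrow> nat" where
  "psum p k = (\<Sum>i = 1..k. part p i)"

lemma psum_0 [simp]: "psum p 0 = 0"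
  and psum_Suc [simp]: "psum p (Suc k) = psum p k + part p (Suc k)"
  by (simp_all add: psum_def)

lemma sum_list_take: "sum_list (take k p) = psum p k"
proof (induction k)
  case (Suc k)
  show ?case
  proof (cases "k < length p")
    case True
    then show ?thesis using Suc by (simp add: take_Suc_conv_app_nth part_def)
  next
    case False
    then show ?thesis using Suc by (simp add: part_def)
  qed
qed simp

lemma dominated_by_iff: "dominated_by d e \<longleftrightarrow> (\<forall>k. psum d k \<le> psum e k)"
  by (simp add: dominated_by_def sum_list_take)

lemma psum_total:
  assumes "is_partition N p" and "length p \<le> k"
  shows "psum p k = N"
  using assms by (simp add: sum_list_take[symmetric] is_partition_def)

lemma partition_eqI:
  assumes "is_partition N p" and "is_partition M q" and "\<And>k. 1 \<le> k \<Longrightarrow> part p k = part q k"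
  shows "p = q"
proof -
  have "k \<le> length p \<longleftrightarrow> k \<le> length q" if "1 \<le> k" for k
    using part_pos_iff[OF assms(1), of k] part_pos_iff[OF assms(2), of k] assms(3)[OF that] that
    by simp
  then have len: "length p = length q"
    by (metis One_nat_def Suc_leI le_antisym le_refl le_zero_eq less_Suc_eq_0_disj neq0_conv not_less)
  show ?thesis
  proof (rule nth_equalityI[OF len])
    fix i assume "i < length p"
    then show "p ! i = q ! i" using assms(3)[of "Suc i"] len by (simp add: part_def)
  qed
qed

lemma dominated_by_antisym:
  assumes "is_partition N d" and "is_partition M e" and "dominated_by d e" and "dominated_by e d"
  shows "d = e"
proof (rule partition_eqI[OF assms(1,2)])
  fix k :: nat assume "1 \<le> k"
  have "psum d j = psum e j" for j
    using assms(3,4) by (simp add: dominated_by_iff le_antisym)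
  from this[of k] this[of "k - 1"] \<open>1 \<le> k\<close> show "part d k = part e k"
    by (cases k) auto
qed

lemma down_closed_eq_atLeastAtMost:
  assumes "finite K" and "\<And>k. k \<in> K \<Longrightarrow> 1 \<le> k" and "\<And>i k. k \<in> K \<Longrightarrow> 1 \<le> i \<Longrightarrow> i \<le> k \<Longrightarrow> i \<in> K"
  shows "K = {1..card K}"
proof (cases "K = {}")
  case False
  have "K = {1..Max K}"
  proof
    show "K \<subseteq> {1..Max K}" using assms(1,2) by auto
    show "{1..Max K} \<subseteq> K" using assms(1,3) Max_in[OF assms(1) False] by auto
  qed
  then show ?thesis by (metis card_atLeastAtMost diff_Suc_1)
qed simp

definition of_parts :: "(nat \<Rightarrow> nat) \<Rightarrow> nat list" where
  "of_parts f = row_lengths {(k, l). 1 \<le> k \<and> 1 \<le> l \<and> l \<le> f k}"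

lemma
  assumes mono: "\<And>i j. 1 \<le> i \<Longrightarrow> i \<le> j \<Longrightarrow> f j \<le> f i" and zero: "\<And>k. M < k \<Longrightarrow> f k = 0"
  shows part_of_parts: "1 \<le> k \<Longrightarrow> part (of_parts f) k = f k"
    and is_partition_of_parts: "is_partition (\<Sum>k = 1..M. f k) (of_parts f)"
proof -
  let ?K = "{k. 1 \<le> k \<and> 1 \<le> f k}"
  define m where "m = card ?K"
  have "k \<le> M" if "1 \<le> f k" for k using zero[of k] that by (cases "M < k") auto
  then have "?K \<subseteq> {1..M}" by auto
  then have fin: "finite ?K" by (rule finite_subset) simp
  have K: "?K = {1..m}"
    unfolding m_def
  proof (rule down_closed_eq_atLeastAtMost[OF fin])
    fix i k assume "k \<in> ?K" "1 \<le> i" "i \<le> k"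
    then show "i \<in> ?K" using mono[of i k] by simp
  qed simp
  have "{k. (k, 1) \<in> {(k, l). 1 \<le> k \<and> 1 \<le> l \<and> l \<le> f k}} = ?K" by auto
  then have rows: "num_rows {(k, l). 1 \<le> k \<and> 1 \<le> l \<and> l \<le> f k} = m"
    by (simp add: num_rows_def m_def)
  have cols: "card {l. (k, l) \<in> {(k, l). 1 \<le> k \<and> 1 \<le> l \<and> l \<le> f k}} = f k" if "1 \<le> k" for k
  proof -
    have "{l. (k, l) \<in> {(k, l). 1 \<le> k \<and> 1 \<le> l \<and> l \<le> f k}} = {1..f k}" using that by auto
    then show ?thesis by simp
  qed
  have eq: "of_parts f = map f [1..<Suc m]"
    unfolding of_parts_def row_lengths_def rows
    by (rule map_cong[OF refl]) (rule cols, auto)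
  have zero': "f k = 0" if "m < k" for k
  proof -
    have "k \<notin> ?K" using K that by simp
    then show ?thesis using that by auto
  qed
  show part: "part (of_parts f) k = f k" if "1 \<le> k" for k
    using that zero' by (auto simp: part_def eq simp del: upt_Suc)
  have "sorted_wrt (\<ge>) (of_parts f)"
    unfolding eq by (auto simp: sorted_wrt_iff_nth_less simp del: upt_Suc intro!: mono)
  moreover have "0 \<notin> set (of_parts f)"
  proof -
    have "1 \<le> f k" if "k \<in> {1..m}" for k using K that by blast
    then show ?thesis unfolding eq by fastforce
  qed
  moreover have "sum_list (of_parts f) = (\<Sum>k = 1..M. f k)"
  proof -
    have "m \<le> M" using \<open>?K \<subseteq> {1..M}\<close> K by (cases m) auto
    have "sum_list (of_parts f) = sum f {1..m}"
      unfolding eq by (simp add: sum_set_upt_conv_sum_list_nat[symmetric] atLeastLessThanSuc_atLeastAtMost del: upt_Suc)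
    also have "\<dots> = sum f {1..M}"
      by (rule sum.mono_neutral_left) (use \<open>m \<le> M\<close> zero' in auto)
    finally show ?thesis .
  qed
  ultimately show "is_partition (\<Sum>k = 1..M. f k) (of_parts f)"
    by (simp add: is_partition_def)
qed

lemma of_parts_part:
  assumes "is_partition N p"
  shows "of_parts (part p) = p"
proof (rule partition_eqI[OF is_partition_of_parts assms])
  show "part (of_parts (part p)) k = part p k" if "1 \<le> k" for k
    using that by (rule part_of_parts[of _ "length p", rotated 2])
      (use part_antimono[OF assms] part_eq_0 in auto)
qed (use part_antimono[OF assms] part_eq_0 in auto)

section \<open>Diagrams, conjugation and dominance\<close>

lemma diagram_eq_Sigma: "diagram p = Sigma {1..length p} (\<lambda>k. {1..part p k})"
  by (auto simp: diagram_def part_def split: if_splits)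

lemma finite_diagram: "finite (diagram p)"
  by (simp add: diagram_eq_Sigma)

lemma card_diagram_rows: "card {(k, l) \<in> diagram p. k \<le> K} = psum p K"
proof -
  have "{(k, l) \<in> diagram p. k \<le> K} = Sigma {1..K} (\<lambda>k. {1..part p k})"
    by (auto simp: diagram_def)
  then show ?thesis by (simp add: psum_def)
qed

lemma card_diagram:
  assumes "is_partition N p"
  shows "card (diagram p) = N"
proof -
  have "{(k, l) \<in> diagram p. k \<le> length p} = diagram p" by (auto simp: diagram_eq_Sigma)
  then show ?thesis using card_diagram_rows[of p "length p"] psum_total[OF assms] by simp
qed

lemma row_lengths_diagram:
  assumes "is_partition N p"
  shows "row_lengths (diagram p) = p"
  using of_parts_part[OF assms] by (simp add: of_parts_def diagram_def)

lemma is_young_diagram_diagram: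
  assumes "is_partition N p"
  shows "is_young_diagram (diagram p)"
  unfolding is_young_diagram_def
proof (intro conjI finite_diagram)
  show "\<forall>(k, l)\<in>diagram p. 1 \<le> k \<and> 1 \<le> l" by (auto simp: diagram_def)
  show "\<forall>(k, l)\<in>diagram p. \<forall>k' l'. 1 \<le> k' \<and> k' \<le> k \<and> 1 \<le> l' \<and> l' \<le> l \<longrightarrow> (k', l') \<in> diagram p"
    using part_antimono[OF assms] by (fastforce simp: diagram_def)
qed

text \<open>Row \<open>k\<close> reaches column \<open>l\<close> iff column \<open>l\<close> reaches
  row \<open>k\<close>. This Galois connection is the working description of the conjugate from here
  on.\<close>

lemma
  assumes "is_partition N p"
  shows part_conjugate_galois: "1 \<le> l \<Longrightarrow> 1 \<le> k \<Longrightarrow> k \<le> part (conjugate p) l \<longleftrightarrow> l \<le> part p k"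
    and is_partition_conjugate: "is_partition N (conjugate p)"
proof -
  define f where "f l = card {k. 1 \<le> k \<and> l \<le> part p k}" for l
  have rows: "{k. 1 \<le> k \<and> l \<le> part p k} = {1..f l}" if "1 \<le> l" for l
    unfolding f_def
  proof (rule down_closed_eq_atLeastAtMost)
    have "{k. 1 \<le> k \<and> l \<le> part p k} \<subseteq> {1..length p}"
      using that by (auto simp: part_def split: if_splits)
    then show "finite {k. 1 \<le> k \<and> l \<le> part p k}" by (rule finite_subset) simp
    fix i k assume "k \<in> {k. 1 \<le> k \<and> l \<le> part p k}" "1 \<le> i" "i \<le> k"
    then show "i \<in> {k. 1 \<le> k \<and> l \<le> part p k}" using part_antimono[OF assms, of i k] by simp
  qed simp
  have gal: "k \<le> f l \<longleftrightarrow> l \<le> part p k" if "1 \<le> l" "1 \<le> k" for k l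
    using rows[OF that(1)] that(2) by (metis (mono_tags, lifting) atLeastAtMost_iff mem_Collect_eq)
  have D: "{(l, k). (k, l) \<in> diagram p} = {(l, k). 1 \<le> l \<and> 1 \<le> k \<and> k \<le> f l}"
    using gal by (auto simp: diagram_def)
  then have eq: "conjugate p = of_parts f"
    by (simp add: conjugate_def of_parts_def)
  have mono: "f j \<le> f i" if "1 \<le> i" "i \<le> j" for i j
  proof (cases "f j = 0")
    case False
    then show ?thesis using gal[of j "f j"] gal[of i "f j"] that by simp
  qed simp
  have zero: "f l = 0" if "part p 1 < l" for l
  proof (rule ccontr)
    assume "f l \<noteq> 0"
    then have "l \<le> part p 1" using gal[of l 1] that by simp
    then show False using that by simp
  qed
  show "k \<le> part (conjugate p) l \<longleftrightarrow> l \<le> part p k" if "1 \<le> l" "1 \<le> k"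
    using part_of_parts[of f "part p 1" l] mono zero that gal eq by simp
  have P: "is_partition (\<Sum>k = 1..part p 1. f k) (conjugate p)"
    unfolding eq using mono zero by (rule is_partition_of_parts)
  have "diagram (conjugate p) = {(l, k). (k, l) \<in> diagram p}"
    unfolding D eq using part_of_parts[of f "part p 1"] mono zero by (auto simp: diagram_def)
  also have "\<dots> = prod.swap ` diagram p" by force
  finally have "card (diagram (conjugate p)) = N"
    using card_diagram[OF assms] by (simp add: card_image)
  then show "is_partition N (conjugate p)"
    using P card_diagram[OF P] by simp
qed

lemma diagram_conjugate:
  assumes "is_partition N p"
  shows "diagram (conjugate p) = prod.swap ` diagram p"
proof -
  have "(k, l) \<in> diagram (conjugate p) \<longleftrightarrow> (l, k) \<in> diagram p" for k l
    using part_conjugate_galois[OF assms, of k l] by (auto simp: diagram_def)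
  then show ?thesis by force
qed

lemma conjugate_conjugate:
  assumes "is_partition N p"
  shows "conjugate (conjugate p) = p"
proof (rule partition_eqI[OF is_partition_conjugate[OF is_partition_conjugate[OF assms]] assms])
  fix k :: nat assume k: "1 \<le> k"
  have "l \<le> part (conjugate (conjugate p)) k \<longleftrightarrow> l \<le> part p k" if "1 \<le> l" for l
    using part_conjugate_galois[OF assms that k]
      part_conjugate_galois[OF is_partition_conjugate[OF assms] k that] by simp
  then show "part (conjugate (conjugate p)) k = part p k"
    by (metis le_antisym le_refl le_zero_eq less_one not_less)
qed

text \<open>Inclusion-exclusion for the boxes in the first \<open>K\<close> rows and those in the
  first \<open>j\<close> columns: the union lies in the diagram, the intersection in a
  \<open>K\<close> by \<open>j\<close> rectangle. If \<open>K\<close> is the height of column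
  \<open>j\<close>, the rectangle is full and no box lies outside the union.\<close>

lemma
  assumes p: "is_partition N p"
  shows psum_conjugate_le: "psum p K + psum (conjugate p) j \<le> K * j + N"
    and psum_conjugate_eq: "1 \<le> j \<Longrightarrow> K = part (conjugate p) j \<Longrightarrow>
      psum p K + psum (conjugate p) j = K * j + N"
proof -
  let ?A = "{(k, l) \<in> diagram p. k \<le> K}" and ?B = "{(k, l) \<in> diagram p. l \<le> j}"
  have "?B = prod.swap ` {(k, l) \<in> diagram (conjugate p). k \<le> j}"
    unfolding diagram_conjugate[OF p] by force
  then have B: "card ?B = psum (conjugate p) j"
    by (simp add: card_image card_diagram_rows)
  have fin: "finite ?A" "finite ?B" using finite_diagram by (auto intro: rev_finite_subset)
  have sum: "psum p K + psum (conjugate p) j = card (?A \<union> ?B) + card (?A \<inter> ?B)"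
    using card_Un_Int[OF fin] B by (simp add: card_diagram_rows)
  have 1: "card (?A \<union> ?B) \<le> N"
    using card_mono[OF finite_diagram[of p], of "?A \<union> ?B"] card_diagram[OF p] by auto
  have sub: "?A \<inter> ?B \<subseteq> {1..K} \<times> {1..j}" by (auto simp: diagram_def)
  then have "card (?A \<inter> ?B) \<le> card ({1..K} \<times> {1..j})" by (intro card_mono) auto
  then have 2: "card (?A \<inter> ?B) \<le> K * j" by simp
  show "psum p K + psum (conjugate p) j \<le> K * j + N" using sum 1 2 by simp
  assume j: "1 \<le> j" and K: "K = part (conjugate p) j"
  have gal: "k \<le> K \<longleftrightarrow> j \<le> part p k" if "1 \<le> k" for k
    using part_conjugate_galois[OF p j that] K by simp
  have "?A \<union> ?B = diagram p" using gal by (auto simp: diagram_def)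
  moreover have "?A \<inter> ?B = {1..K} \<times> {1..j}"
    using gal by (fastforce simp: diagram_def)
  ultimately show "psum p K + psum (conjugate p) j = K * j + N"
    using sum card_diagram[OF p] by simp
qed

lemma dominated_by_conjugate:
  assumes b: "is_partition N b" and g: "is_partition N g" and "dominated_by b g"
  shows "dominated_by (conjugate g) (conjugate b)"
  unfolding dominated_by_iff
proof
  fix j
  show "psum (conjugate g) j \<le> psum (conjugate b) j"
  proof (cases "j = 0")
    case False
    \<comment> \<open>With the height of column \<open>j\<close> of \<open>b\<close> the box count
      is exact for \<open>b\<close> and an upper bound for \<open>g\<close>.\<close>
    define K where "K = part (conjugate b) j"
    have "psum b K + psum (conjugate b) j = K * j + N"
      using psum_conjugate_eq[OF b _ K_def] False by simp
    moreover have "psum g K + psum (conjugate g) j \<le> K * j + N"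
      by (rule psum_conjugate_le[OF g])
    moreover have "psum b K \<le> psum g K" using assms(3) by (simp add: dominated_by_iff)
    ultimately show ?thesis by linarith
  qed simp
qed

section \<open>Multiplicities of parts and the conditions of type \<open>D\<close> and
  \<open>C\<close>\<close>

lemma count_list_conv_card: "count_list xs x = card {i. i < length xs \<and> xs ! i = x}"
proof -
  have "count_list xs x = length (filter ((=) x) xs)" by (induction xs) auto
  then show ?thesis by (simp add: length_filter_conv_card eq_commute)
qed

lemma count_list_eq_card_parts:
  assumes "1 \<le> x"
  shows "count_list d x = card {k. 1 \<le> k \<and> part d k = x}"
proof -
  have "{k. 1 \<le> k \<and> part d k = x} = Suc ` {i. i < length d \<and> d ! i = x}"
  proof
    show "{k. 1 \<le> k \<and> part d k = x} \<subseteq> Suc ` {i. i < length d \<and> d ! i = x}"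
    proof
      fix k assume "k \<in> {k. 1 \<le> k \<and> part d k = x}"
      then show "k \<in> Suc ` {i. i < length d \<and> d ! i = x}"
        using assms by (intro image_eqI[of _ _ "k - 1"]) (auto simp: part_def split: if_splits)
    qed
  qed (auto simp: part_def)
  then show ?thesis by (simp add: count_list_conv_card card_image)
qed

lemma count_parts_even_iff:
  assumes "is_partition N d"
  shows "(\<forall>x\<in>set d. Q x \<longrightarrow> even (count_list d x)) \<longleftrightarrow>
    (\<forall>x\<ge>1. Q x \<longrightarrow> even (card {k. 1 \<le> k \<and> part d k = x}))"
proof -
  have "1 \<le> x" if "x \<in> set d" for x
    using assms that unfolding is_partition_def by (metis less_one not_less)
  moreover have "count_list d x = 0" if "x \<notin> set d" for x
    using that by (simp add: count_list_0_iff)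
  ultimately show ?thesis using count_list_eq_card_parts by (metis even_zero)
qed

lemma is_type_D_iff:
  "is_type_D n d \<longleftrightarrow> is_partition (2 * n) d \<and>
     (\<forall>x\<ge>1. even x \<longrightarrow> even (card {k. 1 \<le> k \<and> part d k = x}))"
  unfolding is_type_D_def using count_parts_even_iff[of "2 * n" d even] by blast

lemma is_type_C_iff:
  "is_type_C n d \<longleftrightarrow> is_partition (2 * n) d \<and>
     (\<forall>x\<ge>1. odd x \<longrightarrow> even (card {k. 1 \<le> k \<and> part d k = x}))"
  unfolding is_type_C_def using count_parts_even_iff[of "2 * n" d odd] by blast

lemma finite_part_level:
  assumes "1 \<le> x"
  shows "finite {k. 1 \<le> k \<and> part d k = x}"
proof -
  have "{k. 1 \<le> k \<and> part d k = x} \<subseteq> {1..length d}"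
    using assms by (auto simp: part_def split: if_splits)
  then show ?thesis by (rule finite_subset) simp
qed

text \<open>The multiplicity of \<open>x\<close> is the difference of the lengths of columns
  \<open>x\<close> and \<open>Suc x\<close>.\<close>

lemma is_type_D_conjugate_iff:
  assumes "is_partition (2 * n) d"
  shows "is_type_D n d \<longleftrightarrow>
    (\<forall>x\<ge>1. even x \<longrightarrow> even (part (conjugate d) x + part (conjugate d) (Suc x)))"
proof -
  have step: "part (conjugate d) x = part (conjugate d) (Suc x) + card {k. 1 \<le> k \<and> part d k = x}"
    if x: "1 \<le> x" for x
  proof -
    have up: "{1..part (conjugate d) y} = {k. 1 \<le> k \<and> y \<le> part d k}" if "1 \<le> y" for y
      using part_conjugate_galois[OF assms that] by auto
    have "{1..part (conjugate d) x} = {1..part (conjugate d) (Suc x)} \<union> {k. 1 \<le> k \<and> part d k = x}"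
      using up[of x] up[of "Suc x"] x by auto
    moreover have "{1..part (conjugate d) (Suc x)} \<inter> {k. 1 \<le> k \<and> part d k = x} = {}"
      using up[of "Suc x"] by auto
    ultimately have "card {1..part (conjugate d) x} =
        card {1..part (conjugate d) (Suc x)} + card {k. 1 \<le> k \<and> part d k = x}"
      using card_Un_disjoint[OF _ finite_part_level[OF x, of d], of "{1..part (conjugate d) (Suc x)}"]
      by (metis finite_atLeastAtMost)
    then show ?thesis by simp
  qed
  have "even (part (conjugate d) x + part (conjugate d) (Suc x)) \<longleftrightarrow>
      even (card {k. 1 \<le> k \<and> part d k = x})" if "1 \<le> x" for x
    using step[OF that] by presburger
  then show ?thesis
    unfolding is_type_D_iff using assms by blast
qed

text \<open>After an odd index the remaining parts pair off with even sums until the even total is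
  reached.\<close>

lemma psum_odd_even:
  assumes g: "is_partition (2 * n) g" and e: "\<forall>x\<ge>1. even x \<longrightarrow> even (part g x + part g (Suc x))"
    and "odd k"
  shows "even (psum g k)"
proof -
  have "even (psum g (k + 2 * i)) \<longleftrightarrow> even (psum g k)" for i
  proof (induction i)
    case (Suc i)
    have "even (part g (Suc (k + 2 * i)) + part g (Suc (Suc (k + 2 * i))))"
      using e \<open>odd k\<close> by simp
    moreover have "psum g (k + 2 * Suc i) =
        psum g (k + 2 * i) + (part g (Suc (k + 2 * i)) + part g (Suc (Suc (k + 2 * i))))"
      by simp
    ultimately show ?case using Suc by presburger
  qed simp
  from this[of "length g"] psum_total[OF g, of "k + 2 * length g"] show ?thesis by simp
qed

text \<open>The partial sums of \<open>c\<close> exceed those of \<open>b\<close> by at most one, exactly where every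
  partition above \<open>b\<close> with even odd-indexed partial sums has to.\<close>

lemma conjugate_D_collapse_conjugate:
  assumes b: "is_partition (2 * n) b" and c: "is_partition (2 * n) c"
    and ev: "\<forall>x\<ge>1. even x \<longrightarrow> even (part c x + part c (Suc x))"
    and sums: "\<And>k. psum c k = psum b k + of_bool (\<delta> k)"
    and odd: "\<And>k. odd k \<Longrightarrow> \<delta> k \<Longrightarrow> odd (psum b k)"
    and even: "\<And>k. even k \<Longrightarrow> \<delta> k \<Longrightarrow> 1 \<le> k \<and> part b k = part b (Suc k) \<and> \<delta> (k - 1) \<and> \<delta> (Suc k)"
  shows "conjugate (D_collapse n (conjugate b)) = c"
proof -
  have cc: "is_partition (2 * n) (conjugate c)" and cb: "is_partition (2 * n) (conjugate b)"
    using b c is_partition_conjugate by auto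
  have "D_collapse n (conjugate b) = conjugate c"
    unfolding D_collapse_def
  proof (rule the_equality)
    have "is_type_D n (conjugate c)"
      unfolding is_type_D_conjugate_iff[OF cc] conjugate_conjugate[OF c] by (rule ev)
    moreover have "dominated_by (conjugate c) (conjugate b)"
      by (rule dominated_by_conjugate[OF b c]) (simp add: dominated_by_iff sums)
    moreover have "dominated_by f (conjugate c)"
      if f: "is_type_D n f" "dominated_by f (conjugate b)" for f
    proof -
      have pf: "is_partition (2 * n) f" using f(1) by (simp add: is_type_D_def)
      define g where "g = conjugate f"
      have g: "is_partition (2 * n) g" using is_partition_conjugate[OF pf] by (simp add: g_def)
      have bg: "psum b k \<le> psum g k" for k
        using dominated_by_conjugate[OF pf cb f(2)] conjugate_conjugate[OF b]
        by (simp add: dominated_by_iff g_def)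
      have "\<forall>x\<ge>1. even x \<longrightarrow> even (part g x + part g (Suc x))"
        using f(1) is_type_D_conjugate_iff[OF pf] by (simp add: g_def)
      then have ge: "Parity.even (psum g k)" if "Parity.odd k" for k
        using psum_odd_even[OF g] that by blast
      have odd': "Suc (psum b k) \<le> psum g k" if "Parity.odd k" "\<delta> k" for k
        using bg[of k] ge[OF that(1)] odd[OF that] by (metis Suc_leI le_neq_implies_less)
      have "psum c k \<le> psum g k" for k
      proof (cases "\<delta> k")
        case False
        then show ?thesis using bg[of k] sums[of k] by simp
      next
        case True
        show ?thesis
        proof (cases "Parity.odd k")
          case True
          then show ?thesis using odd'[OF True \<open>\<delta> k\<close>] sums[of k] \<open>\<delta> k\<close> by simp
        next
          case False
          then have ek: "1 \<le> k" "part b k = part b (Suc k)" "\<delta> (k - 1)" "\<delta> (Suc k)"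
            using even[of k] \<open>\<delta> k\<close> by auto
          then obtain j where j: "k = Suc j" by (cases k) auto
          have "Suc (psum b j) \<le> psum g j" "Suc (psum b (Suc k)) \<le> psum g (Suc k)"
            using odd'[of j] odd'[of "Suc k"] ek False j by auto
          \<comment> \<open>Partial sums of \<open>g\<close> are concave, while those of
            \<open>b\<close> are linear from \<open>k - 1\<close> to \<open>Suc k\<close>. An excess
            at both neighbours of \<open>k\<close> therefore forces one at \<open>k\<close>.\<close>
          moreover have "part g (Suc k) \<le> part g k"
            using part_antimono[OF g ek(1)] by simp
          ultimately have "Suc (psum b k) \<le> psum g k"
            using ek(2) j by simp
          then show ?thesis using sums[of k] \<open>\<delta> k\<close> by simp
        qed
      qed
      then have "dominated_by c g" by (simp add: dominated_by_iff)
      then show ?thesis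
        using dominated_by_conjugate[OF c g] conjugate_conjugate[OF pf] by (simp add: g_def)
    qed
    ultimately show *: "is_type_D n (conjugate c) \<and> dominated_by (conjugate c) (conjugate b) \<and>
      (\<forall>f. is_type_D n f \<and> dominated_by f (conjugate b) \<longrightarrow> dominated_by f (conjugate c))"
      by blast
    fix e assume "is_type_D n e \<and> dominated_by e (conjugate b) \<and>
      (\<forall>f. is_type_D n f \<and> dominated_by f (conjugate b) \<longrightarrow> dominated_by f e)"
    with * show "e = conjugate c"
      using dominated_by_antisym[of "2 * n" e "2 * n" "conjugate c"] unfolding is_type_D_def by blast
  qed
  then show ?thesis using conjugate_conjugate[OF c] by simp
qed

section \<open>The special and the metaplectic partition\<close>

text \<open>The row pairs \<open>(1, 2)\<close>, \<open>(3, 4)\<close>, ... are corrected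
  independently, and only if their parts differ. In a partition the subtraction never truncates,
  since it takes place only above a strictly smaller part.\<close>

definition special_part :: "nat list \<Rightarrow> nat \<Rightarrow> nat" where
  "special_part p k =
     (if odd (part p k) then part p k
      else if odd k then part p k - of_bool (part p (Suc k) \<noteq> part p k)
      else part p k + of_bool (part p (k - 1) \<noteq> part p k))"

text \<open>Here the row pairs are \<open>(2, 3)\<close>, \<open>(4, 5)\<close>, ..., and row 1
  stands alone: as \<open>part p 0 = 0\<close> differs from any odd part, an odd first part is
  increased.\<close>

definition metaplectic_part :: "nat list \<Rightarrow> nat \<Rightarrow> nat" where
  "metaplectic_part p k =
     (if even (part p k) then part p k
      else if odd k then part p k + of_bool (part p (k - 1) \<noteq> part p k)
      else part p k - of_bool (part p (Suc k) \<noteq> part p k))"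

text \<open>Marks where the partial sums of \<open>metaplectic_part p\<close> are one larger than
  those of \<open>special_part p\<close>. At odd \<open>k\<close> these are the indices with odd
  \<open>special_part p k\<close>; at even \<open>k\<close> they lie inside a run of equal odd
  parts, where concavity forces the excess.\<close>

definition excess :: "nat list \<Rightarrow> nat \<Rightarrow> bool" where
  "excess p k \<longleftrightarrow>
     (if odd k then \<not> (even (part p k) \<and> part p (Suc k) = part p k)
      else odd (part p k) \<and> part p (Suc k) = part p k)"

lemma antimono_from_1:
  fixes f :: "nat \<Rightarrow> nat"
  assumes "\<And>k. 1 \<le> k \<Longrightarrow> f (Suc k) \<le> f k" and "1 \<le> i" and "i \<le> j"
  shows "f j \<le> f i"
  using assms(3)
proof (induction rule: dec_induct)
  case (step k)
  then show ?case using assms(1)[of k] assms(2) by simp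
qed simp

lemma even_card_pairs:
  fixes S :: "nat set"
  assumes "finite S" and "\<And>k. k \<in> S \<Longrightarrow> r \<le> k"
    and "\<And>i. 2 * i + r \<in> S \<longleftrightarrow> Suc (2 * i + r) \<in> S"
  shows "even (card S)"
proof -
  define I where "I = {i. 2 * i + r \<in> S}"
  have S: "S = (\<lambda>i. 2 * i + r) ` I \<union> (\<lambda>i. Suc (2 * i + r)) ` I" (is "_ = ?A \<union> ?B")
  proof
    show "S \<subseteq> ?A \<union> ?B"
    proof
      fix k assume k: "k \<in> S"
      define i where "i = (k - r) div 2"
      have "k = 2 * i + r \<or> k = Suc (2 * i + r)" using assms(2)[OF k] unfolding i_def by presburger
      then show "k \<in> ?A \<union> ?B" using assms(3)[of i] k by (auto simp: I_def)
    qed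
    show "?A \<union> ?B \<subseteq> S" using assms(3) by (auto simp: I_def)
  qed
  have fin: "finite ?A" "finite ?B" using S assms(1) by (metis finite_Un)+
  have disj: "?A \<inter> ?B = {}" by (auto; presburger)
  have "card ?A = card I" "card ?B = card I" by (auto intro!: card_image simp: inj_on_def)
  then show ?thesis using S card_Un_disjoint[OF fin disj] by simp
qed

context
  fixes N :: nat and p :: "nat list"
  assumes p: "is_partition N p"
begin

lemma part_Suc_le: "1 \<le> k \<Longrightarrow> part p (Suc k) \<le> part p k"
  using part_antimono[OF p] by simp

lemma part_pred_ge: "2 \<le> k \<Longrightarrow> part p k \<le> part p (k - 1)"
  using part_antimono[OF p, of "k - 1" k] by simp

lemma special_part_Suc_le:
  assumes "1 \<le> k"
  shows "special_part p (Suc k) \<le> special_part p k"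
proof -
  have "part p (Suc k) = part p k \<or> Suc (part p (Suc k)) \<le> part p k"
    using part_Suc_le[OF assms] by auto
  then show ?thesis
  proof
    assume e: "part p (Suc k) = part p k"
    then show ?thesis by (auto simp: special_part_def)
  next
    assume l: "Suc (part p (Suc k)) \<le> part p k"
    have "special_part p (Suc k) \<le> Suc (part p (Suc k)) \<and>
        (odd (part p (Suc k)) \<or> odd (Suc k) \<longrightarrow> special_part p (Suc k) \<le> part p (Suc k))"
      by (auto simp: special_part_def)
    moreover have "part p k - 1 \<le> special_part p k \<and>
        (odd (part p k) \<or> even k \<longrightarrow> part p k \<le> special_part p k)"
      by (auto simp: special_part_def)
    moreover have "Suc (Suc (part p (Suc k))) \<le> part p k"
      if "even (part p (Suc k))" "even (part p k)"
      using that l by presburger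
    ultimately show ?thesis using l by (cases "even k") auto
  qed
qed

lemma metaplectic_part_Suc_le:
  assumes "1 \<le> k"
  shows "metaplectic_part p (Suc k) \<le> metaplectic_part p k"
proof -
  have "part p (Suc k) = part p k \<or> Suc (part p (Suc k)) \<le> part p k"
    using part_Suc_le[OF assms] by auto
  then show ?thesis
  proof
    assume e: "part p (Suc k) = part p k"
    then show ?thesis by (auto simp: metaplectic_part_def)
  next
    assume l: "Suc (part p (Suc k)) \<le> part p k"
    have "metaplectic_part p (Suc k) \<le> Suc (part p (Suc k)) \<and>
        (even (part p (Suc k)) \<or> even (Suc k) \<longrightarrow> metaplectic_part p (Suc k) \<le> part p (Suc k))"
      by (auto simp: metaplectic_part_def)
    moreover have "part p k - 1 \<le> metaplectic_part p k \<and>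
        (even (part p k) \<or> odd k \<longrightarrow> part p k \<le> metaplectic_part p k)"
      by (auto simp: metaplectic_part_def)
    moreover have "Suc (Suc (part p (Suc k))) \<le> part p k"
      if "odd (part p (Suc k))" "odd (part p k)"
      using that l by presburger
    ultimately show ?thesis using l by (cases "even k") auto
  qed
qed

text \<open>The bound has to be even to keep row pairs complete: if \<open>length p\<close> is odd
  and the last part is even, row \<open>length p + 1\<close> gets a box.\<close>

lemma special_part_eq_0: "2 * m < k \<Longrightarrow> length p \<le> 2 * m \<Longrightarrow> special_part p k = 0"
proof -
  assume k: "2 * m < k" "length p \<le> 2 * m"
  then have "part p k = 0" "part p (Suc k) = 0" by (simp_all add: part_eq_0)
  moreover have "part p (k - 1) = 0" if "even k"
  proof -
    have "2 * m < k - 1" using k that by presburger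
    then show ?thesis using k by (simp add: part_eq_0)
  qed
  ultimately show ?thesis by (simp add: special_part_def)
qed

lemma metaplectic_part_eq_0: "length p < k \<Longrightarrow> metaplectic_part p k = 0"
  by (simp add: part_eq_0 metaplectic_part_def)

text \<open>A pair gains one box for an odd first part and loses one for an odd second part. Over
  all pairs, gains and losses cancel by balance.\<close>

lemma special_part_pair:
  "special_part p (Suc (2 * i)) + special_part p (Suc (Suc (2 * i))) + of_bool (odd (part p (Suc (Suc (2 * i))))) =
   part p (Suc (2 * i)) + part p (Suc (Suc (2 * i))) + of_bool (odd (part p (Suc (2 * i))))"
  using part_Suc_le[of "Suc (2 * i)"] by (auto simp: special_part_def)

lemma special_part_pair_parity:
  "odd (special_part p (Suc (2 * i))) \<and> odd (special_part p (Suc (Suc (2 * i)))) \<or>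
   even (special_part p (Suc (2 * i))) \<and> special_part p (Suc (2 * i)) = special_part p (Suc (Suc (2 * i)))"
  using part_Suc_le[of "Suc (2 * i)"] by (auto simp: special_part_def)

lemma odd_special_part_iff:
  "odd k \<Longrightarrow> odd (special_part p k) \<longleftrightarrow> \<not> (even (part p k) \<and> part p (Suc k) = part p k)"
  using part_Suc_le[of k] by (cases k) (auto simp: special_part_def)

text \<open>The telescoping step for comparing the partial sums of the two corrections.\<close>

lemma metaplectic_part_excess:
  assumes "1 \<le> k"
  shows "metaplectic_part p k + of_bool (excess p (k - 1)) = special_part p k + of_bool (excess p k)"
proof (cases "odd k")
  case True
  have "part p 0 = 0" by (simp add: part_def)
  show ?thesis
    using True part_Suc_le[OF assms]
    by (auto simp: metaplectic_part_def special_part_def excess_def)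
next
  case False
  then show ?thesis
    using part_Suc_le[OF assms] part_pred_ge[of k] assms
    by (auto simp: metaplectic_part_def special_part_def excess_def elim: oddE)
qed

end

section \<open>The two corrected partitions, their sizes and types\<close>

definition special_partition :: "nat list \<Rightarrow> nat list" where
  "special_partition p = of_parts (special_part p)"

definition metaplectic_partition :: "nat list \<Rightarrow> nat list" where
  "metaplectic_partition p = of_parts (metaplectic_part p)"

context
  fixes n :: nat and p :: "nat list"
  assumes p: "is_partition (2 * n) p" and bal: "imbalance (\<lambda>i. part p (Suc i)) = 0"
begin

lemma sum_parity_signs:
  assumes "length p \<le> 2 * m"
  shows "(\<Sum>i<m. of_bool (odd (part p (Suc (2 * i)))) :: nat) =
    (\<Sum>i<m. of_bool (odd (part p (Suc (Suc (2 * i))))))"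
proof -
  have "i < 2 * m" if "odd (part p (Suc i))" for i
    using assms part_eq_0[of p "Suc i"] that by (cases "length p < Suc i") auto
  then have "{i. odd (part p (Suc i))} = {i \<in> {..<2 * m}. odd (part p (Suc i))}" by auto
  then have "imbalance (\<lambda>i. part p (Suc i)) = (\<Sum>i<2 * m. if odd (part p (Suc i)) then (- 1) ^ i else 0)"
    unfolding imbalance_def by (simp only: sum.inter_filter finite_lessThan)
  also have "(\<Sum>i<2 * m. if odd (part p (Suc i)) then (- 1) ^ i else 0) =
      (int (\<Sum>i<m. of_bool (odd (part p (Suc (2 * i))))) -
       int (\<Sum>i<m. of_bool (odd (part p (Suc (Suc (2 * i)))))))"
    by (induction m) auto
  finally show ?thesis using bal by simp
qed

lemma sum_special_part:
  assumes "length p \<le> 2 * m"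
  shows "(\<Sum>k = 1..2 * m. special_part p k) = 2 * n"
proof -
  have "(\<Sum>k = 1..2 * m. special_part p k) + (\<Sum>i<m. of_bool (odd (part p (Suc (Suc (2 * i)))))) =
      psum p (2 * m) + (\<Sum>i<m. of_bool (odd (part p (Suc (2 * i)))))" for m
  proof (induction m)
    case (Suc m)
    then show ?case using special_part_pair[OF p, of m] by simp
  qed simp
  from this[of m] show ?thesis
    using sum_parity_signs[OF assms] psum_total[OF p assms] by simp
qed

lemma part_special_partition: "1 \<le> k \<Longrightarrow> part (special_partition p) k = special_part p k"
  unfolding special_partition_def
  by (rule part_of_parts[of _ "2 * length p", rotated 2])
    (use antimono_from_1[of "special_part p"] special_part_Suc_le[OF p]
      special_part_eq_0[OF p, of "length p"] in auto)

lemma special_partition: "is_partition (2 * n) (special_partition p)"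
proof -
  have "is_partition (\<Sum>k = 1..2 * length p. special_part p k) (of_parts (special_part p))"
    by (rule is_partition_of_parts)
      (use antimono_from_1[of "special_part p"] special_part_Suc_le[OF p]
        special_part_eq_0[OF p, of "length p"] in auto)
  then show ?thesis using sum_special_part[of "length p"] by (simp add: special_partition_def)
qed

text \<open>The two parts of a row pair are both odd or equal, so they vanish together.\<close>

lemma even_length_special_partition: "even (length (special_partition p))"
proof (rule ccontr)
  assume "odd (length (special_partition p))"
  then obtain i where i: "length (special_partition p) = Suc (2 * i)" by (auto elim: oddE)
  then have "0 < special_part p (Suc (2 * i))"
    using part_pos_iff[OF special_partition, of "Suc (2 * i)"] part_special_partition by simp
  moreover have "special_part p (Suc (Suc (2 * i))) = 0"
    using part_eq_0[of "special_partition p" "Suc (Suc (2 * i))"] part_special_partition i by simp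
  ultimately show False using special_part_pair_parity[OF p, of i] by auto
qed

lemma length_le_special_partition: "length p \<le> length (special_partition p)"
proof (cases "length p = 0")
  case False
  let ?k = "length p"
  have "0 < part p ?k" "part p (Suc ?k) = 0"
    using part_pos_iff[OF p, of ?k] False by (auto simp: part_eq_0)
  then have "0 < special_part p ?k" by (auto simp: special_part_def elim!: evenE)
  then show ?thesis
    using part_pos_iff[OF special_partition, of ?k] part_special_partition[of ?k] False by simp
qed simp

lemma special_partition_type_D: "is_type_D n (special_partition p)"
  unfolding is_type_D_iff
proof (intro conjI special_partition allI impI)
  fix x :: nat assume x: "1 \<le> x" "even x"
  show "even (card {k. 1 \<le> k \<and> part (special_partition p) k = x})"
  proof (rule even_card_pairs[where r = 1])
    fix i
    show "2 * i + 1 \<in> {k. 1 \<le> k \<and> part (special_partition p) k = x} \<longleftrightarrow>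
        Suc (2 * i + 1) \<in> {k. 1 \<le> k \<and> part (special_partition p) k = x}"
      using special_part_pair_parity[OF p, of i] x by (auto simp: part_special_partition)
  qed (use finite_part_level x in auto)
qed

lemma psum_metaplectic_special:
  "(\<Sum>i = 1..k. metaplectic_part p i) = psum (special_partition p) k + of_bool (excess p k)"
proof (induction k)
  case 0
  then show ?case by (simp add: excess_def part_def)
next
  case (Suc k)
  then show ?case
    using metaplectic_part_excess[OF p, of "Suc k"] by (simp add: part_special_partition)
qed

lemma part_metaplectic_partition: "1 \<le> k \<Longrightarrow> part (metaplectic_partition p) k = metaplectic_part p k"
  unfolding metaplectic_partition_def
  by (rule part_of_parts[of _ "length p", rotated 2])
    (use antimono_from_1[of "metaplectic_part p"] metaplectic_part_Suc_le[OF p]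
      metaplectic_part_eq_0[OF p] in auto)

lemma psum_metaplectic_partition:
  "psum (metaplectic_partition p) k = psum (special_partition p) k + of_bool (excess p k)"
  unfolding psum_metaplectic_special[symmetric]
  by (simp add: psum_def part_metaplectic_partition)

lemma metaplectic_partition: "is_partition (2 * n) (metaplectic_partition p)"
proof -
  have "is_partition (\<Sum>k = 1..2 * length p. metaplectic_part p k) (of_parts (metaplectic_part p))"
    by (rule is_partition_of_parts)
      (use antimono_from_1[of "metaplectic_part p"] metaplectic_part_Suc_le[OF p]
        metaplectic_part_eq_0[OF p] in auto)
  moreover have "(\<Sum>k = 1..2 * length p. metaplectic_part p k) = 2 * n"
  proof -
    have "\<not> excess p (2 * length p)"
      using part_eq_0[of p "2 * length p"] by (cases "length p = 0") (auto simp: excess_def part_def)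
    moreover have "psum (special_partition p) (2 * length p) = 2 * n"
      using sum_special_part[of "length p"] by (simp add: psum_def part_special_partition)
    ultimately show ?thesis unfolding psum_metaplectic_special by simp
  qed
  ultimately show ?thesis by (simp add: metaplectic_partition_def)
qed

lemma metaplectic_part_pair:
  assumes "1 \<le> k" and "even k"
  shows "odd (metaplectic_part p k) \<and> metaplectic_part p (Suc k) = metaplectic_part p k \<or>
    even (metaplectic_part p k) \<and> even (metaplectic_part p (Suc k))"
  using assms part_Suc_le[OF p assms(1)] by (auto simp: metaplectic_part_def)

lemma metaplectic_partition_type_C: "is_type_C n (metaplectic_partition p)"
  unfolding is_type_C_iff
proof (intro conjI metaplectic_partition allI impI)
  fix x :: nat assume x: "1 \<le> x" "odd x"
  show "even (card {k. 1 \<le> k \<and> part (metaplectic_partition p) k = x})"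
  \<comment> \<open>The first part is even, so odd parts occur only in the row pairs
    \<open>(2, 3)\<close>, \<open>(4, 5)\<close>, ...\<close>
  proof (rule even_card_pairs[where r = 2])
    fix i
    show "2 * i + 2 \<in> {k. 1 \<le> k \<and> part (metaplectic_partition p) k = x} \<longleftrightarrow>
        Suc (2 * i + 2) \<in> {k. 1 \<le> k \<and> part (metaplectic_partition p) k = x}"
      using metaplectic_part_pair[of "2 * i + 2"] x by (auto simp: part_metaplectic_partition)
  next
    fix k assume k: "k \<in> {k. 1 \<le> k \<and> part (metaplectic_partition p) k = x}"
    have "part p 0 = 0" by (simp add: part_def)
    then have "even (metaplectic_part p 1)" by (auto simp: metaplectic_part_def elim: oddE)
    then show "2 \<le> k"
      using k x part_metaplectic_partition[of 1] by (cases "k = 1") auto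
  qed (use finite_part_level x in auto)
qed

lemma conjugate_D_collapse_special:
  "conjugate (D_collapse n (conjugate (special_partition p))) = metaplectic_partition p"
proof (rule conjugate_D_collapse_conjugate[OF special_partition metaplectic_partition _ psum_metaplectic_partition])
  show "\<forall>x\<ge>1. even x \<longrightarrow>
      even (part (metaplectic_partition p) x + part (metaplectic_partition p) (Suc x))"
  proof (intro allI impI)
    fix x :: nat assume "1 \<le> x" "even x"
    then show "even (part (metaplectic_partition p) x + part (metaplectic_partition p) (Suc x))"
      using metaplectic_part_pair[of x] by (auto simp: part_metaplectic_partition)
  qed
next
  fix k assume k: "odd k" "excess p k"
  then obtain i where i: "k = Suc (2 * i)" by (auto elim: oddE)
  \<comment> \<open>Row pairs have even sums, so at an odd index the parity of the partial sum is
    that of its last part.\<close>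
  have "even (psum (special_partition p) (2 * i))" for i
  proof (induction i)
    case (Suc i)
    have "even (special_part p (Suc (2 * i)) + special_part p (Suc (Suc (2 * i))))"
      using special_part_pair_parity[OF p, of i] by auto
    with Suc show ?case by (simp add: part_special_partition)
  qed simp
  moreover have "odd (special_part p k)"
    using odd_special_part_iff[OF p k(1)] k by (simp add: excess_def)
  ultimately show "odd (psum (special_partition p) k)"
    using i by (simp add: part_special_partition)
next
  fix k assume k: "even k" "excess p k"
  then have o: "odd (part p k)" "part p (Suc k) = part p k" by (auto simp: excess_def)
  then have k1: "1 \<le> k" by (cases k) (auto simp: part_def)
  with k obtain j where "k = Suc j" "odd j" by (cases k) auto
  then show "1 \<le> k \<and> part (special_partition p) k = part (special_partition p) (Suc k) \<and>
      excess p (k - 1) \<and> excess p (Suc k)"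
    using k1 o k by (auto simp: part_special_partition special_part_def excess_def)
qed

subsection \<open>The H-algorithm\<close>

lemma skip_pair_iff:
  "skip_pair p i \<longleftrightarrow> 1 \<le> i \<and> Suc i \<le> length p \<and> part p (Suc i) = part p i \<and> odd (i + part p i)"
  by (auto simp: skip_pair_def)

lemma labeled_rows_iff:
  "i \<in> labeled_rows p \<longleftrightarrow> 1 \<le> i \<and> i \<le> length p \<and> \<not> skip_pair p i \<and> \<not> skip_pair p (i - 1)"
  unfolding labeled_rows_def by (cases i) (auto simp: skip_pair_def)

text \<open>A skipped pair advances the row number by two and the label count by zero. Since
  \<open>row_label\<close> is also defined on skipped rows, the parities disagree exactly at the
  first row of a pair.\<close>

lemma row_label_parity:
  assumes "i \<le> length p"
  shows "odd (row_label p i) \<longleftrightarrow> (if skip_pair p i then even i else odd i)"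
  using assms
proof (induction i)
  case 0
  have "{j \<in> labeled_rows p. j \<le> 0} = {}" by (auto simp: labeled_rows_def)
  then have "row_label p 0 = 0" unfolding row_label_def by (simp only: card.empty)
  then show ?case by (simp add: skip_pair_def)
next
  case (Suc i)
  show ?case
  proof (cases "Suc i \<in> labeled_rows p")
    case True
    have "{j \<in> labeled_rows p. j \<le> Suc i} = insert (Suc i) {j \<in> labeled_rows p. j \<le> i}"
      using True by auto
    then have "row_label p (Suc i) = Suc (row_label p i)" by (simp add: row_label_def)
    moreover have "\<not> skip_pair p (Suc i)" "\<not> skip_pair p i"
      using True by (auto simp: labeled_rows_iff)
    ultimately show ?thesis using Suc by simp
  next
    case False
    have "{j \<in> labeled_rows p. j \<le> Suc i} = {j \<in> labeled_rows p. j \<le> i}"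
      using False by (auto simp: le_Suc_eq)
    then have "row_label p (Suc i) = row_label p i" by (simp add: row_label_def)
    moreover have "skip_pair p (Suc i) \<or> skip_pair p i"
      using False Suc.prems by (auto simp: labeled_rows_iff)
    moreover have "\<not> (skip_pair p (Suc i) \<and> skip_pair p i)"
      by (auto simp: skip_pair_iff)
    ultimately show ?thesis using Suc by auto
  qed
qed

lemma odd_row_label_iff: "i \<in> labeled_rows p \<Longrightarrow> odd (row_label p i) \<longleftrightarrow> odd i"
  using row_label_parity[of i] by (simp add: labeled_rows_iff)

lemma last_even_col_eq:
  assumes "1 \<le> k"
  shows "last_even_col p k = (if even (k + part p k) then part p k else part p k - 1)"
proof -
  define m where "m = (if even (k + part p k) then part p k else part p k - 1)"
  have "Max (insert 0 {l. (k, l) \<in> even_boxes p}) = m"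
  proof (rule Max_eqI)
    have "{l. (k, l) \<in> even_boxes p} \<subseteq> {..part p k}" by (auto simp: even_boxes_def diagram_def)
    then show "finite (insert 0 {l. (k, l) \<in> even_boxes p})" by (auto intro: finite_subset)
  next
    fix y assume "y \<in> insert 0 {l. (k, l) \<in> even_boxes p}"
    then have "y = 0 \<or> y \<le> part p k \<and> even (k + y)" by (auto simp: even_boxes_def diagram_def)
    then show "y \<le> m" unfolding m_def by (cases "y = part p k") auto
  next
    show "m \<in> insert 0 {l. (k, l) \<in> even_boxes p}"
      using assms by (cases "m = 0") (auto simp: m_def even_boxes_def diagram_def)
  qed
  then show ?thesis by (simp add: last_even_col_def m_def)
qed

text \<open>If the last box of a row is even, the added O follows it; otherwise that box was removed
  and the O takes its place.\<close>

lemma H_boxes_iff: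
  "(k, l) \<in> H_boxes p \<longleftrightarrow> 1 \<le> k \<and>
     (1 \<le> l \<and> l \<le> part p k \<and> even (k + l) \<or>
      odd k \<and> k \<le> length p \<and> \<not> skip_pair p k \<and> \<not> skip_pair p (k - 1) \<and>
      l = (if even (k + part p k) then Suc (part p k) else part p k))"
proof -
  have "last_even_col p k + 1 = (if even (k + part p k) then Suc (part p k) else part p k)"
    if "1 \<le> k" "k \<le> length p"
    using last_even_col_eq[OF that(1)] part_pos_iff[OF p, of k] that by auto
  then show ?thesis
    using odd_row_label_iff[of k]
    by (auto simp: H_boxes_def even_boxes_def diagram_def labeled_rows_iff)
qed

lemma H_boxes_subset: "H_boxes p \<subseteq> diagram (metaplectic_partition p)"
proof
  fix z assume z: "z \<in> H_boxes p"
  obtain k l where kl: "z = (k, l)" by (cases z)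
  then have k: "1 \<le> k" using z H_boxes_iff by blast
  have "1 \<le> l \<and> l \<le> metaplectic_part p k"
    using z unfolding kl H_boxes_iff
  proof (elim conjE disjE)
    assume "1 \<le> l" "l \<le> part p k" "even (k + l)"
    then show ?thesis by (cases "l = part p k") (auto simp: metaplectic_part_def)
  next
    assume o: "odd k" "k \<le> length p" "\<not> skip_pair p k" "\<not> skip_pair p (k - 1)"
      and l: "l = (if even (k + part p k) then Suc (part p k) else part p k)"
    have pos: "0 < part p k" using part_pos_iff[OF p] k o by simp
    show ?thesis
    proof (cases "even (part p k)")
      case True
      then show ?thesis using l o pos by (simp add: metaplectic_part_def)
    next
      case False
      \<comment> \<open>Equal odd parts in rows \<open>k - 1\<close> and \<open>k\<close> with
        \<open>k\<close> odd would end in O and E, so these rows would be a skipped pair.\<close>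
      have "part p (k - 1) \<noteq> part p k"
      proof
        assume e: "part p (k - 1) = part p k"
        then have "k \<noteq> 1" using pos by (auto simp: part_def)
        then have "skip_pair p (k - 1)"
          using o e False k by (auto simp: skip_pair_iff)
        then show False using o by simp
      qed
      then show ?thesis using l o False by (simp add: metaplectic_part_def)
    qed
  qed
  then show "z \<in> diagram (metaplectic_partition p)"
    using k kl by (simp add: diagram_def part_metaplectic_partition)
qed

text \<open>The end of each row of the target is covered by a box of \<open>H_boxes p\<close> in the
  same row, or by one in the next row when that row has the same length in \<open>p\<close>. The
  latter are the holes to be filled.\<close>

lemma diagram_subset_young:
  assumes Y: "is_young_diagram Y" and sub: "H_boxes p \<subseteq> Y"
  shows "diagram (metaplectic_partition p) \<subseteq> Y"
proof
  fix z assume z: "z \<in> diagram (metaplectic_partition p)"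
  obtain k l where kl: "z = (k, l)" by (cases z)
  have k: "1 \<le> k" "1 \<le> l" "l \<le> metaplectic_part p k"
    using z kl by (auto simp: diagram_def part_metaplectic_partition)
  have up: "(k, l) \<in> Y" if "(k', l') \<in> H_boxes p" "k \<le> k'" "l \<le> l'" for k' l'
    using Y sub that k unfolding is_young_diagram_def by blast
  have len: "k \<le> length p"
    using metaplectic_part_eq_0[OF p, of k] k by (cases "length p < k") auto
  have pos: "0 < part p k" using part_pos_iff[OF p] k len by simp
  have len': "Suc k \<le> length p" if "part p (Suc k) = part p k"
    using that pos part_pos_iff[OF p, of "Suc k"] by simp
  have "(k, l) \<in> Y"
  proof (cases "even (part p k)")
    case even: True
    then have l: "l \<le> part p k" using k by (simp add: metaplectic_part_def)
    show ?thesis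
    proof (cases "even k")
      case True
      then show ?thesis using even pos k l by (intro up[of k "part p k"]) (auto simp: H_boxes_iff)
    next
      case False
      show ?thesis
      proof (cases "part p (Suc k) = part p k")
        case True
        then show ?thesis
          using False even pos k l by (intro up[of "Suc k" "part p k"]) (auto simp: H_boxes_iff)
      next
        case ne: False
        then show ?thesis
          using False even pos k l len
          by (intro up[of k "part p k"]) (auto simp: H_boxes_iff skip_pair_iff)
      qed
    qed
  next
    case odd: False
    show ?thesis
    proof (cases "even k")
      case True
      show ?thesis
      proof (cases "part p (Suc k) = part p k")
        case eq: True
        then show ?thesis
          using True odd pos k 
          by (intro up[of "Suc k" "part p k"]) (auto simp: H_boxes_iff metaplectic_part_def)
      next
        case False
        then have "l \<le> part p k - 1" using True odd k by (simp add: metaplectic_part_def)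
        then show ?thesis
          using True odd pos k
          by (intro up[of k "part p k - 1"]) (auto simp: H_boxes_iff)
      qed
    next
      case False
      show ?thesis
      proof (cases "part p (k - 1) = part p k")
        case True
        then show ?thesis
          using False odd pos k
          by (intro up[of k "part p k"]) (auto simp: H_boxes_iff metaplectic_part_def)
      next
        case ne: False
        then have "l \<le> Suc (part p k)" using k False odd by (simp add: metaplectic_part_def)
        then show ?thesis
          using False odd pos k len ne
          by (intro up[of k "Suc (part p k)"]) (auto simp: H_boxes_iff skip_pair_iff)
      qed
    qed
  qed
  then show "z \<in> Y" using kl by simp
qed

lemma fill_holes_H_boxes: "fill_holes (H_boxes p) = diagram (metaplectic_partition p)"
  unfolding fill_holes_def
  using H_boxes_subset diagram_subset_young is_young_diagram_diagram[OF metaplectic_partition]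
  by blast

lemma H_metaplectic_eq: "H_metaplectic n p = metaplectic_partition p"
proof -
  have "card (diagram (metaplectic_partition p)) + 1 \<noteq> 2 * n"
    by (simp add: card_diagram[OF metaplectic_partition])
  then show ?thesis
    unfolding H_metaplectic_def H_diagram_def fill_holes_H_boxes Let_def
    by (simp add: row_lengths_diagram[OF metaplectic_partition])
qed

end

section \<open>Shifts of symbols\<close>

definition shift_array :: "array \<Rightarrow> array" where
  "shift_array A = (0 # map Suc (fst A), 0 # map Suc (snd A))"

lemma shift_array_swap: "(shift_array ^^ i) (prod.swap A) = prod.swap ((shift_array ^^ i) A)"
  by (induction i) (auto simp: shift_array_def)

lemma shift_array_Suc: "(shift_array ^^ i) (shift_array A) = (shift_array ^^ Suc i) A"
  by (simp add: funpow_swap1)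

text \<open>Exchange commutes with shifts, and a backward shift can be traded for a forward shift of
  the other array, so any chain of moves reduces to common shifts and at most one exchange.\<close>

lemma equivclp_D_move_normal_form:
  assumes "equivclp D_move A B"
  shows "\<exists>i j. (shift_array ^^ i) A = (shift_array ^^ j) B \<or>
    (shift_array ^^ i) A = prod.swap ((shift_array ^^ j) B)"
  using assms
proof (induction rule: equivclp_induct)
  case base
  show ?case by (intro exI[of _ 0]) simp
next
  case (step B C)
  have move: "C = shift_array B \<or> C = prod.swap B" if "D_move B C" for B C
    using that by cases (auto simp: shift_array_def)
  obtain i j where ij: "(shift_array ^^ i) A = (shift_array ^^ j) B \<or>
    (shift_array ^^ i) A = prod.swap ((shift_array ^^ j) B)" using step.IH by blast
  from step.hyps(2) have "C = shift_array B \<or> B = shift_array C \<or> C = prod.swap B"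
    using move by fastforce
  then show ?case
  proof (elim disjE)
    assume C: "C = shift_array B"
    have sw: "shift_array (prod.swap D) = prod.swap (shift_array D)" for D
      by (simp add: shift_array_def)
    from ij have "(shift_array ^^ Suc i) A = (shift_array ^^ Suc j) B \<or>
      (shift_array ^^ Suc i) A = prod.swap ((shift_array ^^ Suc j) B)"
      by (auto simp only: funpow.simps comp_apply sw)
    then have "(shift_array ^^ Suc i) A = (shift_array ^^ j) C \<or>
      (shift_array ^^ Suc i) A = prod.swap ((shift_array ^^ j) C)"
      unfolding C shift_array_Suc .
    then show ?thesis by blast
  next
    assume "B = shift_array C"
    then have "(shift_array ^^ i) A = (shift_array ^^ Suc j) C \<or>
      (shift_array ^^ i) A = prod.swap ((shift_array ^^ Suc j) C)"
      using ij by (simp only: shift_array_Suc)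
    then show ?thesis by blast
  next
    assume "C = prod.swap B"
    then have "(shift_array ^^ j) C = prod.swap ((shift_array ^^ j) B)"
      by (simp add: shift_array_swap)
    then have "(shift_array ^^ i) A = (shift_array ^^ j) C \<or>
      (shift_array ^^ i) A = prod.swap ((shift_array ^^ j) C)" using ij by auto
    then show ?thesis by blast
  qed
qed

lemma equivclp_shift_array: "equivclp D_move A (shift_array A)"
  by (cases A) (auto simp: shift_array_def intro: r_into_equivclp D_move.shift)

lemma is_D_array_shift: "is_D_array A \<Longrightarrow> is_D_array (shift_array A)"
  by (auto simp: is_D_array_def shift_array_def sorted_wrt_map)

lemma entries_swap: "entries (prod.swap A) = entries A"
  by (simp add: entries_def add.commute)

lemma entries_shift: "entries (shift_array A) = {#0, 0#} + image_mset Suc (entries A)"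
  by (simp add: entries_def shift_array_def)

lemma entries_funpow_shift:
  "entries A = entries B \<Longrightarrow> entries ((shift_array ^^ i) A) = entries ((shift_array ^^ i) B)"
  by (induction i) (simp_all add: entries_shift)

lemma interlaced_shift:
  assumes "is_D_array A" and "interlaced A"
  shows "interlaced (shift_array A)"
  using assms by (auto simp: interlaced_def shift_array_def is_D_array_def nth_Cons split: nat.split)

lemma interlaced_funpow_shift:
  "is_D_array A \<Longrightarrow> interlaced A \<Longrightarrow>
     is_D_array ((shift_array ^^ i) A) \<and> interlaced ((shift_array ^^ i) A)"
  by (induction i) (simp_all add: interlaced_shift is_D_array_shift)

subsection \<open>Beta numbers\<close>

text \<open>The beta numbers of \<open>d\<close> padded to \<open>K\<close> rows, meant for
  \<open>l \<le> K\<close>; for \<open>K = length d\<close> they are the hook lengths in the first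
  column.\<close>

definition beta :: "nat list \<Rightarrow> nat \<Rightarrow> nat \<Rightarrow> nat" where
  "beta d K l = part d l + K - l"

definition beta_rows :: "nat list \<Rightarrow> nat \<Rightarrow> array \<Rightarrow> bool" where
  "beta_rows d K A \<longleftrightarrow> length d \<le> K \<and> even K \<and> is_D_array A \<and>
     image_mset (\<lambda>x. 2 * x + 1) (mset (fst A)) + image_mset (\<lambda>x. 2 * x) (mset (snd A)) =
       mset (map (beta d K) [1..<Suc K])"

lemma beta_Suc_Suc: "l \<le> K \<Longrightarrow> beta d (Suc (Suc K)) l = beta d K l + 2"
  by (simp add: beta_def)

lemma beta_beyond: "length d < l \<Longrightarrow> beta d K l = K - l"
  by (simp add: beta_def part_eq_0)

lemma beta_rows_shift:
  assumes "beta_rows d K A"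
  shows "beta_rows d (Suc (Suc K)) (shift_array A)"
proof -
  have shifted: "map (beta d (Suc (Suc K))) [1..<Suc K] = map (\<lambda>x. x + 2) (map (beta d K) [1..<Suc K])"
    by (auto simp: beta_Suc_Suc simp del: upt_Suc)
  have split: "[1..<Suc (Suc (Suc K))] = [1..<Suc K] @ [Suc K, Suc (Suc K)]" by simp
  have "map (beta d (Suc (Suc K))) [Suc K, Suc (Suc K)] = [1, 0]"
    using assms by (simp add: beta_beyond beta_rows_def)
  then have "mset (map (beta d (Suc (Suc K))) [1..<Suc (Suc (Suc K))]) =
      image_mset (\<lambda>x. x + 2) (mset (map (beta d K) [1..<Suc K])) + {#1, 0#}"
    unfolding split map_append shifted mset_append mset_map by simp
  also have "\<dots> = image_mset (\<lambda>x. 2 * x + 1) (mset (fst (shift_array A))) +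
      image_mset (\<lambda>x. 2 * x) (mset (snd (shift_array A)))"
  proof -
    have "mset (map (beta d K) [1..<Suc K]) =
        image_mset (\<lambda>x. 2 * x + 1) (mset (fst A)) + image_mset (\<lambda>x. 2 * x) (mset (snd A))"
      using assms unfolding beta_rows_def by (elim conjE) (rule sym)
    then show ?thesis
      by (simp only:) (simp add: shift_array_def multiset.map_comp comp_def)
  qed
  finally have "mset (map (beta d (Suc (Suc K))) [1..<Suc (Suc (Suc K))]) =
    image_mset (\<lambda>x. 2 * x + 1) (mset (fst (shift_array A))) +
      image_mset (\<lambda>x. 2 * x) (mset (snd (shift_array A)))" .
  note this[symmetric]
  moreover have "length d \<le> Suc (Suc K)" "even (Suc (Suc K))" "is_D_array (shift_array A)"
    using assms is_D_array_shift by (auto simp: beta_rows_def)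
  ultimately show ?thesis unfolding beta_rows_def by (intro conjI)
qed

lemma beta_rows_funpow_shift:
  "beta_rows d K A \<Longrightarrow> beta_rows d (K + 2 * i) ((shift_array ^^ i) A)"
  by (induction i) (auto dest: beta_rows_shift)

text \<open>The parity of a beta number only records in which row of the array its half
  stands.\<close>

lemma entries_beta_rows:
  assumes "beta_rows d K A"
  shows "entries A = mset (map (\<lambda>l. beta d K l div 2) [1..<Suc K])"
proof -
  have "entries A = image_mset (\<lambda>x. x div 2) (image_mset (\<lambda>x. 2 * x + 1) (mset (fst A)) +
      image_mset (\<lambda>x. 2 * x) (mset (snd A)))"
    by (simp add: entries_def multiset.map_comp comp_def)
  also have "\<dots> = image_mset (\<lambda>x. x div 2) (mset (map (beta d K) [1..<Suc K]))"
    using assms unfolding beta_rows_def by metis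
  also have "\<dots> = mset (map (\<lambda>l. beta d K l div 2) [1..<Suc K])"
    by (simp add: multiset.map_comp comp_def del: upt_Suc)
  finally show ?thesis .
qed

lemma beta_less:
  assumes "is_partition N d" and "1 \<le> i" and "i < j" and "j \<le> K"
  shows "beta d K j < beta d K i"
  using part_antimono[OF assms(1,2), of j] assms(3,4) by (simp add: beta_def)

lemma sorted_beta_div:
  assumes "is_partition N d"
  shows "sorted (rev (map (\<lambda>l. beta d K l div 2) [1..<Suc K]))"
  unfolding sorted_wrt_rev sorted_wrt_map
  by (rule sorted_wrt_mono_rel[OF _ sorted_wrt_upt])
    (auto intro!: div_le_mono less_imp_le[OF beta_less[OF assms]])

text \<open>Halved beta numbers decrease weakly, so their multiset determines them position by
  position.\<close>

lemma mset_beta_div_eqD: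
  assumes "is_partition N d" and "is_partition M d'"
    and "mset (map (\<lambda>l. beta d K l div 2) [1..<Suc K]) = mset (map (\<lambda>l. beta d' K' l div 2) [1..<Suc K'])"
  shows "K = K'" and "1 \<le> l \<Longrightarrow> l \<le> K \<Longrightarrow> beta d K l div 2 = beta d' K l div 2"
proof -
  show K: "K = K'" using arg_cong[OF assms(3), of size] by (simp del: upt_Suc)
  have "rev (map (\<lambda>l. beta d K l div 2) [1..<Suc K]) = rev (map (\<lambda>l. beta d' K l div 2) [1..<Suc K])"
    using assms(3) K sorted_beta_div[OF assms(1)] sorted_beta_div[OF assms(2)]
    by (metis mset_rev properties_for_sort)
  then show "beta d K l div 2 = beta d' K l div 2" if "1 \<le> l" "l \<le> K"
    using that by (simp del: upt_Suc)
qed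

text \<open>Passing from \<open>2 * m + 1\<close> to \<open>2 * m + 2\<close> beta numbers raises
  each by one and appends a 0. Even numbers \<open>2 * x\<close> become \<open>2 * x + 1\<close>,
  odd ones become \<open>2 * (x + 1)\<close>, and the new 0 heads the lower row. The symbol of
  \<open>p\<close> thus follows the same convention as symbols of type \<open>D\<close>.\<close>

lemma beta_rows_domino:
  assumes "length p \<le> 2 * m + 1" and "length ls = m + 1" and "length us = m"
    and "sorted_wrt (<) ls" and "sorted_wrt (<) us"
    and "image_mset (\<lambda>x. 2 * x) (mset ls) + image_mset (\<lambda>x. 2 * x + 1) (mset us)
       = mset (map (\<lambda>k. part p k + 2 * m + 1 - k) [1..<2 * m + 2])"
  shows "beta_rows p (2 * m + 2) (ls, 0 # map Suc us)"
proof -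
  have shifted: "map (beta p (2 * m + 2)) [1..<2 * m + 2] =
      map Suc (map (\<lambda>k. part p k + 2 * m + 1 - k) [1..<2 * m + 2])"
    by (auto simp: beta_def)
  have split: "[1..<Suc (2 * m + 2)] = [1..<2 * m + 2] @ [2 * m + 2]" by simp
  have "map (beta p (2 * m + 2)) [2 * m + 2] = [0]"
    using assms(1) by (simp add: beta_beyond)
  then have "mset (map (beta p (2 * m + 2)) [1..<Suc (2 * m + 2)]) =
     image_mset Suc (mset (map (\<lambda>k. part p k + 2 * m + 1 - k) [1..<2 * m + 2])) + {#0#}"
    unfolding split map_append shifted mset_append mset_map by simp
  also have "\<dots> = image_mset (\<lambda>x. 2 * x + 1) (mset ls) + image_mset (\<lambda>x. 2 * x) (mset (0 # map Suc us))"
    unfolding assms(6)[symmetric] by (simp add: multiset.map_comp comp_def)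
  finally have "mset (map (beta p (2 * m + 2)) [1..<Suc (2 * m + 2)]) =
      image_mset (\<lambda>x. 2 * x + 1) (mset ls) + image_mset (\<lambda>x. 2 * x) (mset (0 # map Suc us))" .
  note this[symmetric]
  moreover have "length p \<le> 2 * m + 2" "even (2 * m + 2)" "is_D_array (ls, 0 # map Suc us)"
    using assms(1-5) by (auto simp: is_D_array_def sorted_wrt_map)
  ultimately show ?thesis unfolding beta_rows_def fst_conv snd_conv by (intro conjI)
qed

lemma D_symbol_of_dominoE:
  assumes "D_symbol_of_domino p S"
  obtains K A where "beta_rows p K A" and "S = D_symbol A"
proof -
  obtain m ls us where *: "length p \<le> 2 * m + 1" "length ls = m + 1" "length us = m"
    "sorted_wrt (<) ls" "sorted_wrt (<) us"
    "image_mset (\<lambda>x. 2 * x) (mset ls) + image_mset (\<lambda>x. 2 * x + 1) (mset us)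
       = mset (map (\<lambda>k. part p k + 2 * m + 1 - k) [1..<2 * m + 2])"
    and S: "S = D_symbol (ls, 0 # map Suc us)"
    using assms unfolding D_symbol_of_domino_def by (elim exE conjE) (rule that)
  from that[OF beta_rows_domino[OF *] S] show thesis .
qed

lemma D_symbol_of_type_D_E:
  assumes "D_symbol_of_type_D d T"
  obtains A where "beta_rows d (length d) A" and "T = D_symbol A"
proof -
  obtain ls us where *: "even (length d)" "is_D_array (ls, us)" "T = D_symbol (ls, us)"
    "image_mset (\<lambda>x. 2 * x + 1) (mset ls) + image_mset (\<lambda>x. 2 * x) (mset us)
       = mset (map (\<lambda>l. part d l + length d - l) [1..<Suc (length d)])"
    using assms by (auto simp: D_symbol_of_type_D_def)
  then have "beta_rows d (length d) (ls, us)"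
    by (simp add: beta_rows_def beta_def[abs_def] del: upt_Suc)
  with * that show thesis by blast
qed

lemma D_symbol_same_entriesE:
  assumes S: "beta_rows p K A" and T: "beta_rows d M B"
    and "same_entries (D_symbol A) (D_symbol B)"
    and p: "is_partition N p" and d: "is_partition N' d"
  obtains L where "length p \<le> L" and "length d \<le> L" and "even L"
    and "\<And>l. 1 \<le> l \<Longrightarrow> l \<le> L \<Longrightarrow> beta p L l div 2 = beta d L l div 2"
proof -
  obtain A' B' where *: "equivclp D_move A A'" "equivclp D_move B B'" "entries A' = entries B'"
    using assms(3) by (auto simp: same_entries_def D_symbol_def)
  obtain i j where "(shift_array ^^ i) A = (shift_array ^^ j) A' \<or>
      (shift_array ^^ i) A = prod.swap ((shift_array ^^ j) A')"
    using equivclp_D_move_normal_form[OF *(1)] by blast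
  then have ij: "entries ((shift_array ^^ i) A) = entries ((shift_array ^^ j) A')"
    using entries_swap by metis
  obtain k m where "(shift_array ^^ k) B = (shift_array ^^ m) B' \<or>
      (shift_array ^^ k) B = prod.swap ((shift_array ^^ m) B')"
    using equivclp_D_move_normal_form[OF *(2)] by blast
  then have km: "entries ((shift_array ^^ k) B) = entries ((shift_array ^^ m) B')"
    using entries_swap by metis
  \<comment> \<open>The crossed shift amounts bring the representatives \<open>A'\<close> and
    \<open>B'\<close>, which share their entries, to the same shift \<open>m + j\<close>.\<close>
  have "entries ((shift_array ^^ (m + i)) A) = entries ((shift_array ^^ (m + j)) A')"
    using entries_funpow_shift[OF ij, of m] by (simp add: funpow_add)
  also have "\<dots> = entries ((shift_array ^^ (j + m)) B')"
    using entries_funpow_shift[OF *(3), of "m + j"] by (simp add: add.commute)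
  also have "\<dots> = entries ((shift_array ^^ (j + k)) B)"
    using entries_funpow_shift[OF km, of j] by (simp add: funpow_add)
  finally have eq: "entries ((shift_array ^^ (m + i)) A) = entries ((shift_array ^^ (j + k)) B)" .
  have b: "beta_rows p (K + 2 * (m + i)) ((shift_array ^^ (m + i)) A)"
    "beta_rows d (M + 2 * (j + k)) ((shift_array ^^ (j + k)) B)"
    using beta_rows_funpow_shift S T by blast+
  note e = mset_beta_div_eqD[OF p d eq[unfolded entries_beta_rows[OF b(1)] entries_beta_rows[OF b(2)]]]
  show thesis
  proof (rule that[of "K + 2 * (m + i)"])
    show "length d \<le> K + 2 * (m + i)" using b(2) e(1) by (simp add: beta_rows_def)
  qed (use b(1) e(2) in \<open>auto simp: beta_rows_def\<close>)
qed

lemma beta_div_eq_extend: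
  assumes "length p \<le> L" and "length d \<le> L" and "even L"
    and "\<And>l. 1 \<le> l \<Longrightarrow> l \<le> L \<Longrightarrow> beta p L l div 2 = beta d L l div 2"
    and "1 \<le> l" and "l \<le> L + 2 * i"
  shows "beta p (L + 2 * i) l div 2 = beta d (L + 2 * i) l div 2"
proof (cases "l \<le> L")
  case True
  then have "beta f (L + 2 * i) l = beta f L l + 2 * i" for f by (simp add: beta_def)
  then show ?thesis using assms(4)[OF assms(5) True] by simp
next
  case False
  then show ?thesis using assms(1,2) by (simp add: beta_beyond)
qed

text \<open>Interlacing says that reading the rows alternately gives a sorted list, so this list is
  the sorted list of entries. It ends in the lower row, so the halved beta numbers belong
  alternately to the lower and the upper row, from the largest down.\<close>

lemma interlaced_rows:
  assumes C: "is_D_array C" "interlaced C" and d: "is_partition N d" and K: "even K"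
    and e: "entries C = mset (map (\<lambda>l. beta d K l div 2) [1..<Suc K])"
    and i: "2 * i + 2 \<le> K"
  shows "beta d K (2 * i + 2) div 2 \<in> set (fst C)" and "beta d K (2 * i + 1) div 2 \<in> set (snd C)"
proof -
  define m where "m = length (fst C)"
  have len: "length (snd C) = m" using C(1) by (simp add: m_def is_D_array_def)
  define g where "g k = (if even k then fst C ! (k div 2) else snd C ! (k div 2))" for k
  have "size (entries C) = K" using e by (simp del: upt_Suc)
  then have Km: "K = 2 * m" using len by (simp add: entries_def m_def)
  have step: "g k \<le> g (Suc k)" if "Suc k < 2 * m" for k
  proof (cases "even k")
    case True
    then have "Suc k div 2 = k div 2" "k div 2 < m" using that by auto
    then show ?thesis using C(2) True unfolding interlaced_def g_def m_def by simp
  next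
    case False
    then have "Suc k div 2 = Suc (k div 2)" "Suc (k div 2) < m" using that by (auto elim!: oddE)
    then show ?thesis using C(2) False unfolding interlaced_def g_def m_def by simp
  qed
  have "sorted (map g [0..<2 * m])"
    unfolding sorted_iff_nth_Suc using step by simp
  moreover have "mset (map g [0..<2 * m]) = entries C"
  proof -
    have "mset (map g [0..<2 * k]) = mset (take k (fst C)) + mset (take k (snd C))" if "k \<le> m" for k
      using that
    proof (induction k)
      case (Suc k)
      have "g (2 * k) = fst C ! k" "g (Suc (2 * k)) = snd C ! k" by (simp_all add: g_def)
      then show ?case
        using Suc len by (simp add: take_Suc_conv_app_nth m_def)
    qed simp
    from this[of m] show ?thesis using len by (simp add: entries_def m_def)
  qed
  ultimately have "map g [0..<2 * m] = rev (map (\<lambda>l. beta d K l div 2) [1..<Suc K])"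
    using sorted_beta_div[OF d, of K] e by (metis mset_rev properties_for_sort)
  then have eq: "map g [0..<2 * m] ! k = rev (map (\<lambda>l. beta d K l div 2) [1..<Suc K]) ! k" for k
    by (rule arg_cong)
  have g: "g k = beta d K (K - k) div 2" if "k < K" for k
    using eq[of k] that Km by (simp add: rev_nth Suc_diff_Suc del: upt_Suc)
  have "g (K - (2 * i + 2)) = beta d K (2 * i + 2) div 2" "g (K - (2 * i + 1)) = beta d K (2 * i + 1) div 2"
    using g[of "K - (2 * i + 2)"] g[of "K - (2 * i + 1)"] i by auto
  moreover have "even (K - (2 * i + 2))" "odd (K - (2 * i + 1))" using K i by auto
  moreover have "(K - (2 * i + 2)) div 2 < m" "(K - (2 * i + 1)) div 2 < m" using Km i by auto
  ultimately show "beta d K (2 * i + 2) div 2 \<in> set (fst C)" "beta d K (2 * i + 1) div 2 \<in> set (snd C)"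
    using len unfolding g_def m_def by (metis nth_mem)+
qed

section \<open>The attached special partition\<close>

text \<open>The hypotheses say that \<open>e2\<close> stands in the upper row and \<open>e1\<close>
  in the lower one. If they differ, strict decrease leaves only the indices \<open>2 * i + 2\<close>
  and \<open>2 * i + 1\<close> for these two beta numbers; if they agree, the two numbers are
  consecutive with the same half.\<close>

lemma beta_pair_special:
  assumes d: "is_partition N d" and i: "2 * i + 2 \<le> K"
    and 1: "1 \<le> l" "l \<le> K" "beta d K l = 2 * (beta d K (2 * i + 2) div 2) + 1"
    and 2: "1 \<le> l'" "l' \<le> K" "beta d K l' = 2 * (beta d K (2 * i + 1) div 2)"
    and e1: "e1 = beta d K (2 * i + 1) div 2" and e2: "e2 = beta d K (2 * i + 2) div 2"
  shows "beta d K (2 * i + 1) = (if e1 = e2 then 2 * e1 + 1 else 2 * e1) \<and>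
    beta d K (2 * i + 2) = (if e1 = e2 then 2 * e2 else 2 * e2 + 1)"
proof -
  let ?x = "beta d K"
  note less = beta_less[OF d]
  have x12: "?x (2 * i + 2) < ?x (2 * i + 1)" using less[of "2 * i + 1" "2 * i + 2" K] i by simp
  have e: "?x (2 * i + 1) = 2 * e1 \<or> ?x (2 * i + 1) = 2 * e1 + 1"
    "?x (2 * i + 2) = 2 * e2 \<or> ?x (2 * i + 2) = 2 * e2 + 1"
    unfolding e1 e2 by presburger+
  show ?thesis
  proof (cases "e1 = e2")
    case True
    then show ?thesis using e x12 by auto
  next
    case False
    then have lt: "e2 < e1" using e x12 by auto
    have "l = 2 * i + 2"
    proof (rule ccontr)
      assume "l \<noteq> 2 * i + 2"
      moreover have "\<not> 2 * i + 2 < l" using less[of "2 * i + 2" l K] 1 e e2 by auto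
      ultimately have "l \<le> 2 * i + 1" by simp
      then have "?x (2 * i + 1) \<le> ?x l"
        using less[of l "2 * i + 1" K] 1 i by (cases "l = 2 * i + 1") auto
      then show False using 1(3) e lt unfolding e2[symmetric] by auto
    qed
    moreover have "l' = 2 * i + 1"
    proof (rule ccontr)
      assume "l' \<noteq> 2 * i + 1"
      moreover have "\<not> l' < 2 * i + 1" using less[of l' "2 * i + 1" K] 2 e e1 i by auto
      ultimately have "2 * i + 2 \<le> l'" by simp
      then have "?x l' \<le> ?x (2 * i + 2)"
        using less[of "2 * i + 2" l' K] 2 i by (cases "l' = 2 * i + 2") auto
      then show False using 2(3) e lt unfolding e1[symmetric] by auto
    qed
    ultimately show ?thesis using False 1(3) 2(3) e1 e2 by simp
  qed
qed

text \<open>With the rows of the symbol exchanged, the first pair of unequal entries would give an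
  even part of odd multiplicity.\<close>

lemma beta_pair_exchanged:
  assumes d: "is_type_D n d" and K: "even K" "length d \<le> K"
    and 1: "\<And>i. 2 * i + 2 \<le> K \<Longrightarrow> \<exists>l. 1 \<le> l \<and> l \<le> K \<and> beta d K l = 2 * (beta d K (2 * i + 1) div 2) + 1"
    and i: "2 * i + 2 \<le> K"
  shows "beta d K (2 * i + 1) div 2 = beta d K (2 * i + 2) div 2"
  using i
proof (induction i rule: less_induct)
  case (less i)
  let ?x = "beta d K"
  have p: "is_partition (2 * n) d" using d by (simp add: is_type_D_def)
  note lt = beta_less[OF p]
  have tied: "?x (2 * j + 1) = Suc (?x (2 * j + 2)) \<and> even (?x (2 * j + 2))" if "j < i" for j
  proof -
    have "?x (2 * j + 1) div 2 = ?x (2 * j + 2) div 2" using less that by simp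
    moreover have "?x (2 * j + 2) < ?x (2 * j + 1)"
      using lt[of "2 * j + 1" "2 * j + 2" K] that less.prems by simp
    ultimately show ?thesis by presburger
  qed
  define e1 e2 where "e1 = ?x (2 * i + 1) div 2" and "e2 = ?x (2 * i + 2) div 2"
  have x12: "?x (2 * i + 2) < ?x (2 * i + 1)" using lt[of "2 * i + 1" "2 * i + 2" K] less.prems by simp
  have e: "?x (2 * i + 1) = 2 * e1 \<or> ?x (2 * i + 1) = 2 * e1 + 1"
    "?x (2 * i + 2) = 2 * e2 \<or> ?x (2 * i + 2) = 2 * e2 + 1"
    unfolding e1_def e2_def by presburger+
  show ?case
  proof (rule ccontr)
    assume "?x (2 * i + 1) div 2 \<noteq> ?x (2 * i + 2) div 2"
    then have "e2 < e1" using e x12 unfolding e1_def e2_def by auto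
    \<comment> \<open>Otherwise \<open>2 * e1 + 1\<close>, which is a beta number by assumption,
      would have to be the one just before; but that one is even, as its pair is tied by
      induction.\<close>
    have x1: "?x (2 * i + 1) = 2 * e1 + 1"
    proof (rule ccontr)
      assume "?x (2 * i + 1) \<noteq> 2 * e1 + 1"
      then have x1: "?x (2 * i + 1) = 2 * e1" using e by blast
      obtain l where l: "1 \<le> l" "l \<le> K" "?x l = 2 * e1 + 1"
        using 1[OF less.prems] unfolding e1_def by blast
      have "l < 2 * i + 1"
        using lt[of "2 * i + 1" l K] l x1 by (cases "l = 2 * i + 1"; cases "2 * i + 1 < l") auto
      then obtain j where j: "i = Suc j" using l(1) by (cases i) auto
      then have "?x (2 * j + 2) \<le> ?x l"
        using lt[of l "2 * j + 2" K] l \<open>l < 2 * i + 1\<close> less.prems by (cases "l = 2 * j + 2") auto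
      moreover have "?x (2 * i + 1) < ?x (2 * j + 2)"
        using lt[of "2 * j + 2" "2 * i + 1" K] j less.prems by simp
      ultimately have "?x (2 * j + 2) = 2 * e1 + 1" using x1 l(3) by simp
      then show False using tied[of j] j by simp
    qed
    define v where "v = part d (2 * i + 1)"
    have v: "v + (K - (2 * i + 1)) = 2 * e1 + 1"
      using x1 less.prems by (simp add: beta_def v_def)
    have "even v"
    proof -
      have "odd (K - (2 * i + 1))" using K less.prems by simp
      then show ?thesis using v by (metis even_add odd_two_times_div_two_succ even_plus_one_iff dvd_triv_left)
    qed
    have next_lt: "part d (2 * i + 2) < v"
      using x1 e(2) \<open>e2 < e1\<close> less.prems by (auto simp: beta_def v_def)
    then have v1: "1 \<le> v" by simp
    let ?S = "{k. 1 \<le> k \<and> k \<le> 2 * i \<and> part d k = v}"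
    have "{k. 1 \<le> k \<and> part d k = v} = insert (2 * i + 1) ?S"
    proof -
      have "k \<le> 2 * i + 1" if "1 \<le> k" "part d k = v" for k
      proof (rule ccontr)
        assume "\<not> k \<le> 2 * i + 1"
        then have "part d k \<le> part d (2 * i + 2)" using part_antimono[OF p, of "2 * i + 2" k] by simp
        then show False using that next_lt by simp
      qed
      then show ?thesis by (auto simp: v_def le_Suc_eq)
    qed
    moreover have "finite ?S" by simp
    ultimately have "card {k. 1 \<le> k \<and> part d k = v} = Suc (card ?S)" by simp
    moreover have "even (card ?S)"
    proof (rule even_card_pairs[where r = 1])
      fix j
      have "part d (2 * j + 1) = part d (2 * j + 2)" if "j < i"
        using tied[OF that, THEN conjunct1] that less.prems unfolding beta_def by arith
      then show "2 * j + 1 \<in> ?S \<longleftrightarrow> Suc (2 * j + 1) \<in> ?S" by (cases "j < i") auto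
    qed auto
    ultimately show False using d \<open>even v\<close> v1 unfolding is_type_D_iff by auto
  qed
qed

lemma beta_pair_tied:
  assumes d: "is_partition N d" and i: "2 * i + 2 \<le> K"
    and eq: "beta d K (2 * i + 1) div 2 = beta d K (2 * i + 2) div 2"
  shows "beta d K (2 * i + 1) = 2 * (beta d K (2 * i + 1) div 2) + 1 \<and>
    beta d K (2 * i + 2) = 2 * (beta d K (2 * i + 2) div 2)"
proof -
  have "beta d K (2 * i + 2) < beta d K (2 * i + 1)"
    using beta_less[OF d, of "2 * i + 1" "2 * i + 2" K] i by simp
  then show ?thesis using eq by presburger
qed

lemma pair_index:
  fixes k K :: nat
  assumes "1 \<le> k" and "k \<le> K" and "even K"
  obtains i where "2 * i + 2 \<le> K" and "k = 2 * i + 1 \<or> k = 2 * i + 2"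
proof -
  define i where "i = (k - 1) div 2"
  have "k = 2 * i + 1 \<or> k = 2 * i + 2" using assms(1) unfolding i_def by presburger
  moreover from this have "2 * i + 2 \<le> K" using assms(2,3) by presburger
  ultimately show thesis using that by blast
qed

lemma mset_upt_pairs:
  "mset (map f [1..<Suc (2 * m)]) =
    mset (map (\<lambda>i. f (2 * i + 1)) [0..<m]) + mset (map (\<lambda>i. f (2 * i + 2)) [0..<m])"
  by (induction m) simp_all

context
  fixes n :: nat and p :: "nat list"
  assumes p: "is_partition (2 * n) p" and bal: "imbalance (\<lambda>i. part p (Suc i)) = 0"
begin

lemma beta_special_partition:
  assumes K: "even K" and i: "2 * i + 2 \<le> K"
    and e1: "e1 = beta p K (2 * i + 1) div 2" and e2: "e2 = beta p K (2 * i + 2) div 2"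
  shows "beta (special_partition p) K (2 * i + 1) = (if e1 = e2 then 2 * e1 + 1 else 2 * e1)"
    and "beta (special_partition p) K (2 * i + 2) = (if e1 = e2 then 2 * e2 else 2 * e2 + 1)"
proof -
  obtain t where t: "K = 2 * i + 2 + 2 * t"
  proof -
    have "even (K - (2 * i + 2))" using K by simp
    then obtain t where "K - (2 * i + 2) = 2 * t" by (elim evenE)
    then show thesis using that[of t] i by simp
  qed
  define a b where "a = part p (2 * i + 1)" and "b = part p (2 * i + 2)"
  have ba: "b \<le> a" using part_antimono[OF p, of "2 * i + 1" "2 * i + 2"] by (simp add: a_def b_def)
  \<comment> \<open>Here \<open>t\<close> is half the number of rows below the pair:
    \<open>e1\<close> rounds half of \<open>a\<close> up and \<open>e2\<close> rounds half of
    \<open>b\<close> down, so they agree only if \<open>a = b\<close> is even.\<close>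
  have E: "e1 = t + (a + 1) div 2" "e2 = t + b div 2"
    unfolding e1 e2 beta_def t a_def b_def by simp_all
  have sp: "special_part p (2 * i + 1) = (if odd a then a else a - of_bool (b \<noteq> a))"
    "special_part p (2 * i + 2) = (if odd b then b else b + of_bool (a \<noteq> b))"
    by (simp_all add: special_part_def a_def b_def)
  have B: "beta (special_partition p) K (2 * i + 1) = special_part p (2 * i + 1) + (2 * t + 1)"
    "beta (special_partition p) K (2 * i + 2) = special_part p (2 * i + 2) + 2 * t"
    by (simp_all add: beta_def t part_special_partition[OF p bal])
  have eq: "e1 = e2 \<longleftrightarrow> a = b \<and> even a"
    unfolding E using ba by presburger
  show "beta (special_partition p) K (2 * i + 1) = (if e1 = e2 then 2 * e1 + 1 else 2 * e1)"
  proof (cases "a = b \<and> even a")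
    case True
    then show ?thesis using eq B sp E by auto
  next
    case False
    then have "special_part p (2 * i + 1) + 1 = 2 * ((a + 1) div 2)"
      unfolding sp using ba by (cases "even a") (auto elim!: oddE evenE)
    then show ?thesis using False eq B E by auto
  qed
  show "beta (special_partition p) K (2 * i + 2) = (if e1 = e2 then 2 * e2 else 2 * e2 + 1)"
  proof (cases "a = b \<and> even a")
    case True
    then show ?thesis using eq B sp E by auto
  next
    case False
    then have "special_part p (2 * i + 2) = 2 * (b div 2) + 1"
      unfolding sp by (cases "even b") (auto elim!: oddE evenE)
    then show ?thesis using False eq B E by auto
  qed
qed

lemma beta_special_partition_div:
  assumes "even K" and "1 \<le> k" and "k \<le> K"
  shows "beta (special_partition p) K k div 2 = beta p K k div 2"
proof -
  obtain i where "2 * i + 2 \<le> K" "k = 2 * i + 1 \<or> k = 2 * i + 2"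
    using pair_index assms by metis
  then show ?thesis
    using beta_special_partition[OF assms(1) _ refl refl, of i] by auto
qed

lemma special_symbol_unique:
  assumes d: "is_type_D n d" and S: "D_symbol_of_domino p S" and T: "D_symbol_of_type_D d T"
    and sp: "special_D_symbol T" and same: "same_entries S T"
  shows "d = special_partition p"
proof -
  have pd: "is_partition (2 * n) d" using d by (simp add: is_type_D_def)
  obtain K A where A: "beta_rows p K A" "S = D_symbol A" using D_symbol_of_dominoE[OF S] .
  obtain B where B: "beta_rows d (length d) B" "T = D_symbol B" using D_symbol_of_type_D_E[OF T] .
  obtain L where L: "length p \<le> L" "length d \<le> L" "even L"
    "\<And>l. 1 \<le> l \<Longrightarrow> l \<le> L \<Longrightarrow> beta p L l div 2 = beta d L l div 2"
    using D_symbol_same_entriesE[OF A(1) B(1) same[unfolded A(2) B(2)] p pd] by metis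
  obtain C where C: "is_D_array C" "interlaced C" "equivclp D_move B C"
    using sp B(2) by (auto simp: special_D_symbol_def D_symbol_def)
  obtain i j where ij: "(shift_array ^^ i) B = (shift_array ^^ j) C \<or>
      (shift_array ^^ i) B = prod.swap ((shift_array ^^ j) C)"
    using equivclp_D_move_normal_form[OF C(3)] by blast
  \<comment> \<open>The additional \<open>L\<close> shifts on both sides keep the relation between
    the arrays and make \<open>M\<close> at least \<open>L\<close>, so that \<open>p\<close> and
    \<open>d\<close> can be compared in \<open>M\<close> rows.\<close>
  define B' C' M where "B' = (shift_array ^^ (L + i)) B" and "C' = (shift_array ^^ (L + j)) C"
    and "M = length d + 2 * (L + i)"
  have BC: "B' = C' \<or> B' = prod.swap C'"
    using ij by (auto simp: B'_def C'_def funpow_add shift_array_swap)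
  have C': "is_D_array C'" "interlaced C'"
    using interlaced_funpow_shift[OF C(1,2)] by (auto simp: C'_def)
  have B': "beta_rows d M B'" unfolding B'_def M_def by (rule beta_rows_funpow_shift[OF B(1)])
  have M: "even M" "length d \<le> M" "L \<le> M" using B(1) by (auto simp: M_def beta_rows_def)
  obtain t where t: "M = L + 2 * t"
  proof -
    have "even (M - L)" using M L(3) by simp
    then obtain t where "M - L = 2 * t" by (elim evenE)
    then show thesis using that[of t] M by simp
  qed
  have E: "beta p M l div 2 = beta d M l div 2" if "1 \<le> l" "l \<le> M" for l
    using beta_div_eq_extend[OF L] that t by simp
  have entr: "entries C' = mset (map (\<lambda>l. beta d M l div 2) [1..<Suc M])"
    using BC entries_beta_rows[OF B'] entries_swap by metis
  note rows = interlaced_rows[OF C' pd M(1) entr]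
  have beta_set: "x \<in> set (map (beta d M) [1..<Suc M]) \<Longrightarrow> \<exists>l. 1 \<le> l \<and> l \<le> M \<and> beta d M l = x" for x
    by (auto simp del: upt_Suc)
  have in_beta: "2 * x + 1 \<in> set (map (beta d M) [1..<Suc M])" if "x \<in> set (fst B')" for x
  proof -
    have "2 * x + 1 \<in># image_mset (\<lambda>x. 2 * x + 1) (mset (fst B')) + image_mset (\<lambda>x. 2 * x) (mset (snd B'))"
      using that by auto
    then show ?thesis using B' unfolding beta_rows_def by (metis set_mset_mset)
  qed
  have in_beta': "2 * x \<in> set (map (beta d M) [1..<Suc M])" if "x \<in> set (snd B')" for x
  proof -
    have "2 * x \<in># image_mset (\<lambda>x. 2 * x + 1) (mset (fst B')) + image_mset (\<lambda>x. 2 * x) (mset (snd B'))"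
      using that by auto
    then show ?thesis using B' unfolding beta_rows_def by (metis set_mset_mset)
  qed
  have pair: "beta d M (2 * i + 1) = beta (special_partition p) M (2 * i + 1) \<and>
      beta d M (2 * i + 2) = beta (special_partition p) M (2 * i + 2)" if i: "2 * i + 2 \<le> M" for i
  proof -
    note b = beta_special_partition[OF M(1) i refl refl]
    have e: "beta p M (2 * i + 1) div 2 = beta d M (2 * i + 1) div 2"
      "beta p M (2 * i + 2) div 2 = beta d M (2 * i + 2) div 2" using E i by auto
    from BC show ?thesis
    proof
      assume "B' = C'"
      then obtain l l' where "1 \<le> l" "l \<le> M" "beta d M l = 2 * (beta d M (2 * i + 2) div 2) + 1"
        "1 \<le> l'" "l' \<le> M" "beta d M l' = 2 * (beta d M (2 * i + 1) div 2)"
        using rows[OF i] in_beta in_beta' beta_set by metis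
      from beta_pair_special[OF pd i this refl refl] show ?thesis unfolding b e by simp
    next
      assume "B' = prod.swap C'"
      then have fst: "fst B' = snd C'" by simp
      have "\<exists>l. 1 \<le> l \<and> l \<le> M \<and> beta d M l = 2 * (beta d M (2 * j + 1) div 2) + 1"
        if "2 * j + 2 \<le> M" for j
        using beta_set[OF in_beta] rows(2)[OF that] unfolding fst by blast
      from beta_pair_exchanged[OF d M(1,2) this i]
      have tied: "beta d M (2 * i + 1) div 2 = beta d M (2 * i + 2) div 2" by blast
      show ?thesis using beta_pair_tied[OF pd i tied] tied unfolding b e by simp
    qed
  qed
  show ?thesis
  proof (rule partition_eqI[OF pd special_partition[OF p bal]])
    fix k :: nat assume k: "1 \<le> k"
    show "part d k = part (special_partition p) k"
    proof (cases "k \<le> M")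
      case True
      then obtain i where "2 * i + 2 \<le> M" "k = 2 * i + 1 \<or> k = 2 * i + 2"
        using pair_index k M(1) by metis
      then have "beta d M k = beta (special_partition p) M k" using pair by auto
      then show ?thesis using True by (simp add: beta_def)
    next
      case False
      moreover obtain m where "M = 2 * m" using M(1) by (elim evenE)
      ultimately show ?thesis
        using M L k special_part_eq_0[OF p, of m k]
        by (simp add: part_special_partition[OF p bal] part_eq_0)
    qed
  qed
qed

lemma special_symbol_exists:
  "\<exists>S T. D_symbol_of_domino p S \<and> D_symbol_of_type_D (special_partition p) T \<and>
     special_D_symbol T \<and> same_entries S T"
proof -
  let ?b = "special_partition p"
  have b: "is_partition (2 * n) ?b" using special_partition[OF p bal] .
  obtain m where m: "length ?b = 2 * m" using even_length_special_partition[OF p bal] by (elim evenE)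
  have lp: "length p \<le> 2 * m" using length_le_special_partition[OF p bal] m by simp
  define K where "K = 2 * m"
  define e where "e l = beta ?b K l div 2" for l
  \<comment> \<open>The largest entry goes to the lower row, the next to the upper row, and so on,
    as interlacing demands; \<open>rev\<close> makes the rows increasing.\<close>
  define lb ub where "lb = rev (map (\<lambda>i. e (2 * i + 2)) [0..<m])"
    and "ub = rev (map (\<lambda>i. e (2 * i + 1)) [0..<m])"
  \<comment> \<open>Two steps lower a beta number by at least 2, hence its half by at least
    1.\<close>
  have e_less: "e j < e i" if "1 \<le> i" "i + 2 \<le> j" "j \<le> K" for i j
  proof -
    have "beta ?b K j < beta ?b K (Suc i)" "beta ?b K (Suc i) < beta ?b K i"
      using beta_less[OF b] that by auto
    then show ?thesis unfolding e_def by simp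
  qed
  have e_le: "e j \<le> e i" if "1 \<le> i" "i \<le> j" "j \<le> K" for i j
    using beta_less[OF b, of i j K] that unfolding e_def
    by (cases "i = j") (auto intro: div_le_mono)
  have bp: "beta ?b K (2 * i + 1) = (if e (2 * i + 1) = e (2 * i + 2) then 2 * e (2 * i + 1) + 1 else 2 * e (2 * i + 1)) \<and>
      beta ?b K (2 * i + 2) = (if e (2 * i + 1) = e (2 * i + 2) then 2 * e (2 * i + 2) else 2 * e (2 * i + 2) + 1)"
    if "i < m" for i
    using beta_special_partition[of K i] beta_special_partition_div[of K "2 * i + 1"]
      beta_special_partition_div[of K "2 * i + 2"] that
    by (simp add: K_def e_def)
  have arr: "is_D_array (lb, ub)"
    unfolding is_D_array_def lb_def ub_def fst_conv snd_conv sorted_wrt_rev sorted_wrt_map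
    by (auto simp: K_def sorted_wrt_iff_nth_less intro!: e_less)
  have "image_mset (\<lambda>x. 2 * x + 1) (mset lb) + image_mset (\<lambda>x. 2 * x) (mset ub) =
      mset (map (\<lambda>i. beta ?b K (2 * i + 1)) [0..<m]) + mset (map (\<lambda>i. beta ?b K (2 * i + 2)) [0..<m])"
  proof -
    have "image_mset (\<lambda>x. 2 * x + 1) (mset (map (\<lambda>i. e (2 * i + 2)) [0..<k])) +
        image_mset (\<lambda>x. 2 * x) (mset (map (\<lambda>i. e (2 * i + 1)) [0..<k])) =
        mset (map (\<lambda>i. beta ?b K (2 * i + 1)) [0..<k]) + mset (map (\<lambda>i. beta ?b K (2 * i + 2)) [0..<k])"
      if "k \<le> m" for k
      using that
    proof (induction k)
      case (Suc k)
      have "{#2 * e (2 * k + 2) + 1#} + {#2 * e (2 * k + 1)#} =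
          {#beta ?b K (2 * k + 1)#} + {#beta ?b K (2 * k + 2)#}"
        using bp[of k] Suc.prems by (auto simp: add_mset_commute)
      with Suc show ?case by (simp add: union_ac add_mset_commute)
    qed simp
    from this[of m] show ?thesis by (simp add: lb_def ub_def)
  qed
  then have rows_b: "image_mset (\<lambda>x. 2 * x + 1) (mset lb) + image_mset (\<lambda>x. 2 * x) (mset ub) =
      mset (map (beta ?b K) [1..<Suc K])"
    unfolding K_def mset_upt_pairs .
  then have beta_b: "beta_rows ?b K (lb, ub)"
    using arr m unfolding beta_rows_def K_def by simp
  define T where "T = D_symbol (lb, ub)"
  have T: "D_symbol_of_type_D ?b T"
    unfolding D_symbol_of_type_D_def T_def
  proof (intro conjI exI)
    show "even (length ?b)" using m by simp
    show "image_mset (\<lambda>x. 2 * x + 1) (mset lb) + image_mset (\<lambda>x. 2 * x) (mset ub)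
       = mset (map (\<lambda>l. part ?b l + length ?b - l) [1..<Suc (length ?b)])"
      using rows_b unfolding beta_def K_def m .
  qed (use arr in auto)
  have "interlaced (lb, ub)"
    unfolding interlaced_def
  proof (intro allI impI conjI)
    fix i assume "i < length (fst (lb, ub))"
    then have i: "i < m" by (simp add: lb_def)
    then have nth: "lb ! i = e (2 * (m - Suc i) + 2)" "ub ! i = e (2 * (m - Suc i) + 1)"
      by (simp_all add: lb_def ub_def rev_nth)
    show "fst (lb, ub) ! i \<le> snd (lb, ub) ! i"
      using i unfolding nth fst_conv snd_conv by (intro e_le) (auto simp: K_def)
    assume "Suc i < length (fst (lb, ub))"
    then have si: "Suc i < m" by (simp add: lb_def)
    then have "lb ! Suc i = e (2 * (m - Suc (Suc i)) + 2)" by (simp add: lb_def rev_nth)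
    then show "snd (lb, ub) ! i \<le> fst (lb, ub) ! Suc i"
      using si unfolding nth fst_conv snd_conv by (simp add: K_def) (intro e_le, auto simp: K_def)
  qed
  moreover have "(lb, ub) \<in> T" using arr by (simp add: T_def D_symbol_def)
  ultimately have sp: "special_D_symbol T"
    using arr unfolding special_D_symbol_def is_D_symbol_def T_def by blast
  define f where "f k = part p k + 2 * m + 1 - k" for k
  define xs where "xs = map f [1..<2 * m + 2]"
  have f_less: "f j < f i" if "1 \<le> i" "i < j" "j < 2 * m + 2" for i j
    using part_antimono[OF p that(1), of j] that by (simp add: f_def)
  have desc: "sorted_wrt (>) xs"
    unfolding xs_def by (auto simp: sorted_wrt_iff_nth_less simp del: upt_Suc intro!: f_less)
  define ls us where "ls = rev (map (\<lambda>x. x div 2) (filter even xs))"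
    and "us = rev (map (\<lambda>x. x div 2) (filter odd xs))"
  have "sorted_wrt (>) (filter even xs)" "sorted_wrt (>) (filter odd xs)"
    using desc by (rule sorted_wrt_filter)+
  then have sorted: "sorted_wrt (<) ls" "sorted_wrt (<) us"
    unfolding ls_def us_def sorted_wrt_rev sorted_wrt_map
    by (auto elim!: sorted_wrt_mono_rel[rotated] elim!: evenE oddE)
  have "image_mset (\<lambda>x. 2 * (x div 2)) (filter_mset even (mset xs)) = image_mset id (filter_mset even (mset xs))"
    "image_mset (\<lambda>x. Suc (2 * (x div 2))) (filter_mset odd (mset xs)) = image_mset id (filter_mset odd (mset xs))"
    by (rule image_mset_cong; simp)+
  then have "image_mset (\<lambda>x. 2 * x) (mset ls) = filter_mset even (mset xs)"
    "image_mset (\<lambda>x. 2 * x + 1) (mset us) = filter_mset odd (mset xs)"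
    unfolding ls_def us_def
    by (simp_all add: multiset.map_comp comp_def)
  then have rows_p: "image_mset (\<lambda>x. 2 * x) (mset ls) + image_mset (\<lambda>x. 2 * x + 1) (mset us) = mset xs"
    using multiset_partition[of "mset xs" even] by simp
  have len: "length ls = m + 1" "length us = m"
  proof -
    \<comment> \<open>Even beta numbers come from even parts in odd rows and odd parts in even rows.
      By balance there are \<open>m\<close> of them among the first \<open>2 * m\<close>; the last
      one, which is 0, makes the upper row longer by one.\<close>
    have cnt: "length (filter even (map f [1..<Suc (2 * k)])) + (\<Sum>i<k. of_bool (odd (part p (Suc (2 * i))))) =
        k + (\<Sum>i<k. of_bool (odd (part p (Suc (Suc (2 * i))))))" if "k \<le> m" for k
      using that
    proof (induction k)
      case (Suc k)
      have "f (Suc (2 * k)) = part p (Suc (2 * k)) + 2 * (m - k)"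
        "f (Suc (Suc (2 * k))) + 1 = part p (Suc (Suc (2 * k))) + 2 * (m - k)"
        using Suc.prems by (auto simp: f_def)
      then have "even (f (Suc (2 * k))) \<longleftrightarrow> even (part p (Suc (2 * k)))"
        "even (f (Suc (Suc (2 * k)))) \<longleftrightarrow> odd (part p (Suc (Suc (2 * k))))"
        by presburger+
      with Suc show ?case by simp
    qed simp
    have "length (filter even (map f [1..<Suc (2 * m)])) = m"
      using cnt[of m] sum_parity_signs[OF p bal lp] by simp
    moreover have "f (2 * m + 1) = 0" using lp by (simp add: f_def part_eq_0)
    moreover have xs: "xs = map f [1..<Suc (2 * m)] @ [f (2 * m + 1)]" by (simp add: xs_def)
    ultimately have "length (filter even xs) = m + 1" by (simp del: upt_Suc)
    moreover have "length (filter even xs) + length (filter odd xs) = 2 * m + 1"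
      using sum_length_filter_compl[of even xs] by (simp add: xs_def)
    ultimately show "length ls = m + 1" "length us = m" by (simp_all add: ls_def us_def)
  qed
  define A where "A = (ls, 0 # map Suc us)"
  have S: "D_symbol_of_domino p (D_symbol A)"
    unfolding D_symbol_of_domino_def A_def
    using lp len sorted rows_p unfolding xs_def f_def
    by (intro exI[of _ m] exI[of _ ls] exI[of _ us]) simp
  have beta_p: "beta_rows p (K + 2) A"
    unfolding K_def A_def
    by (rule beta_rows_domino) (use lp len sorted rows_p in \<open>auto simp: xs_def f_def[abs_def] simp del: upt_Suc\<close>)
  \<comment> \<open>One shift gives \<open>(lb, ub)\<close> the same \<open>m + 1\<close> columns as
    \<open>A\<close>, so that the entries can be compared.\<close>
  have beta_b': "beta_rows ?b (K + 2) (shift_array (lb, ub))"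
    using beta_rows_shift[OF beta_b] by simp
  have "map (\<lambda>l. beta p (K + 2) l div 2) [1..<Suc (K + 2)] =
      map (\<lambda>l. beta ?b (K + 2) l div 2) [1..<Suc (K + 2)]"
    using beta_special_partition_div[of "K + 2"] by (auto simp: K_def simp del: upt_Suc)
  then have "entries A = entries (shift_array (lb, ub))"
    unfolding entries_beta_rows[OF beta_p] entries_beta_rows[OF beta_b'] by (rule arg_cong)
  moreover have "A \<in> D_symbol A" using beta_p by (simp add: D_symbol_def beta_rows_def)
  moreover have "shift_array (lb, ub) \<in> T"
    using is_D_array_shift[OF arr] equivclp_shift_array by (simp add: T_def D_symbol_def)
  ultimately have "same_entries (D_symbol A) T" unfolding same_entries_def by blast
  with S T sp show ?thesis by blast
qed

lemma attached_special_D_eq: "attached_special_D n p = special_partition p"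
  unfolding attached_special_D_def
proof (rule the_equality)
  show "is_type_D n (special_partition p) \<and> (\<exists>S T. D_symbol_of_domino p S \<and>
      D_symbol_of_type_D (special_partition p) T \<and> special_D_symbol T \<and> same_entries S T)"
    using special_partition_type_D[OF p bal] special_symbol_exists by blast
  show "b = special_partition p"
    if "is_type_D n b \<and> (\<exists>S T. D_symbol_of_domino p S \<and> D_symbol_of_type_D b T \<and>
      special_D_symbol T \<and> same_entries S T)" for b
    using that special_symbol_unique by blast
qed

end

theorem lemma8p17:
  fixes n :: nat and p :: "nat list"
  assumes "domino_type n p"
  shows "H_metaplectic n p = metaplectic_special n p \<and>
         is_type_C n (metaplectic_special n p)"
proof -
  have p: "is_partition (2 * n) p" using assms by (simp add: domino_type_def)
  have bal: "imbalance (\<lambda>i. part p (Suc i)) = 0" using domino_type_imbalance[OF assms] .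
  have "metaplectic_special n p = metaplectic_partition p"
    unfolding metaplectic_special_def attached_special_D_eq[OF p bal]
    by (rule conjugate_D_collapse_special[OF p bal])
  then show ?thesis
    using H_metaplectic_eq[OF p bal] metaplectic_partition_type_C[OF p bal] by simp
qed

end
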